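(* For any $l\in\mathbb{Z}_{>0}$ there is an equivalence of categories $\mathbb{E}:\mathrm{HC}_l(\mathfrak{g},K)\to\mathrm{Rep}(\mathfrak{A})$, given on the level of objects by assigning to $M$ the representation of the Gelfand quiver $$V_-=M_{-l-1},\quad V_\ast=M_{-l+1},\quad V_+=M_{l+1},$$ $$A_-=X_-:V_-\to V_\ast,\quad B_-=Y_-:V_\ast\to V_-,\quad A_+=X_\ast^{-1}Y_+:V_+\to V_\ast,\quad B_+=X_+X_\ast:V_\ast\to V_+,$$ where $X_-=X|_{M_{-l-1}}$, $X_+=X|_{M_{l-1}}$, $Y_-=Y|_{M_{-l+1}}$, $Y_+=Y|_{M_{l+1}}$, and $X_\ast=X^{l-1}|_{M_{-l+1}}:M_{-l+1}\to M_{l-1}$ (an isomorphism).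
   Context: $G=\mathrm{SL}_2(\mathbb{R})$, $K=\mathrm{SO}_2(\mathbb{R})$, $\mathfrak{g}=\mathrm{Lie}(G)\otimes_{\mathbb R}\mathbb{C}$ with basis $H=\begin{pmatrix}0&-i\\i&0\end{pmatrix}$, $X=\frac12\begin{pmatrix}1&i\\i&-1\end{pmatrix}$, $Y=\frac12\begin{pmatrix}1&-i\\-i&-1\end{pmatrix}$, so $[H,X]=2X$, $[H,Y]=-2Y$, $[X,Y]=H$. Casimir element: $C=H^2-2H+4XY\in U(\mathfrak{g})$. A $(\mathfrak{g},K)$-module is a complex vector space $M$ with a $\mathfrak{g}$-action and a locally smooth $K$-action such that $\mathrm{Ad}_k(Z)v=k(Z(k^{-1}v))$ for $k\in K$, $Z\in\mathfrak{g}$, $v\in M$, and such that the differential of the $K$-action is the restriction of the $\mathfrak{g}$-action to the complexified Lie algebra of $K$. Put $M_n=\{v\in M:Hv=nv\}$. $M$ is a Harish-Chandra module if it is finitely generated over $U(\mathfrak{g})$ and $M=\bigoplus_{n\in\mathbb{Z}}M_n$ with all $M_n$ finite dimensional. For $l\in\mathbb{Z}_{>0}$, $\mathrm{HC}_l(\mathfrak{g},K)$ is the full subcategory of the category of Harish-Chandra modules consisting of those $M$ with $M=\bigoplus_{i\in\mathbb{Z}}M_{-l-1+2i}$ for which there is an integer $m>0$ with $(C-(l^2-1))^mM=0$. Let $\mathfrak{D}=\mathbb{C}[[t]]$, $\mathfrak{m}=(t)$, $\mathfrak{A}=\begin{pmatrix}\mathfrak{D}&\mathfrak{m}&\mathfrak{m}\\\mathfrak{D}&\mathfrak{D}&\mathfrak{m}\\\mathfrak{D}&\mathfrak{m}&\mathfrak{D}\end{pmatrix}\subset\mathrm{Mat}_{3\times3}(\mathfrak{D})$,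 and let $\mathrm{Rep}(\mathfrak{A})$ be the category of finite dimensional left $\mathfrak{A}$-modules. It is identified with the category of finite dimensional nilpotent representations $(V_-,V_\ast,V_+,A_\pm:V_\pm\to V_\ast,B_\pm:V_\ast\to V_\pm)$, $A_-B_-=A_+B_+$, of the Gelfand quiver (vertices $-,\ast,+$, arrows $a_\pm:\pm\to\ast$, $b_\pm:\ast\to\pm$, relation $a_-b_-=a_+b_+$), via $a_-\mapsto tE_{12}$, $a_+\mapsto tE_{13}$, $b_-\mapsto E_{21}$, $b_+\mapsto E_{31}$ (positions $1,2,3$ corresponding to $\ast,-,+$); nilpotent means that all sufficiently long paths act as zero. *)

theory Defs
  imports
    "HOL-Analysis.Analysis"
    "HOL-Library.FuncSet"
    "HOL-Library.Numeral_Type"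
    "HOL-Computational_Algebra.Formal_Power_Series"
    "HOL-Algebra.Module"
    "HOL-Algebra.Algebraic_Closure_Type"
begin

section \<open>Categories, functors and equivalences\<close>

record ('o, 'm) cat =
  Obj :: "'o set"
  Hom :: "'o \<Rightarrow> 'o \<Rightarrow> 'm set"
  Cmp :: "'o \<Rightarrow> 'o \<Rightarrow> 'o \<Rightarrow> 'm \<Rightarrow> 'm \<Rightarrow> 'm"
  Idn :: "'o \<Rightarrow> 'm"

text \<open>\<open>Cmp C x y z g f\<close> is the composite of \<open>f : x \<rightarrow> y\<close> and \<open>g : y \<rightarrow> z\<close>; the objects are passed
  along because a morphism does not record its source and target.\<close>

definition is_category :: "('o, 'm) cat \<Rightarrow> bool" where
  "is_category C \<longleftrightarrow>
     (\<forall>x\<in>Obj C. Idn C x \<in> Hom C x x) \<and>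
     (\<forall>x\<in>Obj C. \<forall>y\<in>Obj C. \<forall>z\<in>Obj C. \<forall>f\<in>Hom C x y. \<forall>g\<in>Hom C y z.
        Cmp C x y z g f \<in> Hom C x z) \<and>
     (\<forall>x\<in>Obj C. \<forall>y\<in>Obj C. \<forall>f\<in>Hom C x y.
        Cmp C x x y f (Idn C x) = f \<and> Cmp C x y y (Idn C y) f = f) \<and>
     (\<forall>w\<in>Obj C. \<forall>x\<in>Obj C. \<forall>y\<in>Obj C. \<forall>z\<in>Obj C.
        \<forall>f\<in>Hom C w x. \<forall>g\<in>Hom C x y. \<forall>h\<in>Hom C y z.
        Cmp C w y z h (Cmp C w x y g f) = Cmp C w x z (Cmp C x y z h g) f)"

definition full_subcat :: "('o, 'm) cat \<Rightarrow> ('o \<Rightarrow> bool) \<Rightarrow> ('o, 'm) cat" where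
  "full_subcat C P = C\<lparr>Obj := {x \<in> Obj C. P x}\<rparr>"

definition is_iso :: "('o, 'm) cat \<Rightarrow> 'o \<Rightarrow> 'o \<Rightarrow> 'm \<Rightarrow> bool" where
  "is_iso C x y f \<longleftrightarrow> f \<in> Hom C x y \<and>
     (\<exists>g\<in>Hom C y x. Cmp C x y x g f = Idn C x \<and> Cmp C y x y f g = Idn C y)"

record ('o, 'm, 'p, 'n) cat_functor =
  on_obj :: "'o \<Rightarrow> 'p"
  on_mor :: "'o \<Rightarrow> 'o \<Rightarrow> 'm \<Rightarrow> 'n"

definition is_functor ::
  "('o, 'm) cat \<Rightarrow> ('p, 'n) cat \<Rightarrow> ('o, 'm, 'p, 'n) cat_functor \<Rightarrow> bool" where
  "is_functor C D F \<longleftrightarrow> is_category C \<and> is_category D \<and>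
     (\<forall>x\<in>Obj C. on_obj F x \<in> Obj D) \<and>
     (\<forall>x\<in>Obj C. \<forall>y\<in>Obj C. \<forall>f\<in>Hom C x y.
        on_mor F x y f \<in> Hom D (on_obj F x) (on_obj F y)) \<and>
     (\<forall>x\<in>Obj C. on_mor F x x (Idn C x) = Idn D (on_obj F x)) \<and>
     (\<forall>x\<in>Obj C. \<forall>y\<in>Obj C. \<forall>z\<in>Obj C. \<forall>f\<in>Hom C x y. \<forall>g\<in>Hom C y z.
        on_mor F x z (Cmp C x y z g f) =
        Cmp D (on_obj F x) (on_obj F y) (on_obj F z) (on_mor F y z g) (on_mor F x y f))"

definition id_functor :: "('o, 'm, 'o, 'm) cat_functor" where
  "id_functor = \<lparr>on_obj = (\<lambda>x. x), on_mor = (\<lambda>x y f. f)\<rparr>"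

definition comp_functor ::
  "('p, 'n, 'q, 'k) cat_functor \<Rightarrow> ('o, 'm, 'p, 'n) cat_functor \<Rightarrow> ('o, 'm, 'q, 'k) cat_functor" where
  "comp_functor G F =
     \<lparr>on_obj = (\<lambda>x. on_obj G (on_obj F x)),
      on_mor = (\<lambda>x y f. on_mor G (on_obj F x) (on_obj F y) (on_mor F x y f))\<rparr>"

definition naturally_isomorphic ::
  "('o, 'm) cat \<Rightarrow> ('p, 'n) cat \<Rightarrow> ('o, 'm, 'p, 'n) cat_functor \<Rightarrow> ('o, 'm, 'p, 'n) cat_functor \<Rightarrow> bool" where
  "naturally_isomorphic C D F G \<longleftrightarrow>
     (\<exists>\<eta>. (\<forall>x\<in>Obj C. is_iso D (on_obj F x) (on_obj G x) (\<eta> x)) \<and>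
       (\<forall>x\<in>Obj C. \<forall>y\<in>Obj C. \<forall>f\<in>Hom C x y.
          Cmp D (on_obj F x) (on_obj F y) (on_obj G y) (\<eta> y) (on_mor F x y f) =
          Cmp D (on_obj F x) (on_obj G x) (on_obj G y) (on_mor G x y f) (\<eta> x)))"

definition is_equivalence ::
  "('o, 'm) cat \<Rightarrow> ('p, 'n) cat \<Rightarrow> ('o, 'm, 'p, 'n) cat_functor \<Rightarrow> bool" where
  "is_equivalence C D F \<longleftrightarrow> is_functor C D F \<and>
     (\<exists>G. is_functor D C G \<and>
        naturally_isomorphic C C (comp_functor G F) id_functor \<and>
        naturally_isomorphic D D (comp_functor F G) id_functor)"


section \<open>Complex vector spaces with carrier in a type\<close>

text \<open>Vector spaces and modules are records over the set-based library notion of a module, with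
  carrier a subset of an arbitrary type \<open>'u\<close>, which plays the role of the universe.  (The fields
  \<open>mult\<close> and \<open>one\<close> of the library record have no meaning for a module.)  As soon as \<open>'u\<close> has
  at least the cardinality of the continuum, every complex vector space of at most countable
  dimension, hence every Harish-Chandra module, is isomorphic to one with carrier in \<open>'u\<close>.
  Morphisms are extensional functions, so that they are equal iff they agree on the carrier.\<close>

abbreviation CC :: "complex ring" where
  "CC \<equiv> ring_of_type_algebra"

definition linear_map ::
  "('r, 's) ring_scheme \<Rightarrow> ('r, 'u, 'a) module_scheme \<Rightarrow> ('r, 'w, 'b) module_scheme \<Rightarrow> ('u \<Rightarrow> 'w) \<Rightarrow> bool" where
  "linear_map R M N f \<longleftrightarrow> f \<in> carrier M \<rightarrow> carrier N \<and>
     (\<forall>v\<in>carrier M. \<forall>w\<in>carrier M. f (v \<oplus>\<^bsub>M\<^esub> w) = f v \<oplus>\<^bsub>N\<^esub> f w) \<and>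
     (\<forall>r\<in>carrier R. \<forall>v\<in>carrier M. f (r \<odot>\<^bsub>M\<^esub> v) = r \<odot>\<^bsub>N\<^esub> f v)"

definition fd_subspace :: "(complex, 'u, 'a) module_scheme \<Rightarrow> 'u set \<Rightarrow> bool" where
  "fd_subspace M W \<longleftrightarrow> submodule W CC M \<and>
     (\<exists>B\<subseteq>W. finite B \<and> (\<forall>v\<in>W. \<exists>c. v = (\<Oplus>\<^bsub>M\<^esub>b\<in>B. c b \<odot>\<^bsub>M\<^esub> b)))"

definition dual_space :: "(complex, 'u, 'a) module_scheme \<Rightarrow> 'u set \<Rightarrow> ('u \<Rightarrow> complex) set" where
  "dual_space M W = {\<phi>.
     (\<forall>v\<in>W. \<forall>w\<in>W. \<phi> (v \<oplus>\<^bsub>M\<^esub> w) = \<phi> v + \<phi> w) \<and>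
     (\<forall>c. \<forall>v\<in>W. \<phi> (c \<odot>\<^bsub>M\<^esub> v) = c * \<phi> v)}"

definition internal_direct_sum :: "(complex, 'u, 'a) module_scheme \<Rightarrow> (int \<Rightarrow> 'u set) \<Rightarrow> bool" where
  "internal_direct_sum M W \<longleftrightarrow> (\<forall>i. submodule (W i) CC M) \<and>
     (\<forall>v\<in>carrier M. \<exists>!f. (\<forall>i. f i \<in> W i) \<and> finite {i. f i \<noteq> \<zero>\<^bsub>M\<^esub>} \<and>
        v = (\<Oplus>\<^bsub>M\<^esub>i\<in>{i. f i \<noteq> \<zero>\<^bsub>M\<^esub>}. f i))"

text \<open>A subspace as a vector space of its own.  The operations are cut down to the subspace, so
  that equality of such records is equality of vector spaces.\<close>

definition vspace_on :: "(complex, 'u, 'a) module_scheme \<Rightarrow> 'u set \<Rightarrow> (complex, 'u) module" where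
  "vspace_on M W =
     \<lparr>carrier = W, mult = undefined, one = undefined, zero = \<zero>\<^bsub>M\<^esub>,
      add = (\<lambda>v\<in>W. \<lambda>w\<in>W. v \<oplus>\<^bsub>M\<^esub> w), smult = (\<lambda>c. \<lambda>v\<in>W. c \<odot>\<^bsub>M\<^esub> v)\<rparr>"


section \<open>\<open>(\<gg>, K)\<close>-modules for \<open>SL\<^sub>2(\<real>)\<close>\<close>

type_synonym cmat2 = "complex^2^2"
type_synonym rmat2 = "real^2^2"

text \<open>\<open>Lie(SL\<^sub>2(\<real>)) \<otimes> \<complex>\<close> is identified with the traceless complex matrices.\<close>

definition sl2c :: "cmat2 set" where
  "sl2c = {Z. trace Z = 0}"

definition lie_bracket :: "cmat2 \<Rightarrow> cmat2 \<Rightarrow> cmat2" where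
  "lie_bracket Z W = Z ** W - W ** Z"

definition H_mat :: cmat2 where
  "H_mat = vector [vector [0, - \<i>], vector [\<i>, 0]]"

definition X_mat :: cmat2 where
  "X_mat = vector [vector [1/2, \<i>/2], vector [\<i>/2, - 1/2]]"

definition Y_mat :: cmat2 where
  "Y_mat = vector [vector [1/2, - \<i>/2], vector [- \<i>/2, - 1/2]]"

definition SO2 :: "rmat2 set" where
  "SO2 = {k. orthogonal_matrix k \<and> det k = 1}"

definition rot :: "real \<Rightarrow> rmat2" where
  "rot \<theta> = vector [vector [cos \<theta>, - sin \<theta>], vector [sin \<theta>, cos \<theta>]]"

text \<open>\<open>Lie(K)\<close> consists of the real multiples of \<open>J_mat\<close>, and \<open>rot \<theta>\<close> is the exponential of
  \<open>\<theta>\<close> times \<open>J_mat\<close>.\<close>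

definition J_mat :: rmat2 where
  "J_mat = vector [vector [0, - 1], vector [1, 0]]"

definition complexify :: "rmat2 \<Rightarrow> cmat2" where
  "complexify k = map_matrix complex_of_real k"

definition Ad :: "rmat2 \<Rightarrow> cmat2 \<Rightarrow> cmat2" where
  "Ad k Z = complexify k ** Z ** complexify (matrix_inv k)"

record 'u gk_module = "(complex, 'u) module" +
  gact :: "cmat2 \<Rightarrow> 'u \<Rightarrow> 'u"
  kact :: "rmat2 \<Rightarrow> 'u \<Rightarrow> 'u"

definition lie_action :: "'u gk_module \<Rightarrow> bool" where
  "lie_action M \<longleftrightarrow>
     (\<forall>Z\<in>sl2c. linear_map CC M M (gact M Z)) \<and>
     (\<forall>Z\<in>sl2c. \<forall>W\<in>sl2c. \<forall>v\<in>carrier M. gact M (Z + W) v = gact M Z v \<oplus>\<^bsub>M\<^esub> gact M W v) \<and>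
     (\<forall>c. \<forall>Z\<in>sl2c. \<forall>v\<in>carrier M. gact M (map_matrix ((*) c) Z) v = c \<odot>\<^bsub>M\<^esub> gact M Z v) \<and>
     (\<forall>Z\<in>sl2c. \<forall>W\<in>sl2c. \<forall>v\<in>carrier M.
        gact M (lie_bracket Z W) v = gact M Z (gact M W v) \<ominus>\<^bsub>M\<^esub> gact M W (gact M Z v))"

definition group_action_K :: "'u gk_module \<Rightarrow> bool" where
  "group_action_K M \<longleftrightarrow>
     (\<forall>k\<in>SO2. linear_map CC M M (kact M k)) \<and>
     (\<forall>v\<in>carrier M. kact M (mat 1) v = v) \<and>
     (\<forall>k\<in>SO2. \<forall>k'\<in>SO2. \<forall>v\<in>carrier M. kact M (k ** k') v = kact M k (kact M k' v))"

definition smooth_fun :: "(real \<Rightarrow> complex) \<Rightarrow> bool" where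
  "smooth_fun f \<longleftrightarrow> (\<exists>D :: nat \<Rightarrow> real \<Rightarrow> complex. D 0 = f \<and>
     (\<forall>n x. (D n has_vector_derivative D (Suc n) x) (at x)))"

text \<open>Local smoothness: every vector lies in a finite dimensional \<open>K\<close>-stable subspace on which \<open>K\<close>
  acts smoothly.  A map into a finite dimensional space is smooth iff its composites with
  all linear functionals are, and a function on \<open>K\<close> is smooth iff its pullback along the local
  diffeomorphism \<open>rot\<close> is.\<close>

definition locally_smooth :: "'u gk_module \<Rightarrow> bool" where
  "locally_smooth M \<longleftrightarrow> (\<forall>v\<in>carrier M. \<exists>W. fd_subspace M W \<and> v \<in> W \<and>
     (\<forall>k\<in>SO2. \<forall>w\<in>W. kact M k w \<in> W) \<and>
     (\<forall>w\<in>W. \<forall>\<phi>\<in>dual_space M W. smooth_fun (\<lambda>\<theta>. \<phi> (kact M (rot \<theta>) w))))"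

text \<open>A curve contained in a finite dimensional subspace has derivative \<open>w\<close> at \<open>0\<close>.\<close>

definition has_derivative_at_0 ::
  "(complex, 'u, 'a) module_scheme \<Rightarrow> (real \<Rightarrow> 'u) \<Rightarrow> 'u \<Rightarrow> bool" where
  "has_derivative_at_0 M c w \<longleftrightarrow> (\<exists>W. fd_subspace M W \<and> range c \<subseteq> W \<and> w \<in> W \<and>
     (\<forall>\<phi>\<in>dual_space M W. ((\<lambda>t. \<phi> (c t)) has_vector_derivative \<phi> w) (at 0)))"

text \<open>The last condition says that the differential of the \<open>K\<close>-action at the element
  \<open>s\<close> times \<open>J_mat\<close> of \<open>Lie(K)\<close> is the action of that element of \<open>\<gg>\<close>; on the complexification of
  \<open>Lie(K)\<close> both sides are extended linearly.\<close>

definition is_gk_module :: "'u gk_module \<Rightarrow> bool" where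
  "is_gk_module M \<longleftrightarrow> Module.module CC M \<and> lie_action M \<and> group_action_K M \<and> locally_smooth M \<and>
     (\<forall>k\<in>SO2. \<forall>Z\<in>sl2c. \<forall>v\<in>carrier M.
        gact M (Ad k Z) v = kact M k (gact M Z (kact M (matrix_inv k) v))) \<and>
     (\<forall>s. \<forall>v\<in>carrier M.
        has_derivative_at_0 M (\<lambda>t. kact M (rot (t * s)) v) (gact M (complexify (s *\<^sub>R J_mat)) v))"

definition gk_hom :: "'u gk_module \<Rightarrow> 'u gk_module \<Rightarrow> ('u \<Rightarrow> 'u) set" where
  "gk_hom M N = {f \<in> extensional (carrier M). linear_map CC M N f \<and>
     (\<forall>Z\<in>sl2c. \<forall>v\<in>carrier M. f (gact M Z v) = gact N Z (f v)) \<and>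
     (\<forall>k\<in>SO2. \<forall>v\<in>carrier M. f (kact M k v) = kact N k (f v))}"

definition gk_cat :: "('u gk_module, 'u \<Rightarrow> 'u) cat" where
  "gk_cat = \<lparr>Obj = {M. is_gk_module M}, Hom = gk_hom,
     Cmp = (\<lambda>L M N g f. compose (carrier L) g f), Idn = (\<lambda>M. \<lambda>v\<in>carrier M. v)\<rparr>"


section \<open>Harish-Chandra modules\<close>

text \<open>The operators by which the elements of \<open>U(\<gg>)\<close> act on \<open>M\<close>: as \<open>U(\<gg>)\<close> is generated as a
  unital algebra by \<open>\<gg>\<close>, they form the unital algebra of operators generated by the action of \<open>\<gg>\<close>.\<close>

inductive_set U_operators :: "'u gk_module \<Rightarrow> ('u \<Rightarrow> 'u) set" for M :: "'u gk_module" where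
  one: "(\<lambda>v. v) \<in> U_operators M"
| lie: "Z \<in> sl2c \<Longrightarrow> gact M Z \<in> U_operators M"
| scale: "a \<in> U_operators M \<Longrightarrow> (\<lambda>v. c \<odot>\<^bsub>M\<^esub> a v) \<in> U_operators M"
| plus: "a \<in> U_operators M \<Longrightarrow> b \<in> U_operators M \<Longrightarrow> (\<lambda>v. a v \<oplus>\<^bsub>M\<^esub> b v) \<in> U_operators M"
| times: "a \<in> U_operators M \<Longrightarrow> b \<in> U_operators M \<Longrightarrow> (\<lambda>v. a (b v)) \<in> U_operators M"

definition finitely_generated_U :: "'u gk_module \<Rightarrow> bool" where
  "finitely_generated_U M \<longleftrightarrow> (\<exists>S\<subseteq>carrier M. finite S \<and>
     (\<forall>v\<in>carrier M. \<exists>a. (\<forall>s\<in>S. a s \<in> U_operators M) \<and> v = (\<Oplus>\<^bsub>M\<^esub>s\<in>S. a s s)))"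

definition weight_space :: "'u gk_module \<Rightarrow> int \<Rightarrow> 'u set" where
  "weight_space M n = {v \<in> carrier M. gact M H_mat v = of_int n \<odot>\<^bsub>M\<^esub> v}"

definition harish_chandra :: "'u gk_module \<Rightarrow> bool" where
  "harish_chandra M \<longleftrightarrow> is_gk_module M \<and> finitely_generated_U M \<and>
     internal_direct_sum M (weight_space M) \<and> (\<forall>n. fd_subspace M (weight_space M n))"

definition HC_cat :: "('u gk_module, 'u \<Rightarrow> 'u) cat" where
  "HC_cat = full_subcat gk_cat harish_chandra"

text \<open>The action of \<open>C = H\<^sup>2 - 2H + 4XY\<close>.\<close>

definition casimir :: "'u gk_module \<Rightarrow> 'u \<Rightarrow> 'u" where
  "casimir M v = (gact M H_mat (gact M H_mat v) \<ominus>\<^bsub>M\<^esub> 2 \<odot>\<^bsub>M\<^esub> gact M H_mat v)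
     \<oplus>\<^bsub>M\<^esub> 4 \<odot>\<^bsub>M\<^esub> gact M X_mat (gact M Y_mat v)"

definition in_HC_l :: "nat \<Rightarrow> 'u gk_module \<Rightarrow> bool" where
  "in_HC_l l M \<longleftrightarrow>
     internal_direct_sum M (\<lambda>i. weight_space M (- int l - 1 + 2 * i)) \<and>
     (\<exists>m>0. \<forall>v\<in>carrier M.
        ((\<lambda>w. casimir M w \<ominus>\<^bsub>M\<^esub> ((of_nat l)\<^sup>2 - 1) \<odot>\<^bsub>M\<^esub> w) ^^ m) v = \<zero>\<^bsub>M\<^esub>)"

definition HC_l_cat :: "nat \<Rightarrow> ('u gk_module, 'u \<Rightarrow> 'u) cat" where
  "HC_l_cat l = full_subcat HC_cat (in_HC_l l)"


section \<open>The order \<open>\<AA>\<close> and its finite dimensional modules\<close>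

type_synonym fmat3 = "complex fps^3^3"

definition order_A :: "fmat3 ring" where
  "order_A =
     \<lparr>carrier = {a. fps_X dvd a $ 1 $ 2 \<and> fps_X dvd a $ 1 $ 3 \<and> fps_X dvd a $ 2 $ 3 \<and> fps_X dvd a $ 3 $ 2},
      mult = (**), one = mat 1, zero = 0, add = (+)\<rparr>"

text \<open>The library locale \<open>module\<close> requires a commutative ring of scalars.\<close>

definition left_module :: "('r, 's) ring_scheme \<Rightarrow> ('r, 'u, 'a) module_scheme \<Rightarrow> bool" where
  "left_module R N \<longleftrightarrow> Ring.ring R \<and> abelian_group N \<and>
     (\<forall>a\<in>carrier R. \<forall>v\<in>carrier N. a \<odot>\<^bsub>N\<^esub> v \<in> carrier N) \<and>
     (\<forall>a\<in>carrier R. \<forall>b\<in>carrier R. \<forall>v\<in>carrier N. (a \<oplus>\<^bsub>R\<^esub> b) \<odot>\<^bsub>N\<^esub> v = a \<odot>\<^bsub>N\<^esub> v \<oplus>\<^bsub>N\<^esub> b \<odot>\<^bsub>N\<^esub> v) \<and>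
     (\<forall>a\<in>carrier R. \<forall>v\<in>carrier N. \<forall>w\<in>carrier N. a \<odot>\<^bsub>N\<^esub> (v \<oplus>\<^bsub>N\<^esub> w) = a \<odot>\<^bsub>N\<^esub> v \<oplus>\<^bsub>N\<^esub> a \<odot>\<^bsub>N\<^esub> w) \<and>
     (\<forall>a\<in>carrier R. \<forall>b\<in>carrier R. \<forall>v\<in>carrier N. (a \<otimes>\<^bsub>R\<^esub> b) \<odot>\<^bsub>N\<^esub> v = a \<odot>\<^bsub>N\<^esub> (b \<odot>\<^bsub>N\<^esub> v)) \<and>
     (\<forall>v\<in>carrier N. \<one>\<^bsub>R\<^esub> \<odot>\<^bsub>N\<^esub> v = v)"

text \<open>Restriction of scalars along \<open>\<complex> \<rightarrow> \<AA>\<close>.\<close>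

definition underlying_vspace :: "(fmat3, 'u) module \<Rightarrow> (complex, 'u) module" where
  "underlying_vspace N =
     \<lparr>carrier = carrier N, mult = undefined, one = undefined, zero = \<zero>\<^bsub>N\<^esub>, add = add N,
      smult = (\<lambda>c v. mat (fps_const c) \<odot>\<^bsub>N\<^esub> v)\<rparr>"

definition A_hom :: "(fmat3, 'u) module \<Rightarrow> (fmat3, 'u) module \<Rightarrow> ('u \<Rightarrow> 'u) set" where
  "A_hom N N' = {f \<in> extensional (carrier N). linear_map order_A N N' f}"

definition Rep_A :: "((fmat3, 'u) module, 'u \<Rightarrow> 'u) cat" where
  "Rep_A = \<lparr>Obj = {N. left_module order_A N \<and> fd_subspace (underlying_vspace N) (carrier N)},
     Hom = A_hom, Cmp = (\<lambda>L M N g f. compose (carrier L) g f), Idn = (\<lambda>N. \<lambda>v\<in>carrier N. v)\<rparr>"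


section \<open>Representations of the Gelfand quiver\<close>

record 'u gelfand_rep =
  V_minus :: "(complex, 'u) module"
  V_star :: "(complex, 'u) module"
  V_plus :: "(complex, 'u) module"
  A_minus :: "'u \<Rightarrow> 'u"
  B_minus :: "'u \<Rightarrow> 'u"
  A_plus :: "'u \<Rightarrow> 'u"
  B_plus :: "'u \<Rightarrow> 'u"

definition mat_elem :: "3 \<Rightarrow> 3 \<Rightarrow> complex fps \<Rightarrow> fmat3" where
  "mat_elem i j a = (\<chi> r s. if r = i \<and> s = j then a else 0)"

definition component :: "(fmat3, 'u) module \<Rightarrow> 3 \<Rightarrow> 'u set" where
  "component N i = (\<lambda>v. mat_elem i i 1 \<odot>\<^bsub>N\<^esub> v) ` carrier N"

text \<open>The quiver representation identified with an \<open>\<AA>\<close>-module; the positions \<open>1\<close>, \<open>2\<close>, \<open>3\<close> belong to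
  the vertices \<open>*\<close>, \<open>-\<close>, \<open>+\<close>.\<close>

definition quiver_rep_of :: "(fmat3, 'u) module \<Rightarrow> 'u gelfand_rep" where
  "quiver_rep_of N =
     \<lparr>V_minus = vspace_on (underlying_vspace N) (component N 2),
      V_star = vspace_on (underlying_vspace N) (component N 1),
      V_plus = vspace_on (underlying_vspace N) (component N 3),
      A_minus = (\<lambda>v\<in>component N 2. mat_elem 1 2 fps_X \<odot>\<^bsub>N\<^esub> v),
      B_minus = (\<lambda>v\<in>component N 1. mat_elem 2 1 1 \<odot>\<^bsub>N\<^esub> v),
      A_plus = (\<lambda>v\<in>component N 3. mat_elem 1 3 fps_X \<odot>\<^bsub>N\<^esub> v),
      B_plus = (\<lambda>v\<in>component N 1. mat_elem 3 1 1 \<odot>\<^bsub>N\<^esub> v)\<rparr>"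

definition X_star :: "nat \<Rightarrow> 'u gk_module \<Rightarrow> 'u \<Rightarrow> 'u" where
  "X_star l M = gact M X_mat ^^ (l - 1)"

definition gelfand_rep_of :: "nat \<Rightarrow> 'u gk_module \<Rightarrow> 'u gelfand_rep" where
  "gelfand_rep_of l M =
     (let Vm = weight_space M (- int l - 1);
          Vs = weight_space M (- int l + 1);
          Vp = weight_space M (int l + 1)
      in \<lparr>V_minus = vspace_on M Vm,
          V_star = vspace_on M Vs,
          V_plus = vspace_on M Vp,
          A_minus = (\<lambda>v\<in>Vm. gact M X_mat v),
          B_minus = (\<lambda>v\<in>Vs. gact M Y_mat v),
          A_plus = (\<lambda>v\<in>Vp. inv_into Vs (X_star l M) (gact M Y_mat v)),
          B_plus = (\<lambda>v\<in>Vs. gact M X_mat (X_star l M v))\<rparr>)"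

end

theory Submission
  imports Defs
begin

text \<open>On a module in \<open>HC\<^sub>l\<close> the operator \<open>T = (C - (l\<^sup>2 - 1)) / 4\<close> is nilpotent, and \<open>XY\<close> and \<open>YX\<close> act on
  every weight space as \<open>T\<close> plus a scalar.  The scalar vanishes only for the steps between the weights
  \<open>-l-1\<close> and \<open>-l+1\<close> and between \<open>l-1\<close> and \<open>l+1\<close>, so that \<open>X\<close> and \<open>Y\<close> are isomorphisms between
  neighbouring weight spaces everywhere else, and the module is determined by its weight spaces
  \<open>V\<^sub>-\<close>, \<open>V\<^sub>*\<close>, \<open>V\<^sub>+\<close>.  The functor takes the sum of these three subspaces, on which \<open>\<AA>\<close> acts through the
  quiver, with \<open>t\<close> acting as \<open>T\<close>.  It is full because a morphism on the three subspaces can be moved along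
  the isomorphisms; compatibility with \<open>K\<close> is automatic, as the differential forces \<open>K\<close> to act on each
  weight space by a power of one character.  It is essentially surjective because \<open>t\<close> is nilpotent on every finite
  dimensional \<open>\<AA>\<close>-module, and copies of the three components of such a module, strung together with
  \<open>X\<close> and \<open>Y\<close> acting by suitable elements of \<open>\<AA>\<close>, form a Harish-Chandra module.

  Identities between vectors are checked by applying linear functionals, which turns them into identities
  of complex numbers.\<close>

text \<open>The scalars are forced by \<open>C\<close>. On weight \<open>n\<close> its definition
  gives \<open>4XY = C - n^2 + 2n = 4T + l^2 - (n-1)^2\<close>, and with
  \<open>n = 2i - l - 1\<close> a quarter of \<open>l^2 - (n-1)^2\<close> is
  \<open>(i-1)(l+1-i)\<close>, which is \<open>kap l i\<close>. Since \<open>T\<close> is nilpotent,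
  power series in \<open>t\<close> act through \<open>T\<close>, and \<open>t + kap l i\<close> is
  an invertible series as soon as \<open>kap l i\<close> is nonzero; this provides the inverses of
  \<open>X\<close> and \<open>Y\<close>.

  Two requirements shape the constructions. The quiver representation of the image has to equal the
  prescribed one as a record, not only up to isomorphism; so the carrier of the image of
  \<open>M\<close> is a subset of \<open>M\<close>, the vectors whose components vanish outside the
  three weights. Moreover, all carriers live in one type \<open>'u\<close>, which has no room
  reserved for the functions from which a Harish-Chandra module is built out of an \<open>N\<close>
  in \<open>Rep_A\<close>; these functions are encoded in \<open>'u\<close>, which is infinite as
  soon as \<open>N\<close> is nonzero.\<close>

no_notation fps_nth (infixl "$" 75)

section \<open>Fully faithful and essentially surjective functors\<close>

lemma category_Idn:
  "is_category C \<Longrightarrow> x \<in> Obj C \<Longrightarrow> Idn C x \<in> Hom C x x"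
  by (auto simp: is_category_def)

lemma category_Cmp:
  "is_category C \<Longrightarrow> x \<in> Obj C \<Longrightarrow> y \<in> Obj C \<Longrightarrow> z \<in> Obj C \<Longrightarrow> f \<in> Hom C x y \<Longrightarrow> g \<in> Hom C y z
    \<Longrightarrow> Cmp C x y z g f \<in> Hom C x z"
  by (auto simp: is_category_def)

lemma category_Idn_left:
  "is_category C \<Longrightarrow> x \<in> Obj C \<Longrightarrow> y \<in> Obj C \<Longrightarrow> f \<in> Hom C x y \<Longrightarrow> Cmp C x y y (Idn C y) f = f"
  by (auto simp: is_category_def)

lemma category_Idn_right:
  "is_category C \<Longrightarrow> x \<in> Obj C \<Longrightarrow> y \<in> Obj C \<Longrightarrow> f \<in> Hom C x y \<Longrightarrow> Cmp C x x y f (Idn C x) = f"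
  by (auto simp: is_category_def)

lemma category_assoc:
  "is_category C \<Longrightarrow> w \<in> Obj C \<Longrightarrow> x \<in> Obj C \<Longrightarrow> y \<in> Obj C \<Longrightarrow> z \<in> Obj C
    \<Longrightarrow> f \<in> Hom C w x \<Longrightarrow> g \<in> Hom C x y \<Longrightarrow> h \<in> Hom C y z
    \<Longrightarrow> Cmp C w y z h (Cmp C w x y g f) = Cmp C w x z (Cmp C x y z h g) f"
  by (auto simp: is_category_def)

text \<open>The quasi-inverse picks for every \<open>d\<close> an object \<open>G0 d\<close> with an
  isomorphism \<open>e d\<close> from its image to \<open>d\<close>. A morphism of \<open>D\<close>
  is conjugated by these isomorphisms and lifted along fullness; faithfulness reduces the functor
  laws and naturality squares in \<open>C\<close> to identities in \<open>D\<close>.\<close>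

lemma is_equivalence_if_fully_faithful:
  fixes C :: "('o, 'm) cat" and D :: "('p, 'n) cat" and F :: "('o, 'm, 'p, 'n) cat_functor"
  assumes F: "is_functor C D F"
    and ff: "\<And>x y. x \<in> Obj C \<Longrightarrow> y \<in> Obj C \<Longrightarrow>
      bij_betw (on_mor F x y) (Hom C x y) (Hom D (on_obj F x) (on_obj F y))"
    and es: "\<And>d. d \<in> Obj D \<Longrightarrow> \<exists>x\<in>Obj C. \<exists>f. is_iso D (on_obj F x) d f"
  shows "is_equivalence C D F"
proof -
  let ?o = "on_obj F" and ?m = "on_mor F"
  have C: "is_category C" and D: "is_category D"
    and Fo: "\<And>x. x \<in> Obj C \<Longrightarrow> ?o x \<in> Obj D"
    and Fm: "\<And>x y f. x \<in> Obj C \<Longrightarrow> y \<in> Obj C \<Longrightarrow> f \<in> Hom C x y \<Longrightarrow> ?m x y f \<in> Hom D (?o x) (?o y)"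
    and FI: "\<And>x. x \<in> Obj C \<Longrightarrow> ?m x x (Idn C x) = Idn D (?o x)"
    and FC: "\<And>x y z f g. x \<in> Obj C \<Longrightarrow> y \<in> Obj C \<Longrightarrow> z \<in> Obj C \<Longrightarrow> f \<in> Hom C x y \<Longrightarrow> g \<in> Hom C y z \<Longrightarrow>
       ?m x z (Cmp C x y z g f) = Cmp D (?o x) (?o y) (?o z) (?m y z g) (?m x y f)"
    using F by (auto simp: is_functor_def)
  note CI = category_Idn[OF C] and CC = category_Cmp[OF C] and CA = category_assoc[OF C]
    and CL = category_Idn_left[OF C] and CR = category_Idn_right[OF C]
  note DI = category_Idn[OF D] and DC = category_Cmp[OF D] and DA = category_assoc[OF D]
    and DL = category_Idn_left[OF D] and DR = category_Idn_right[OF D]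
  have inj: "f = g" if "x \<in> Obj C" "y \<in> Obj C" "f \<in> Hom C x y" "g \<in> Hom C x y" "?m x y f = ?m x y g"
    for x y f g
    using ff[OF that(1,2)] that(3-5) by (auto simp: bij_betw_def inj_on_def)
  define lift where "lift x y k = (SOME f. f \<in> Hom C x y \<and> ?m x y f = k)" for x y k
  have lift: "lift x y k \<in> Hom C x y" "?m x y (lift x y k) = k"
    if "x \<in> Obj C" "y \<in> Obj C" "k \<in> Hom D (?o x) (?o y)" for x y k
  proof -
    have "\<exists>f. f \<in> Hom C x y \<and> ?m x y f = k"
      using ff[OF that(1,2)] that(3) unfolding bij_betw_def by (metis imageE)
    from someI_ex[OF this] show "lift x y k \<in> Hom C x y" "?m x y (lift x y k) = k"
      by (auto simp: lift_def)
  qed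
  from es obtain G0 e where G0: "\<And>d. d \<in> Obj D \<Longrightarrow> G0 d \<in> Obj C"
    and e: "\<And>d. d \<in> Obj D \<Longrightarrow> is_iso D (?o (G0 d)) d (e d)"
    by metis
  have eH: "\<And>d. d \<in> Obj D \<Longrightarrow> e d \<in> Hom D (?o (G0 d)) d"
    using e by (auto simp: is_iso_def)
  have "\<forall>d\<in>Obj D. \<exists>g\<in>Hom D d (?o (G0 d)). Cmp D (?o (G0 d)) d (?o (G0 d)) g (e d) = Idn D (?o (G0 d))
      \<and> Cmp D d (?o (G0 d)) d (e d) g = Idn D d"
    using e by (auto simp: is_iso_def)
  then obtain e' where e'H: "\<And>d. d \<in> Obj D \<Longrightarrow> e' d \<in> Hom D d (?o (G0 d))"
    and e'e: "\<And>d. d \<in> Obj D \<Longrightarrow> Cmp D (?o (G0 d)) d (?o (G0 d)) (e' d) (e d) = Idn D (?o (G0 d))"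
    and ee': "\<And>d. d \<in> Obj D \<Longrightarrow> Cmp D d (?o (G0 d)) d (e d) (e' d) = Idn D d"
    by metis
  note cl = G0 Fo eH e'H DC DI CC CI lift
  define cj where "cj d d' k = Cmp D (?o (G0 d)) d' (?o (G0 d')) (e' d') (Cmp D (?o (G0 d)) d d' k (e d))"
    for d d' k
  have cjH: "cj d d' k \<in> Hom D (?o (G0 d)) (?o (G0 d'))"
    if "d \<in> Obj D" "d' \<in> Obj D" "k \<in> Hom D d d'" for d d' k
    unfolding cj_def using that by (intro cl) auto
  have cj_e: "Cmp D (?o (G0 d)) (?o (G0 d')) d' (e d') (cj d d' k) = Cmp D (?o (G0 d)) d d' k (e d)"
    if "d \<in> Obj D" "d' \<in> Obj D" "k \<in> Hom D d d'" for d d' k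
  proof -
    have kH: "Cmp D (?o (G0 d)) d d' k (e d) \<in> Hom D (?o (G0 d)) d'"
      using that by (intro cl) auto
    show ?thesis unfolding cj_def
      using that kH by (subst DA) (auto simp: ee' DL cl intro!: cl)
  qed
  \<comment> \<open>\<open>e d\<close> is invertible, hence a monomorphism: identities between the
    conjugates \<open>cj\<close> may be tested after composition with \<open>e\<close>.\<close>
  have e_cancel: "f = g" if "d \<in> Obj D" "c \<in> Obj D" "f \<in> Hom D c (?o (G0 d))" "g \<in> Hom D c (?o (G0 d))"
    "Cmp D c (?o (G0 d)) d (e d) f = Cmp D c (?o (G0 d)) d (e d) g" for c d f g
  proof -
    have "f = Cmp D c d (?o (G0 d)) (e' d) (Cmp D c (?o (G0 d)) d (e d) f)"
      using that by (subst DA) (auto simp: e'e DL cl intro!: cl)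
    also have "\<dots> = Cmp D c d (?o (G0 d)) (e' d) (Cmp D c (?o (G0 d)) d (e d) g)" using that by simp
    also have "\<dots> = g" using that by (subst DA) (auto simp: e'e DL cl intro!: cl)
    finally show ?thesis .
  qed
  define G where "G = \<lparr>on_obj = G0, on_mor = (\<lambda>d d' k. lift (G0 d) (G0 d') (cj d d' k))\<rparr>"
  have G_simps: "on_obj G d = G0 d" "on_mor G d d' k = lift (G0 d) (G0 d') (cj d d' k)" for d d' k
    by (auto simp: G_def)
  have Gm: "on_mor G d d' k \<in> Hom C (G0 d) (G0 d')" "?m (G0 d) (G0 d') (on_mor G d d' k) = cj d d' k"
    if "d \<in> Obj D" "d' \<in> Obj D" "k \<in> Hom D d d'" for d d' k
    unfolding G_simps using that by (intro cl cjH; simp)+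
  have cj_Idn: "cj d d (Idn D d) = Idn D (?o (G0 d))" if d: "d \<in> Obj D" for d
    using d by (simp add: cj_def DL[OF Fo[OF G0] _ eH] e'e)
  have cj_Cmp: "cj d1 d3 (Cmp D d1 d2 d3 g f) = Cmp D (?o (G0 d1)) (?o (G0 d2)) (?o (G0 d3)) (cj d2 d3 g) (cj d1 d2 f)"
    if d: "d1 \<in> Obj D" "d2 \<in> Obj D" "d3 \<in> Obj D" and fg: "f \<in> Hom D d1 d2" "g \<in> Hom D d2 d3" for d1 d2 d3 f g
  proof (rule e_cancel[of d3 "?o (G0 d1)"])
    have gf: "Cmp D d1 d2 d3 g f \<in> Hom D d1 d3" using d fg by (intro cl)
    show "cj d1 d3 (Cmp D d1 d2 d3 g f) \<in> Hom D (?o (G0 d1)) (?o (G0 d3))" using d gf by (intro cjH)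
    show "Cmp D (?o (G0 d1)) (?o (G0 d2)) (?o (G0 d3)) (cj d2 d3 g) (cj d1 d2 f) \<in> Hom D (?o (G0 d1)) (?o (G0 d3))"
      using d fg by (intro cl cjH) 
    have "Cmp D (?o (G0 d1)) (?o (G0 d3)) d3 (e d3) (Cmp D (?o (G0 d1)) (?o (G0 d2)) (?o (G0 d3)) (cj d2 d3 g) (cj d1 d2 f))
      = Cmp D (?o (G0 d1)) (?o (G0 d2)) d3 (Cmp D (?o (G0 d2)) d2 d3 g (e d2)) (cj d1 d2 f)"
      using d fg by (subst DA) (auto simp: cj_e intro!: cl cjH)
    also have "\<dots> = Cmp D (?o (G0 d1)) d2 d3 g (Cmp D (?o (G0 d1)) d1 d2 f (e d1))"
      using d fg by (subst DA[symmetric]) (auto simp: cj_e intro!: cl cjH)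
    also have "\<dots> = Cmp D (?o (G0 d1)) d1 d3 (Cmp D d1 d2 d3 g f) (e d1)"
      using d fg by (subst DA) (auto intro!: cl)
    also have "\<dots> = Cmp D (?o (G0 d1)) (?o (G0 d3)) d3 (e d3) (cj d1 d3 (Cmp D d1 d2 d3 g f))"
      using d gf by (simp add: cj_e)
    finally show "Cmp D (?o (G0 d1)) (?o (G0 d3)) d3 (e d3) (cj d1 d3 (Cmp D d1 d2 d3 g f))
      = Cmp D (?o (G0 d1)) (?o (G0 d3)) d3 (e d3) (Cmp D (?o (G0 d1)) (?o (G0 d2)) (?o (G0 d3)) (cj d2 d3 g) (cj d1 d2 f))"
      by simp
  qed (use d in \<open>auto intro!: cl\<close>)
  have GF: "is_functor D C G"
    unfolding is_functor_def
  proof (intro conjI ballI)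
    fix d assume d: "d \<in> Obj D"
    show "on_mor G d d (Idn D d) = Idn C (on_obj G d)"
      using d Gm[OF d d DI[OF d]] by (intro inj[of "G0 d" "G0 d"]) (auto simp: G_simps(1) cj_Idn FI cl)
  next
    fix d1 d2 d3 f g assume d: "d1 \<in> Obj D" "d2 \<in> Obj D" "d3 \<in> Obj D" and fg: "f \<in> Hom D d1 d2" "g \<in> Hom D d2 d3"
    have gf: "Cmp D d1 d2 d3 g f \<in> Hom D d1 d3" using d fg by (intro cl)
    show "on_mor G d1 d3 (Cmp D d1 d2 d3 g f) =
       Cmp C (on_obj G d1) (on_obj G d2) (on_obj G d3) (on_mor G d2 d3 g) (on_mor G d1 d2 f)"
      using d fg gf by (intro inj[of "G0 d1" "G0 d3"]) (auto simp: G_simps(1) Gm FC cj_Cmp G0 intro!: G0 CC Gm)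
  qed (use C D in \<open>auto simp: G_simps(1) Gm(1) intro!: cl\<close>)
  have GFi: "naturally_isomorphic C C (comp_functor G F) id_functor"
    unfolding naturally_isomorphic_def
  \<comment> \<open>The component at \<open>x\<close> is the lift of the isomorphism chosen for the
    image of \<open>x\<close>; lifting the inverse isomorphism inverts it.\<close>
  proof (intro exI[where x = "\<lambda>x. lift (G0 (?o x)) x (e (?o x))"] conjI ballI)
    fix x assume x: "x \<in> Obj C"
    let ?y = "G0 (?o x)"
    let ?f = "lift ?y x (e (?o x))" and ?g = "lift x ?y (e' (?o x))"
    note o = x Fo[OF x] G0[OF Fo[OF x]]
    have fg: "?f \<in> Hom C ?y x" "?m ?y x ?f = e (?o x)" "?g \<in> Hom C x ?y" "?m x ?y ?g = e' (?o x)"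
      using o by (intro lift eH e'H; simp)+
    have "Cmp C ?y x ?y ?g ?f = Idn C ?y"
      by (rule inj[of ?y ?y]) (use o fg in \<open>auto simp: FC FI e'e intro!: CC CI\<close>)
    moreover have "Cmp C x ?y x ?f ?g = Idn C x"
      by (rule inj[of x x]) (use o fg in \<open>auto simp: FC FI ee' intro!: CC CI\<close>)
    ultimately show "is_iso C (on_obj (comp_functor G F) x) (on_obj id_functor x) ?f"
      using fg by (auto simp: is_iso_def comp_functor_def id_functor_def G_simps(1))
  next
    fix x y f assume x: "x \<in> Obj C" and y: "y \<in> Obj C" and f: "f \<in> Hom C x y"
    let ?x = "G0 (?o x)" and ?y = "G0 (?o y)"
    note o = x y Fo[OF x] Fo[OF y] G0[OF Fo[OF x]] G0[OF Fo[OF y]] f Fm[OF x y f]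
    have l: "lift ?x x (e (?o x)) \<in> Hom C ?x x" "?m ?x x (lift ?x x (e (?o x))) = e (?o x)"
      "lift ?y y (e (?o y)) \<in> Hom C ?y y" "?m ?y y (lift ?y y (e (?o y))) = e (?o y)"
      using o by (intro lift eH; simp)+
    show "Cmp C (on_obj (comp_functor G F) x) (on_obj (comp_functor G F) y) (on_obj id_functor y)
        (lift ?y y (e (?o y))) (on_mor (comp_functor G F) x y f) =
      Cmp C (on_obj (comp_functor G F) x) (on_obj id_functor x) (on_obj id_functor y)
        (on_mor id_functor x y f) (lift ?x x (e (?o x)))"
      unfolding comp_functor_def id_functor_def cat_functor.simps G_simps(1)
      by (rule inj[of ?x y]) (use o l in \<open>auto simp: FC Gm cj_e intro!: CC Gm\<close>)
  qed
  have FGi: "naturally_isomorphic D D (comp_functor F G) id_functor"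
    unfolding naturally_isomorphic_def
    by (intro exI[where x = e] conjI ballI)
      (auto simp: comp_functor_def id_functor_def G_simps(1) e Gm cj_e)
  show ?thesis unfolding is_equivalence_def using F GF GFi FGi by blast
qed

section \<open>Complex vector spaces\<close>

lemma CC_simps [simp]:
  "carrier CC = UNIV" "x \<oplus>\<^bsub>CC\<^esub> y = x + y" "x \<otimes>\<^bsub>CC\<^esub> y = x * y" "\<zero>\<^bsub>CC\<^esub> = 0" "\<one>\<^bsub>CC\<^esub> = 1"
  by (auto simp: ring_of_type_algebra_def)

lemma cring_CC: "cring CC"
  by (rule cring_from_type_algebra)

locale cvec = fixes M :: "(complex, 'u, 'a) module_scheme" (structure)
  assumes cvec: "Module.module CC M"

sublocale cvec \<subseteq> module CC M
  by (rule cvec)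

context cvec
begin

abbreviation V where "V \<equiv> carrier M"
abbreviation functionals where "functionals \<equiv> dual_space M V"

lemma smult_mem [simp, intro]: "v \<in> V \<Longrightarrow> c \<odot> v \<in> V"
  using smult_closed by simp

lemma smult_add_left: "v \<in> V \<Longrightarrow> (a + b) \<odot> v = a \<odot> v \<oplus> b \<odot> v"
  using smult_l_distr[of a b v] by simp

lemma smult_add_right: "v \<in> V \<Longrightarrow> w \<in> V \<Longrightarrow> a \<odot> (v \<oplus> w) = a \<odot> v \<oplus> a \<odot> w"
  using smult_r_distr[of a v w] by simp

lemma smult_smult: "v \<in> V \<Longrightarrow> a \<odot> (b \<odot> v) = (a * b) \<odot> v"
  using smult_assoc1[of a b v] by simp

lemma smult_1 [simp]: "v \<in> V \<Longrightarrow> 1 \<odot> v = v"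
  using smult_one by simp

lemma smult_0 [simp]: "v \<in> V \<Longrightarrow> 0 \<odot> v = \<zero>"
  using smult_l_null by simp

lemma smult_zero [simp]: "c \<odot> \<zero> = \<zero>"
  using smult_r_null by simp

lemma uminus_eq_smult: "v \<in> V \<Longrightarrow> \<ominus> v = (- 1) \<odot> v"
proof -
  assume v: "v \<in> V"
  have "(- 1) \<odot> v \<oplus> v = (- 1 + 1) \<odot> v" using v smult_add_left[of v "-1" 1] by simp
  then have "(- 1) \<odot> v \<oplus> v = \<zero>" using v by simp
  then show ?thesis using v M.minus_equality by auto
qed

lemma functional_add: "\<phi> \<in> functionals \<Longrightarrow> v \<in> V \<Longrightarrow> w \<in> V \<Longrightarrow> \<phi> (v \<oplus> w) = \<phi> v + \<phi> w"
  and functional_smult: "\<phi> \<in> functionals \<Longrightarrow> v \<in> V \<Longrightarrow> \<phi> (c \<odot> v) = c * \<phi> v"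
  by (auto simp: dual_space_def)

lemma functional_zero: "\<phi> \<in> functionals \<Longrightarrow> \<phi> \<zero> = 0"
  using functional_smult[of \<phi> \<zero> 0] by simp

lemma functional_uminus: "\<phi> \<in> functionals \<Longrightarrow> v \<in> V \<Longrightarrow> \<phi> (\<ominus> v) = - \<phi> v"
  by (simp add: uminus_eq_smult functional_smult)

lemma functional_minus: "\<phi> \<in> functionals \<Longrightarrow> v \<in> V \<Longrightarrow> w \<in> V \<Longrightarrow> \<phi> (v \<ominus> w) = \<phi> v - \<phi> w"
  by (simp add: a_minus_def functional_add functional_uminus)

lemma functional_finsum:
  "\<phi> \<in> functionals \<Longrightarrow> finite A \<Longrightarrow> f \<in> A \<rightarrow> V \<Longrightarrow> \<phi> (\<Oplus>i\<in>A. f i) = (\<Sum>i\<in>A. \<phi> (f i))"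
proof -
  assume \<phi>: "\<phi> \<in> functionals"
  show "finite A \<Longrightarrow> f \<in> A \<rightarrow> V \<Longrightarrow> \<phi> (\<Oplus>i\<in>A. f i) = (\<Sum>i\<in>A. \<phi> (f i))"
    by (induction A rule: finite_induct) (use \<phi> in \<open>auto simp: functional_add functional_zero Pi_def\<close>)
qed

lemmas functional_simps = functional_add functional_smult functional_zero functional_uminus
  functional_minus functional_finsum

text \<open>A maximal subspace avoiding \<open>v\<close> is a complement of the line through \<open>v\<close>, so it is the kernel of
  a functional that is \<open>1\<close> at \<open>v\<close>.\<close>

lemma exists_functional:
  assumes v: "v \<in> V" "v \<noteq> \<zero>"
  shows "\<exists>\<phi>\<in>functionals. \<phi> v = 1"
proof -
  let ?A = "{U. submodule U CC M \<and> v \<notin> U}"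
  have "\<exists>U\<in>?A. \<forall>Z\<in>?A. U \<subseteq> Z \<longrightarrow> Z = U"
  proof (rule subset_Zorn_nonempty)
    have "submodule {\<zero>} CC M" by (rule submoduleI) auto
    then show "?A \<noteq> {}" using v by auto
  next
    fix \<C> assume ne: "\<C> \<noteq> {}" and ch: "subset.chain ?A \<C>"
    have sub: "\<And>U. U \<in> \<C> \<Longrightarrow> submodule U CC M \<and> v \<notin> U"
      using ch by (auto simp: subset.chain_def)
    have lin: "\<And>U W. U \<in> \<C> \<Longrightarrow> W \<in> \<C> \<Longrightarrow> U \<subseteq> W \<or> W \<subseteq> U"
      using ch by (auto simp: subset.chain_def)
    have "submodule (\<Union>\<C>) CC M"
    proof (rule submoduleI)
      show "\<Union>\<C> \<subseteq> V" using sub submoduleE(1) by blast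
      obtain U where "U \<in> \<C>" using ne by auto
      then show "\<zero> \<in> \<Union>\<C>" using submoduleE(4)[of U 0] submoduleE(1,2)[of U] sub by fastforce
      show "\<And>a. a \<in> \<Union>\<C> \<Longrightarrow> \<ominus> a \<in> \<Union>\<C>" using sub submoduleE(3) by blast
      show "\<And>a x. a \<in> carrier CC \<Longrightarrow> x \<in> \<Union>\<C> \<Longrightarrow> a \<odot> x \<in> \<Union>\<C>" using sub submoduleE(4) by blast
      show "a \<oplus> b \<in> \<Union>\<C>" if "a \<in> \<Union>\<C>" "b \<in> \<Union>\<C>" for a b
      proof -
        from that obtain U W where "U \<in> \<C>" "W \<in> \<C>" "a \<in> U" "b \<in> W" by auto
        with lin[of U W] obtain Z where "Z \<in> \<C>" "a \<in> Z" "b \<in> Z" by auto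
        then show ?thesis using sub[of Z] submoduleE(5)[of Z a b] by auto
      qed
    qed
    then show "\<Union>\<C> \<in> ?A" using sub by auto
  qed
  then obtain U where U: "submodule U CC M" "v \<notin> U"
    and max: "\<And>Z. submodule Z CC M \<Longrightarrow> v \<notin> Z \<Longrightarrow> U \<subseteq> Z \<Longrightarrow> Z = U" by auto
  note UE = submoduleE[OF U(1)]
  have UV: "u \<in> V" if "u \<in> U" for u using UE(1) that by auto
  have U0: "\<zero> \<in> U" using UE(2) UE(4)[of 0] UV by fastforce
  \<comment> \<open>For \<open>w\<close> outside \<open>U\<close>, the sum of \<open>U\<close> and
    the line through \<open>w\<close> is strictly larger than \<open>U\<close>, so by maximality it
    contains \<open>v\<close>. In \<open>v = u + c w\<close> the coefficient \<open>c\<close> is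
    nonzero because \<open>v\<close> is not in \<open>U\<close>, and the equation can be solved for
    \<open>w\<close>.\<close>
  have ex: "\<exists>c. w \<ominus> c \<odot> v \<in> U" if w: "w \<in> V" for w
  proof (cases "w \<in> U")
    case True
    then show ?thesis using v UV by (intro exI[of _ 0]) (simp add: a_minus_def uminus_eq_smult)
  next
    case False
    let ?X = "{u \<oplus> c \<odot> w | u c. u \<in> U}"
    have "submodule ?X CC M"
    proof (rule submoduleI)
      show "?X \<subseteq> V" using w UV by auto
      show "\<zero> \<in> ?X" using w U0 by (intro CollectI exI[of _ \<zero>] exI[of _ 0]) auto
      show "\<ominus> a \<in> ?X" if "a \<in> ?X" for a
      proof -
        from that obtain u c where a: "a = u \<oplus> c \<odot> w" and u: "u \<in> U" by auto
        have "\<ominus> a = \<ominus> u \<oplus> (- c) \<odot> w"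
          using UV[OF u] w by (simp add: a uminus_eq_smult smult_add_right smult_smult)
        then show ?thesis using UE(3)[OF u] by auto
      qed
      show "a \<odot> x \<in> ?X" if "x \<in> ?X" for a x
      proof -
        from that obtain u c where a: "x = u \<oplus> c \<odot> w" and u: "u \<in> U" by auto
        have "a \<odot> x = a \<odot> u \<oplus> (a * c) \<odot> w"
          using UV[OF u] w by (simp add: a smult_add_right smult_smult)
        then show ?thesis using UE(4)[of a, OF _ u] by auto
      qed
      show "a \<oplus> b \<in> ?X" if "a \<in> ?X" "b \<in> ?X" for a b
      proof -
        from that obtain u c u' c' where a: "a = u \<oplus> c \<odot> w" "b = u' \<oplus> c' \<odot> w" and u: "u \<in> U" "u' \<in> U"
          by auto
        have "a \<oplus> b = (u \<oplus> u') \<oplus> (c + c') \<odot> w"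
          using UV[OF u(1)] UV[OF u(2)] w by (simp add: a smult_add_left M.a_ac)
        then show ?thesis using UE(5)[OF u] by auto
      qed
    qed
    moreover have "U \<subseteq> ?X"
    proof
      fix u assume "u \<in> U"
      then show "u \<in> ?X" using UV[of u] w by (intro CollectI exI[of _ u] exI[of _ 0]) auto
    qed
    moreover have "?X \<noteq> U"
    proof -
      have "w \<in> ?X" using U0 w by (intro CollectI exI[of _ \<zero>] exI[of _ 1]) auto
      then show ?thesis using False by auto
    qed
    ultimately have "v \<in> ?X" using max[of ?X] by blast
    then obtain u c where uc: "v = u \<oplus> c \<odot> w" "u \<in> U" by auto
    have "c \<noteq> 0" using uc U(2) w UV by auto
    have u: "u \<in> V" using UV[OF uc(2)] .
    have "(- 1 / c) \<odot> v = (- 1 / c) \<odot> u \<oplus> (- 1) \<odot> w"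
      using \<open>c \<noteq> 0\<close> w u by (simp add: uc(1) smult_add_right smult_smult)
    moreover have "w \<oplus> (- 1) \<odot> w = \<zero>" using w smult_add_left[of w 1 "-1"] by simp
    ultimately have "w \<ominus> (1 / c) \<odot> v = (- 1 / c) \<odot> u"
      using w u v M.a_lcomm[of w "(- 1 / c) \<odot> u" "(- 1) \<odot> w"]
      by (simp add: a_minus_def uminus_eq_smult smult_smult)
    then show ?thesis using UE(4)[OF _ uc(2)] by (intro exI[of _ "1 / c"]) auto
  qed
  define \<phi> where "\<phi> w = (SOME c. w \<ominus> c \<odot> v \<in> U)" for w
  have \<phi>: "w \<ominus> \<phi> w \<odot> v \<in> U" if "w \<in> V" for w
    unfolding \<phi>_def using someI_ex[OF ex[OF that]] .
  \<comment> \<open>Two admissible coefficients would put a nonzero multiple of \<open>v\<close>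
    into \<open>U\<close>. Uniqueness is what makes the chosen \<open>\<phi>\<close> linear.\<close>
  have uniq: "\<phi> w = c" if w: "w \<in> V" and c: "w \<ominus> c \<odot> v \<in> U" for w c
  proof (rule ccontr)
    assume ne: "\<phi> w \<noteq> c"
    have "(w \<ominus> c \<odot> v) \<ominus> (w \<ominus> \<phi> w \<odot> v) = (\<phi> w - c) \<odot> v"
    proof -
      have "(w \<ominus> c \<odot> v) \<ominus> (w \<ominus> \<phi> w \<odot> v) = (w \<oplus> (- 1) \<odot> w) \<oplus> ((- c) \<odot> v \<oplus> \<phi> w \<odot> v)"
        using w v by (simp add: a_minus_def uminus_eq_smult smult_add_right smult_smult M.a_ac)
      also have "w \<oplus> (- 1) \<odot> w = \<zero>" using w smult_add_left[of w 1 "-1"] by simp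
      also have "(- c) \<odot> v \<oplus> \<phi> w \<odot> v = (\<phi> w - c) \<odot> v"
        using v smult_add_left[of v "-c" "\<phi> w"] by (simp add: add.commute)
      finally show ?thesis using v by simp
    qed
    moreover have "(w \<ominus> c \<odot> v) \<ominus> (w \<ominus> \<phi> w \<odot> v) \<in> U"
      using c \<phi>[OF w] UE(3,5) by (simp add: a_minus_def)
    ultimately have "(\<phi> w - c) \<odot> v \<in> U" by simp
    then have "(1 / (\<phi> w - c)) \<odot> ((\<phi> w - c) \<odot> v) \<in> U" by (rule UE(4)[rotated]) simp
    then show False using U(2) v ne by (simp add: smult_smult)
  qed
  have "\<phi> \<in> functionals"
    unfolding dual_space_def
  proof (intro CollectI conjI ballI allI)
    fix x y assume xy: "x \<in> V" "y \<in> V"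
    have "(x \<oplus> y) \<ominus> (\<phi> x + \<phi> y) \<odot> v = (x \<ominus> \<phi> x \<odot> v) \<oplus> (y \<ominus> \<phi> y \<odot> v)"
      using xy v by (simp add: a_minus_def uminus_eq_smult smult_add_left smult_add_right smult_smult M.a_ac)
    then show "\<phi> (x \<oplus> y) = \<phi> x + \<phi> y"
      using xy \<phi> UE(5) by (intro uniq) auto
  next
    fix c x assume x: "x \<in> V"
    have "(c \<odot> x) \<ominus> (c * \<phi> x) \<odot> v = c \<odot> (x \<ominus> \<phi> x \<odot> v)"
      using x v by (simp add: a_minus_def uminus_eq_smult smult_add_left smult_add_right smult_smult M.a_ac)
    then show "\<phi> (c \<odot> x) = c * \<phi> x"
      using x \<phi> UE(4) by (intro uniq) auto
  qed
  moreover have "\<phi> v = 1"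
    using v U0 by (intro uniq) (auto simp: a_minus_def M.r_neg)
  ultimately show ?thesis by blast
qed

lemma vector_eqI:
  assumes "v \<in> V" "w \<in> V" "\<And>\<phi>. \<phi> \<in> functionals \<Longrightarrow> \<phi> v = \<phi> w"
  shows "v = w"
proof (rule ccontr)
  assume "v \<noteq> w"
  have "v \<ominus> w \<noteq> \<zero>" using assms(1,2) \<open>v \<noteq> w\<close>
    by (metis M.add.inv_closed M.add.inv_inv M.minus_equality a_minus_def)
  then obtain \<phi> where \<phi>: "\<phi> \<in> functionals" "\<phi> (v \<ominus> w) = 1"
    using exists_functional[of "v \<ominus> w"] assms(1,2) by auto
  then show False using assms(1,2) assms(3)[OF \<phi>(1)] by (simp add: functional_minus)
qed

end

section \<open>Linear maps, spans and finite dimensional subspaces\<close>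

lemma linear_mapD:
  assumes "linear_map CC M N f"
  shows "v \<in> carrier M \<Longrightarrow> f v \<in> carrier N"
    and "v \<in> carrier M \<Longrightarrow> w \<in> carrier M \<Longrightarrow> f (v \<oplus>\<^bsub>M\<^esub> w) = f v \<oplus>\<^bsub>N\<^esub> f w"
    and "v \<in> carrier M \<Longrightarrow> f (c \<odot>\<^bsub>M\<^esub> v) = c \<odot>\<^bsub>N\<^esub> f v"
  using assms by (auto simp: linear_map_def)

lemma linear_map_zero:
  assumes "cvec M" "cvec N" "linear_map CC M N f"
  shows "f \<zero>\<^bsub>M\<^esub> = \<zero>\<^bsub>N\<^esub>"
proof -
  interpret M: cvec M by fact
  interpret N: cvec N by fact
  have "f (0 \<odot>\<^bsub>M\<^esub> \<zero>\<^bsub>M\<^esub>) = 0 \<odot>\<^bsub>N\<^esub> f \<zero>\<^bsub>M\<^esub>"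
    by (rule linear_mapD(3)[OF assms(3)]) simp
  also have "\<dots> = \<zero>\<^bsub>N\<^esub>" using linear_mapD(1)[OF assms(3)] by simp
  finally show ?thesis by simp
qed

lemma linear_map_finsum:
  assumes "cvec M" "cvec N" "linear_map CC M N f" "finite A" "g \<in> A \<rightarrow> carrier M"
  shows "f (\<Oplus>\<^bsub>M\<^esub>i\<in>A. g i) = (\<Oplus>\<^bsub>N\<^esub>i\<in>A. f (g i))"
proof -
  interpret M: cvec M by fact
  interpret N: cvec N by fact
  show ?thesis using assms(4,5)
    by (induction A rule: finite_induct)
      (auto simp: linear_map_zero[OF assms(1-3)] linear_mapD[OF assms(3)] Pi_def)
qed

lemma (in cvec) linear_map_funpow:
  assumes "linear_map CC M M f"
  shows "linear_map CC M M (f ^^ n)"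
  using assms by (induction n) (auto simp: linear_map_def Pi_def)

context cvec
begin

lemma submodule_zero: "submodule U CC M \<Longrightarrow> \<zero> \<in> U"
  using submoduleE(2)[of U] submoduleE(4)[of U 0] submoduleE(1)[of U] by fastforce

lemma submodule_smult: "submodule U CC M \<Longrightarrow> v \<in> U \<Longrightarrow> c \<odot> v \<in> U"
  using submoduleE(4)[of U c v] by simp

lemmas submodule_add = submoduleE(5)
lemmas submodule_subset = submoduleE(1)

lemma submodule_mem: "submodule U CC M \<Longrightarrow> v \<in> U \<Longrightarrow> v \<in> V"
  using submodule_subset by blast

lemma submoduleI':
  assumes "U \<subseteq> V" "\<zero> \<in> U" "\<And>a b. a \<in> U \<Longrightarrow> b \<in> U \<Longrightarrow> a \<oplus> b \<in> U" "\<And>c a. a \<in> U \<Longrightarrow> c \<odot> a \<in> U"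
  shows "submodule U CC M"
proof (rule submoduleI)
  show "\<ominus> a \<in> U" if "a \<in> U" for a
    using assms(4)[OF that, of "-1"] assms(1) that by (auto simp: uminus_eq_smult)
qed (use assms in auto)

lemma submodule_finsum:
  assumes "submodule U CC M" "finite A" "\<And>a. a \<in> A \<Longrightarrow> f a \<in> U"
  shows "(\<Oplus>a\<in>A. f a) \<in> U"
  using assms(2,3)
  by (induction A rule: finite_induct)
    (auto simp: submodule_zero[OF assms(1)] submodule_add[OF assms(1)] Pi_def
      submodule_mem[OF assms(1)])

definition span_of :: "'u set \<Rightarrow> 'u set" where
  "span_of B = {\<Oplus>b\<in>B. c b \<odot> b | c. True}"

lemma submodule_span_of:
  assumes "finite B" "B \<subseteq> V"
  shows "submodule (span_of B) CC M"
proof (rule submoduleI')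
  show "span_of B \<subseteq> V" using assms by (auto simp: span_of_def intro!: M.finsum_closed)
  show "\<zero> \<in> span_of B"
  proof -
    have "\<zero> = (\<Oplus>b\<in>B. 0 \<odot> b)"
      by (rule vector_eqI) (use assms in \<open>auto simp: functional_simps Pi_def subset_iff\<close>)
    then show ?thesis by (auto simp: span_of_def)
  qed
  show "a \<oplus> b \<in> span_of B" if ab: "a \<in> span_of B" "b \<in> span_of B" for a b
  proof -
    from ab obtain c d where ab: "a = (\<Oplus>b\<in>B. c b \<odot> b)" "b = (\<Oplus>b\<in>B. d b \<odot> b)"
      by (auto simp: span_of_def)
    have "a \<oplus> b = (\<Oplus>b\<in>B. (c b + d b) \<odot> b)"
      unfolding ab
      by (rule vector_eqI)
        (use assms in \<open>auto simp: functional_simps Pi_def subset_iff sum.distrib algebra_simps\<close>)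
    then show ?thesis by (auto simp: span_of_def)
  qed
  show "k \<odot> a \<in> span_of B" if a: "a \<in> span_of B" for k a
  proof -
    from a obtain c where a: "a = (\<Oplus>b\<in>B. c b \<odot> b)" by (auto simp: span_of_def)
    have "k \<odot> a = (\<Oplus>b\<in>B. (k * c b) \<odot> b)"
      unfolding a
      by (rule vector_eqI)
        (use assms in \<open>auto simp: functional_simps Pi_def subset_iff sum_distrib_left algebra_simps\<close>)
    then show ?thesis by (auto simp: span_of_def)
  qed
qed

lemma span_of_superset:
  assumes "finite B" "B \<subseteq> V" "v \<in> B"
  shows "v \<in> span_of B"
proof -
  have "v = (\<Oplus>b\<in>B. (if b = v then 1 else 0) \<odot> b)"
  proof (rule vector_eqI)
    fix \<phi> assume "\<phi> \<in> functionals"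
    then have "\<phi> (\<Oplus>b\<in>B. (if b = v then 1 else 0) \<odot> b) = (\<Sum>b\<in>B. (if b = v then 1 else 0) * \<phi> b)"
      using assms by (auto simp: functional_simps Pi_def subset_iff intro!: sum.cong)
    also have "\<dots> = (\<Sum>b\<in>B. if b = v then \<phi> b else 0)" by (intro sum.cong) auto
    also have "\<dots> = \<phi> v" using assms by simp
    finally show "\<phi> v = \<phi> (\<Oplus>b\<in>B. (if b = v then 1 else 0) \<odot> b)" by simp
  qed (use assms in \<open>auto intro!: M.finsum_closed\<close>)
  then show ?thesis unfolding span_of_def by (intro CollectI exI[of _ "\<lambda>b. if b = v then 1 else 0"] conjI TrueI)
qed

lemma span_of_minimal:
  assumes "finite B" "submodule U CC M" "B \<subseteq> U"
  shows "span_of B \<subseteq> U"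
  using assms by (auto simp: span_of_def intro!: submodule_finsum submodule_smult)

lemma fd_subspace_iff:
  "fd_subspace M U \<longleftrightarrow> submodule U CC M \<and> (\<exists>B\<subseteq>U. finite B \<and> U \<subseteq> span_of B)"
  unfolding fd_subspace_def span_of_def by blast

lemma fd_subspace_submodule: "fd_subspace M U \<Longrightarrow> submodule U CC M"
  by (simp add: fd_subspace_iff)

end

lemma submodule_preimage:
  assumes "cvec M" "cvec N" "linear_map CC M N f" "submodule U CC N"
  shows "submodule {v \<in> carrier M. f v \<in> U} CC M"
proof -
  interpret M: cvec M by fact
  interpret N: cvec N by fact
  show ?thesis
    by (rule M.submoduleI')
      (auto simp: linear_map_zero[OF assms(1-3)] linear_mapD[OF assms(3)]
        N.submodule_zero[OF assms(4)] N.submodule_add[OF assms(4)] N.submodule_smult[OF assms(4)])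
qed

lemma fd_subspace_image:
  assumes "cvec M" "cvec N" "linear_map CC M N f" "fd_subspace M U"
  shows "fd_subspace N (f ` U)"
proof -
  interpret M: cvec M by fact
  interpret N: cvec N by fact
  note f = linear_mapD[OF assms(3)]
  from assms(4) obtain B where B: "B \<subseteq> U" "finite B" "U \<subseteq> M.span_of B" and U: "submodule U CC M"
    by (auto simp: M.fd_subspace_iff)
  have fB: "finite (f ` B)" "f ` B \<subseteq> carrier N"
    using B M.submodule_subset[OF U] f(1) by auto
  have BV: "B \<subseteq> carrier M" using B M.submodule_subset[OF U] by auto
  have "submodule (f ` U) CC N"
  proof (rule N.submoduleI')
    show "f ` U \<subseteq> carrier N" using f(1) M.submodule_subset[OF U] by auto
    show "\<zero>\<^bsub>N\<^esub> \<in> f ` U"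
      using M.submodule_zero[OF U] linear_map_zero[OF assms(1-3)] by (metis imageI)
    show "a \<oplus>\<^bsub>N\<^esub> b \<in> f ` U" if ab: "a \<in> f ` U" "b \<in> f ` U" for a b
    proof -
      from ab obtain x y where xy: "x \<in> U" "y \<in> U" "a = f x" "b = f y" by blast
      then have "a \<oplus>\<^bsub>N\<^esub> b = f (x \<oplus>\<^bsub>M\<^esub> y)" using M.submodule_mem[OF U] f(2) by simp
      then show ?thesis using M.submodule_add[OF U xy(1,2)] by blast
    qed
    show "c \<odot>\<^bsub>N\<^esub> a \<in> f ` U" if a: "a \<in> f ` U" for a c
    proof -
      from a obtain x where x: "x \<in> U" "a = f x" by blast
      then have "c \<odot>\<^bsub>N\<^esub> a = f (c \<odot>\<^bsub>M\<^esub> x)" using M.submodule_mem[OF U] f(3) by simp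
      then show ?thesis using M.submodule_smult[OF U x(1)] by blast
    qed
  qed
  \<comment> \<open>The preimage of the span of the images of \<open>B\<close> is a subspace
    containing \<open>B\<close>, hence it contains the span of \<open>B\<close>.\<close>
  moreover have "M.span_of B \<subseteq> {v \<in> carrier M. f v \<in> N.span_of (f ` B)}"
    using BV by (intro M.span_of_minimal B submodule_preimage[OF assms(1-3)] N.submodule_span_of fB)
      (auto intro!: N.span_of_superset fB)
  ultimately show ?thesis
    unfolding N.fd_subspace_iff using B fB by (intro conjI exI[of _ "f ` B"]) auto
qed

section \<open>Graded vector spaces\<close>

text \<open>The decomposition is carried by its projections \<open>p i\<close>. They are linear, so
  components of sums and multiples can be computed; \<open>p_finite\<close> and \<open>p_ext\<close>
  together say that a vector is the finite sum of its components.\<close>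

locale graded = cvec M for M :: "(complex, 'u, 'a) module_scheme" (structure) +
  fixes W :: "int \<Rightarrow> 'u set" and p :: "int \<Rightarrow> 'u \<Rightarrow> 'u"
  assumes W_submodule: "submodule (W i) CC M"
    and p_mem: "v \<in> V \<Longrightarrow> p i v \<in> W i"
    and p_add: "v \<in> V \<Longrightarrow> w \<in> V \<Longrightarrow> p i (v \<oplus> w) = p i v \<oplus> p i w"
    and p_smult: "v \<in> V \<Longrightarrow> p i (c \<odot> v) = c \<odot> p i v"
    and p_same: "v \<in> W i \<Longrightarrow> p i v = v"
    and p_other: "v \<in> W i \<Longrightarrow> j \<noteq> i \<Longrightarrow> p j v = \<zero>"
    and p_finite: "v \<in> V \<Longrightarrow> finite {i. p i v \<noteq> \<zero>}"
    and p_ext: "v \<in> V \<Longrightarrow> w \<in> V \<Longrightarrow> (\<And>i. p i v = p i w) \<Longrightarrow> v = w"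
begin

lemma W_mem: "v \<in> W i \<Longrightarrow> v \<in> V"
  using submodule_mem[OF W_submodule] .

lemma p_closed [simp, intro]: "v \<in> V \<Longrightarrow> p i v \<in> V"
  using p_mem W_mem by blast

lemma W_zero [simp]: "\<zero> \<in> W i"
  using submodule_zero[OF W_submodule] .

lemma p_zero [simp]: "p i \<zero> = \<zero>"
  using p_same[of \<zero> i] by simp

lemma p_p: "v \<in> V \<Longrightarrow> p i (p j v) = (if i = j then p i v else \<zero>)"
  using p_same[of "p j v" j] p_other[of "p j v" j i] p_mem by auto

lemma p_finsum:
  assumes "finite S" "\<And>i. i \<in> S \<Longrightarrow> u i \<in> W i"
  shows "p j (\<Oplus>i\<in>S. u i) = (if j \<in> S then u j else \<zero>)"
  using assms
proof (induction S rule: finite_induct)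
  case (insert x F)
  have "(\<Oplus>i\<in>insert x F. u i) = u x \<oplus> (\<Oplus>i\<in>F. u i)"
    using insert W_mem by (intro M.finsum_insert) blast+
  moreover have "u x \<in> V" "(\<Oplus>i\<in>F. u i) \<in> V" using insert W_mem by (auto intro!: M.finsum_closed)
  ultimately have "p j (\<Oplus>i\<in>insert x F. u i) = p j (u x) \<oplus> (if j \<in> F then u j else \<zero>)"
    using insert by (simp add: p_add)
  moreover have "u x \<in> V" "j \<in> F \<Longrightarrow> u j \<in> V" using insert W_mem by blast+
  ultimately show ?case using insert p_same[of "u x" x] p_other[of "u x" x j] by auto
qed auto

lemma decompose:
  assumes "finite S" "v \<in> V" "\<And>i. i \<notin> S \<Longrightarrow> p i v = \<zero>"
  shows "v = (\<Oplus>i\<in>S. p i v)"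
proof (rule p_ext)
  show "(\<Oplus>i\<in>S. p i v) \<in> V" using assms by auto
  show "p i v = p i (\<Oplus>i\<in>S. p i v)" for i
    using assms p_mem by (subst p_finsum) auto
qed (use assms in auto)

text \<open>Serves to assemble a map into \<open>M\<close> from maps into its homogeneous
  parts.\<close>

lemma exists_with_components:
  assumes "\<And>i. u i \<in> W i" "finite {i. u i \<noteq> \<zero>}"
  shows "\<exists>v\<in>V. \<forall>i. p i v = u i"
  using assms W_mem
  by (intro bexI[of _ "\<Oplus>i\<in>{i. u i \<noteq> \<zero>}. u i"] allI) (auto simp: p_finsum intro!: M.finsum_closed)

text \<open>Every vector is a finite sum of its homogeneous components. The empty sum needs no case
  of its own, since zero is homogeneous of every degree.\<close>

lemma graded_induct [consumes 1, case_names add homogeneous]: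
  assumes "v \<in> V"
    and "\<And>v w. v \<in> V \<Longrightarrow> w \<in> V \<Longrightarrow> P v \<Longrightarrow> P w \<Longrightarrow> P (v \<oplus> w)"
    and "\<And>i v. v \<in> W i \<Longrightarrow> P v"
  shows "P v"
proof -
  have "P (\<Oplus>i\<in>S. p i v)" if "finite S" for S
    using that
  proof (induction S rule: finite_induct)
    case empty
    then show ?case using assms(3)[of \<zero>] by simp
  next
    case (insert x F)
    then show ?case using assms(1) by (auto simp: Pi_def intro!: assms(2) assms(3)[OF p_mem])
  qed
  from this[OF p_finite[OF assms(1)]] show ?thesis
    using decompose[OF p_finite[OF assms(1)] assms(1)] by simp
qed

lemma internal_direct_sum: "internal_direct_sum M W"
  unfolding internal_direct_sum_def
proof (intro conjI allI ballI)
  fix v assume v: "v \<in> V"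
  show "\<exists>!f. (\<forall>i. f i \<in> W i) \<and> finite {i. f i \<noteq> \<zero>} \<and> v = (\<Oplus>i\<in>{i. f i \<noteq> \<zero>}. f i)"
  proof (rule ex1I[of _ "\<lambda>i. p i v"])
    show "(\<forall>i. p i v \<in> W i) \<and> finite {i. p i v \<noteq> \<zero>} \<and> v = (\<Oplus>i\<in>{i. p i v \<noteq> \<zero>}. p i v)"
      using v p_mem p_finite decompose[OF p_finite[OF v] v] by auto
    fix f assume f: "(\<forall>i. f i \<in> W i) \<and> finite {i. f i \<noteq> \<zero>} \<and> v = (\<Oplus>i\<in>{i. f i \<noteq> \<zero>}. f i)"
    show "f = (\<lambda>i. p i v)"
    proof
      fix j
      have "p j (\<Oplus>i\<in>{i. f i \<noteq> \<zero>}. f i) = (if j \<in> {i. f i \<noteq> \<zero>} then f j else \<zero>)"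
        using f by (intro p_finsum) auto
      then show "f j = p j v" using f by (auto split: if_splits)
    qed
  qed
qed (rule W_submodule)

lemma fd_subspace_finite_support:
  assumes "finite S" "\<And>i. i \<in> S \<Longrightarrow> fd_subspace M (W i)"
  shows "fd_subspace M {v \<in> V. \<forall>i. i \<notin> S \<longrightarrow> p i v = \<zero>}" (is "fd_subspace M ?U")
proof -
  have "\<exists>B. \<forall>i\<in>S. B i \<subseteq> W i \<and> finite (B i) \<and> W i \<subseteq> span_of (B i)"
    using assms(2) unfolding fd_subspace_iff by metis
  then obtain B where B: "\<And>i. i \<in> S \<Longrightarrow> B i \<subseteq> W i" "\<And>i. i \<in> S \<Longrightarrow> finite (B i)"
    "\<And>i. i \<in> S \<Longrightarrow> W i \<subseteq> span_of (B i)" by metis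
  let ?B = "\<Union>i\<in>S. B i"
  have U: "submodule ?U CC M"
    by (rule submoduleI') (auto simp: p_add p_smult)
  have WU: "W i \<subseteq> ?U" if "i \<in> S" for i
    using that p_other W_mem by fastforce
  have BU: "?B \<subseteq> ?U" using B(1) WU by blast
  have fB: "finite ?B" "?B \<subseteq> V" using assms(1) B(2) BU by auto
  have "W i \<subseteq> span_of ?B" if "i \<in> S" for i
  proof -
    have "span_of (B i) \<subseteq> span_of ?B"
      using that fB by (intro span_of_minimal B submodule_span_of) (auto intro!: span_of_superset)
    then show ?thesis using B(3)[OF that] by blast
  qed
  then have "(\<Oplus>i\<in>S. p i v) \<in> span_of ?B" if "v \<in> V" for v
    using that p_mem by (intro submodule_finsum submodule_span_of fB assms(1)) auto
  then have "?U \<subseteq> span_of ?B"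
    using decompose[OF assms(1)] by fastforce
  then show ?thesis unfolding fd_subspace_iff using U BU fB by blast
qed

end

definition dproj :: "(complex, 'u, 'a) module_scheme \<Rightarrow> (int \<Rightarrow> 'u set) \<Rightarrow> int \<Rightarrow> 'u \<Rightarrow> 'u" where
  "dproj M W i v = (THE f. (\<forall>i. f i \<in> W i) \<and> finite {i. f i \<noteq> \<zero>\<^bsub>M\<^esub>} \<and>
        v = (\<Oplus>\<^bsub>M\<^esub>i\<in>{i. f i \<noteq> \<zero>\<^bsub>M\<^esub>}. f i)) i"

text \<open>\<open>internal_direct_sum\<close> sums over the exact support, but the support of a sum
  may be smaller than the union of the supports. Linearity of the projections therefore goes through
  sums over an arbitrary finite set containing the support, which \<open>QI\<close> and
  \<open>Qs\<close> allow.\<close>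

lemma graded_dproj:
  fixes M (structure)
  assumes M: "cvec M" and ds: "internal_direct_sum M W"
  shows "graded M W (dproj M W)"
proof -
  interpret cvec M by fact
  have W: "\<And>i. submodule (W i) CC M" using ds by (auto simp: internal_direct_sum_def)
  have Wm: "\<And>i v. v \<in> W i \<Longrightarrow> v \<in> V" using submodule_mem[OF W] .
  define Q where "Q v f \<longleftrightarrow> (\<forall>i. f i \<in> W i) \<and> finite {i. f i \<noteq> \<zero>} \<and>
        v = (\<Oplus>i\<in>{i. f i \<noteq> \<zero>}. f i)" for v f
  have ex1: "\<exists>!f. Q v f" if "v \<in> V" for v
    using ds that unfolding internal_direct_sum_def Q_def by blast
  have dp: "(\<lambda>i. dproj M W i v) = (THE f. Q v f)" for v
    by (simp add: dproj_def Q_def fun_eq_iff)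
  have Q: "Q v (\<lambda>i. dproj M W i v)" if "v \<in> V" for v
    unfolding dp using theI'[OF ex1[OF that]] .
  have uniq: "dproj M W i v = f i" if "v \<in> V" "Q v f" for v f i
    using ex1[OF that(1)] Q[OF that(1)] that(2) by (metis (mono_tags, lifting))
  have QI: "Q v f" if "\<And>i. f i \<in> W i" "finite S" "\<And>i. i \<notin> S \<Longrightarrow> f i = \<zero>" "v = (\<Oplus>i\<in>S. f i)" for v f S
  proof -
    have "{i. f i \<noteq> \<zero>} \<subseteq> S" using that(3) by auto
    then have "finite {i. f i \<noteq> \<zero>}" using that(2) finite_subset by auto
    moreover have "(\<Oplus>i\<in>{i. f i \<noteq> \<zero>}. f i) = (\<Oplus>i\<in>S. f i)"
      using that Wm \<open>{i. f i \<noteq> \<zero>} \<subseteq> S\<close> by (intro M.add.finprod_mono_neutral_cong_left) auto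
    ultimately show ?thesis using that by (auto simp: Q_def)
  qed
  have S: "\<exists>S. finite S \<and> (\<forall>i. i \<notin> S \<longrightarrow> dproj M W i v = \<zero>) \<and> (\<forall>i. dproj M W i v \<in> W i)" if "v \<in> V" for v
    using Q[OF that] by (intro exI[of _ "{i. dproj M W i v \<noteq> \<zero>}"]) (auto simp: Q_def)
  have Qs: "v = (\<Oplus>i\<in>S. dproj M W i v)" if "v \<in> V" "finite S" "\<And>i. i \<notin> S \<Longrightarrow> dproj M W i v = \<zero>" for v S
  proof -
    have "{i. dproj M W i v \<noteq> \<zero>} \<subseteq> S" using that(3) by auto
    moreover have "v = (\<Oplus>i\<in>{i. dproj M W i v \<noteq> \<zero>}. dproj M W i v)" "\<And>i. dproj M W i v \<in> V"
      using Q[OF that(1)] Wm by (auto simp: Q_def)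
    moreover from this that \<open>_ \<subseteq> S\<close> have "(\<Oplus>i\<in>{i. dproj M W i v \<noteq> \<zero>}. dproj M W i v) = (\<Oplus>i\<in>S. dproj M W i v)"
      by (intro M.add.finprod_mono_neutral_cong_left) auto
    ultimately show ?thesis by simp
  qed
  show ?thesis
  proof (intro graded.intro graded_axioms.intro M)
    fix i v assume v: "v \<in> V"
    show "dproj M W i v \<in> W i" "finite {i. dproj M W i v \<noteq> \<zero>}" using Q[OF v] by (auto simp: Q_def)
    fix w assume w: "w \<in> V"
    obtain S1 where S1: "finite S1" "\<And>i. i \<notin> S1 \<Longrightarrow> dproj M W i v = \<zero>" "\<And>i. dproj M W i v \<in> W i"
      using S[OF v] by blast
    obtain S2 where S2: "finite S2" "\<And>i. i \<notin> S2 \<Longrightarrow> dproj M W i w = \<zero>" "\<And>i. dproj M W i w \<in> W i"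
      using S[OF w] by blast
    have "v = (\<Oplus>i\<in>S1 \<union> S2. dproj M W i v)" "w = (\<Oplus>i\<in>S1 \<union> S2. dproj M W i w)"
      using S1 S2 by (auto intro!: Qs v w)
    then have "v \<oplus> w = (\<Oplus>i\<in>S1 \<union> S2. dproj M W i v) \<oplus> (\<Oplus>i\<in>S1 \<union> S2. dproj M W i w)" by simp
    also have "\<dots> = (\<Oplus>i\<in>S1 \<union> S2. dproj M W i v \<oplus> dproj M W i w)"
      using S1(3) S2(3) Wm by (intro M.finsum_addf[symmetric]) auto
    finally have vw: "v \<oplus> w = (\<Oplus>i\<in>S1 \<union> S2. dproj M W i v \<oplus> dproj M W i w)" .
    have "Q (v \<oplus> w) (\<lambda>i. dproj M W i v \<oplus> dproj M W i w)"
      using S1 S2 by (intro QI[OF _ _ _ vw]) (simp_all add: submodule_add[OF W])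
    then show "dproj M W i (v \<oplus> w) = dproj M W i v \<oplus> dproj M W i w"
      using v w by (intro uniq) simp_all
    show "v = w" if "\<And>i. dproj M W i v = dproj M W i w"
      using Q[OF v] Q[OF w] that by (simp add: Q_def)
    fix c
    have "v = (\<Oplus>i\<in>S1. dproj M W i v)"
      using S1 by (auto intro!: Qs v)
    then have "c \<odot> v = c \<odot> (\<Oplus>i\<in>S1. dproj M W i v)" by simp
    also have "\<dots> = (\<Oplus>i\<in>S1. c \<odot> dproj M W i v)"
      using S1 Wm by (intro finsum_smult_ldistr) auto
    finally have cv: "c \<odot> v = (\<Oplus>i\<in>S1. c \<odot> dproj M W i v)" .
    have "Q (c \<odot> v) (\<lambda>i. c \<odot> dproj M W i v)"
      using S1 by (intro QI[OF _ _ _ cv]) (simp_all add: submodule_smult[OF W])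
    then show "dproj M W i (c \<odot> v) = c \<odot> dproj M W i v"
      using v by (intro uniq) simp_all
  next
    fix v i assume v: "v \<in> W i"
    have *: "Q v (\<lambda>j. if j = i then v else \<zero>)"
      using v Wm[OF v] by (intro QI[of _ "{i}"]) (auto simp: submodule_zero[OF W])
    show "dproj M W i v = v" using uniq[OF Wm[OF v] *] by simp
    fix j assume "j \<noteq> i"
    then show "dproj M W j v = \<zero>" using uniq[OF Wm[OF v] *] by simp
  qed (rule W)
qed

section \<open>The Lie algebra and the group \<open>K\<close>\<close>

text \<open>Coordinates of a traceless matrix with respect to the basis \<open>X\<close>, \<open>H\<close>, \<open>Y\<close>.\<close>

definition coordX :: "cmat2 \<Rightarrow> complex" where
  "coordX Z = Z $ 1 $ 1 - \<i> / 2 * (Z $ 1 $ 2 + Z $ 2 $ 1)"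
definition coordY :: "cmat2 \<Rightarrow> complex" where
  "coordY Z = Z $ 1 $ 1 + \<i> / 2 * (Z $ 1 $ 2 + Z $ 2 $ 1)"
definition coordH :: "cmat2 \<Rightarrow> complex" where
  "coordH Z = \<i> / 2 * (Z $ 1 $ 2 - Z $ 2 $ 1)"

lemmas coord_defs = coordX_def coordY_def coordH_def

lemma map_matrix_nth: "map_matrix f A $ i $ j = f (A $ i $ j)"
  by (simp add: map_matrix_def)

lemma matrix_mult_2: "((A :: 'a::semiring_1^2^2) ** B) $ i $ j = A $ i $ 1 * B $ 1 $ j + A $ i $ 2 * B $ 2 $ j"
  by (simp add: matrix_matrix_mult_def UNIV_2)

lemma trace_2: "trace (Z :: 'a::semiring_1^2^2) = Z $ 1 $ 1 + Z $ 2 $ 2"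
  by (simp add: trace_def UNIV_2)

lemma mat2_eqI:
  "A $ 1 $ 1 = B $ 1 $ 1 \<Longrightarrow> A $ 1 $ 2 = B $ 1 $ 2 \<Longrightarrow> A $ 2 $ 1 = B $ 2 $ 1 \<Longrightarrow> A $ 2 $ 2 = B $ 2 $ 2
    \<Longrightarrow> A = (B :: 'a^2^2)"
  by (simp add: vec_eq_iff forall_2)

lemma sl2c_22: "Z \<in> sl2c \<Longrightarrow> Z $ 2 $ 2 = - Z $ 1 $ 1"
  by (simp add: sl2c_def trace_2 add_eq_0_iff)

lemma basis_in_sl2c [simp]: "H_mat \<in> sl2c" "X_mat \<in> sl2c" "Y_mat \<in> sl2c"
  by (simp_all add: sl2c_def trace_2 H_mat_def X_mat_def Y_mat_def)

lemma sl2c_closed [simp]: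
  "Z \<in> sl2c \<Longrightarrow> Z' \<in> sl2c \<Longrightarrow> Z + Z' \<in> sl2c"
  "Z \<in> sl2c \<Longrightarrow> map_matrix ((*) c) Z \<in> sl2c"
  "lie_bracket Z Z' \<in> sl2c"
  by (simp_all add: sl2c_def trace_2 lie_bracket_def matrix_mult_2 map_matrix_nth algebra_simps
      flip: distrib_left)

lemma sl2c_coords:
  assumes "Z \<in> sl2c"
  shows "Z = map_matrix ((*) (coordX Z)) X_mat
    + (map_matrix ((*) (coordH Z)) H_mat + map_matrix ((*) (coordY Z)) Y_mat)"
  by (rule mat2_eqI)
    (simp_all add: map_matrix_nth coord_defs X_mat_def Y_mat_def H_mat_def sl2c_22[OF assms] field_simps)

lemma coord_basis [simp]:
  "coordX X_mat = 1" "coordH X_mat = 0" "coordY X_mat = 0"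
  "coordX H_mat = 0" "coordH H_mat = 1" "coordY H_mat = 0"
  "coordX Y_mat = 0" "coordH Y_mat = 0" "coordY Y_mat = 1"
  by (simp_all add: coord_defs X_mat_def Y_mat_def H_mat_def field_simps)

lemma coord_add:
  "coordX (Z + Z') = coordX Z + coordX Z'" "coordH (Z + Z') = coordH Z + coordH Z'"
  "coordY (Z + Z') = coordY Z + coordY Z'"
  by (simp_all only: coord_defs vector_add_component ring_distribs) simp_all

lemma coord_scale:
  "coordX (map_matrix ((*) c) Z) = c * coordX Z" "coordH (map_matrix ((*) c) Z) = c * coordH Z"
  "coordY (map_matrix ((*) c) Z) = c * coordY Z"
  by (simp_all only: coord_defs map_matrix_nth ring_distribs mult.left_commute[of c])

lemma coord_bracket:
  assumes "Z \<in> sl2c" "Z' \<in> sl2c"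
  shows "coordX (lie_bracket Z Z') = 2 * (coordH Z * coordX Z' - coordX Z * coordH Z')"
    "coordH (lie_bracket Z Z') = coordX Z * coordY Z' - coordY Z * coordX Z'"
    "coordY (lie_bracket Z Z') = - 2 * (coordH Z * coordY Z' - coordY Z * coordH Z')"
proof -
  \<comment> \<open>The constant is kept opaque, so that with the rules for its square both sides
    become polynomials in the matrix entries.\<close>
  define h where "h = \<i> / 2"
  have hh: "h * h = - 1 / 4" "h * (h * x) = - x / 4" for x by (simp_all add: h_def)
  obtain p q r p' q' r' where Z: "Z $ 1 $ 1 = p" "Z $ 1 $ 2 = q" "Z $ 2 $ 1 = r"
    "Z' $ 1 $ 1 = p'" "Z' $ 1 $ 2 = q'" "Z' $ 2 $ 1 = r'"
    by simp
  show "coordX (lie_bracket Z Z') = 2 * (coordH Z * coordX Z' - coordX Z * coordH Z')"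
    "coordH (lie_bracket Z Z') = coordX Z * coordY Z' - coordY Z * coordX Z'"
    "coordY (lie_bracket Z Z') = - 2 * (coordH Z * coordY Z' - coordY Z * coordH Z')"
    unfolding coord_defs lie_bracket_def vector_minus_component matrix_mult_2 sl2c_22[OF assms(1)]
      sl2c_22[OF assms(2)] h_def[symmetric] Z
    by (simp_all add: algebra_simps hh)
qed

lemma bracket_basis:
  "lie_bracket H_mat X_mat = map_matrix ((*) 2) X_mat"
  "lie_bracket H_mat Y_mat = map_matrix ((*) (- 2)) Y_mat"
  "lie_bracket X_mat Y_mat = H_mat"
  by (rule mat2_eqI; simp add: lie_bracket_def matrix_mult_2 map_matrix_nth X_mat_def Y_mat_def H_mat_def)+

text \<open>The generator \<open>J_mat\<close> of the rotations is \<open>- \<i>\<close> times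
  \<open>H\<close>. This is where the factor \<open>exp (- \<i> n \<theta>)\<close> of a rotation on
  weight \<open>n\<close> comes from.\<close>

lemma J_mat_eq: "complexify (s *\<^sub>R J_mat) = map_matrix ((*) (- \<i> * of_real s)) H_mat"
  by (rule mat2_eqI; simp add: complexify_def map_matrix_nth J_mat_def H_mat_def mult.assoc mult.commute[of "of_real s" \<i>])+

text \<open>The character by which \<open>K\<close> acts on vectors of weight \<open>1\<close>.\<close>

definition chi :: "rmat2 \<Rightarrow> complex" where
  "chi k = of_real (k $ 1 $ 1) + \<i> * of_real (k $ 1 $ 2)"

section \<open>Rotations, their character and the adjoint action\<close>

lemma rot_in_SO2 [simp]: "rot \<theta> \<in> SO2"
proof -
  have "orthogonal_matrix (rot \<theta>)"
    unfolding orthogonal_matrix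
    by (rule mat2_eqI) (simp_all add: rot_def matrix_mult_2 transpose_def mat_def flip: power2_eq_square)
  moreover have "det (rot \<theta>) = 1"
    by (simp add: det_2 rot_def flip: power2_eq_square)
  ultimately show ?thesis by (simp add: SO2_def)
qed

lemma SO2_eq_rot:
  assumes "k \<in> SO2"
  obtains \<theta> where "k = rot \<theta>"
proof -
  have o: "transpose k ** k = mat 1" "k ** transpose k = mat 1" and d: "det k = 1"
    using assms by (auto simp: SO2_def orthogonal_matrix_def)
  have 1: "k $ 1 $ 1 * k $ 1 $ 1 + k $ 2 $ 1 * k $ 2 $ 1 = 1"
    using arg_cong[OF o(1), of "\<lambda>A. A $ 1 $ 1"] by (simp add: matrix_mult_2 transpose_def mat_def)
  have 2: "k $ 1 $ 1 * k $ 1 $ 2 + k $ 2 $ 1 * k $ 2 $ 2 = 0"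
    using arg_cong[OF o(1), of "\<lambda>A. A $ 1 $ 2"] by (simp add: matrix_mult_2 transpose_def mat_def)
  have 3: "k $ 1 $ 1 * k $ 2 $ 2 - k $ 1 $ 2 * k $ 2 $ 1 = 1"
    using d by (simp add: det_2)
  \<comment> \<open>Multiplying an entry by the squared length 1 of the first column and regrouping
    expresses it through the determinant and the inner product of the columns.\<close>
  have "k $ 2 $ 2 = k $ 2 $ 2 * (k $ 1 $ 1 * k $ 1 $ 1 + k $ 2 $ 1 * k $ 2 $ 1)"
    by (simp add: 1)
  also have "\<dots> = k $ 1 $ 1 * (k $ 1 $ 1 * k $ 2 $ 2 - k $ 1 $ 2 * k $ 2 $ 1)
      + k $ 2 $ 1 * (k $ 1 $ 1 * k $ 1 $ 2 + k $ 2 $ 1 * k $ 2 $ 2)"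
    by (simp add: algebra_simps)
  finally have 4: "k $ 2 $ 2 = k $ 1 $ 1" by (simp add: 2 3)
  have "k $ 1 $ 2 = k $ 1 $ 2 * (k $ 1 $ 1 * k $ 1 $ 1 + k $ 2 $ 1 * k $ 2 $ 1)"
    by (simp add: 1)
  also have "\<dots> = k $ 1 $ 1 * (k $ 1 $ 1 * k $ 1 $ 2 + k $ 2 $ 1 * k $ 2 $ 2)
      - k $ 2 $ 1 * (k $ 1 $ 1 * k $ 2 $ 2 - k $ 1 $ 2 * k $ 2 $ 1)"
    by (simp add: algebra_simps)
  finally have 5: "k $ 1 $ 2 = - k $ 2 $ 1" by (simp add: 2 3)
  obtain \<theta> where "k $ 1 $ 1 = cos \<theta>" "k $ 2 $ 1 = sin \<theta>"
    using sincos_total_2pi[of "k $ 1 $ 1" "k $ 2 $ 1"] 1 by (auto simp: power2_eq_square)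
  then have "k = rot \<theta>"
    using 4 5 by (intro mat2_eqI) (simp_all add: rot_def)
  then show ?thesis by (rule that)
qed

lemma rot_add: "rot (a + b) = rot a ** rot b"
  by (rule mat2_eqI) (simp_all add: rot_def matrix_mult_2 cos_add sin_add algebra_simps)

lemma rot_0: "rot 0 = mat 1"
  by (rule mat2_eqI) (simp_all add: rot_def mat_def)

text \<open>\<open>matrix_inv\<close> is defined by choice, so uniqueness of the inverse
  enters.\<close>

lemma matrix_inv_rot: "matrix_inv (rot \<theta>) = rot (- \<theta>)"
proof -
  have 1: "rot \<theta> ** rot (- \<theta>) = mat 1 \<and> rot (- \<theta>) ** rot \<theta> = mat 1"
    by (simp flip: rot_add rot_0)
  have 2: "rot \<theta> ** matrix_inv (rot \<theta>) = mat 1"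
    using someI[of "\<lambda>A'. rot \<theta> ** A' = mat 1 \<and> A' ** rot \<theta> = mat 1", OF 1]
    by (simp add: matrix_inv_def)
  have "matrix_inv (rot \<theta>) = (rot (- \<theta>) ** rot \<theta>) ** matrix_inv (rot \<theta>)"
    using 1 by (simp add: matrix_mul_lid)
  also have "\<dots> = rot (- \<theta>)" by (simp add: matrix_mul_assoc[symmetric] 2 matrix_mul_rid)
  finally show ?thesis .
qed

lemma chi_rot: "chi (rot \<theta>) = exp (- \<i> * of_real \<theta>)"
  by (simp add: chi_def rot_def complex_eq_iff Re_exp Im_exp)

lemma chi_mult: "k \<in> SO2 \<Longrightarrow> k' \<in> SO2 \<Longrightarrow> chi (k ** k') = chi k * chi k'"
  by (elim SO2_eq_rot) (simp add: rot_add[symmetric] chi_rot exp_add[symmetric] algebra_simps)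

lemma chi_inv: "k \<in> SO2 \<Longrightarrow> chi (matrix_inv k) = inverse (chi k)"
  by (elim SO2_eq_rot) (simp add: matrix_inv_rot chi_rot exp_minus)

lemma chi_one: "chi (mat 1) = 1"
  by (simp add: chi_def mat_def)

lemma chi_nonzero [simp]: "k \<in> SO2 \<Longrightarrow> chi k \<noteq> 0"
  by (elim SO2_eq_rot) (simp add: chi_rot)

lemma coord_Ad:
  assumes "k \<in> SO2" "Z \<in> sl2c"
  shows "coordX (Ad k Z) = chi k ^ 2 * coordX Z" "coordH (Ad k Z) = coordH Z"
    "coordY (Ad k Z) = inverse (chi k) ^ 2 * coordY Z" "Ad k Z \<in> sl2c"
proof -
  obtain \<theta> where k: "k = rot \<theta>" using assms(1) by (rule SO2_eq_rot)
  define c s where "c = complex_of_real (cos \<theta>)" and "s = complex_of_real (sin \<theta>)"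
  have "c * c + s * s = 1"
    unfolding c_def s_def of_real_mult[symmetric] of_real_add[symmetric] by (simp add: sin_cos_squared_add3)
  \<comment> \<open>Rewriting \<open>s * s\<close> and \<open>h * h\<close> away gives polynomial
    normal forms, so the coordinate identities below are ring computations.\<close>
  then have ss: "s * s = 1 - c * c" by (simp add: algebra_simps)
  define h where "h = \<i> / 2"
  have hh: "h * h = - 1 / 4" "h * (h * x) = - x / 4" for x by (simp_all add: h_def)
  have chi: "chi k = c - 2 * h * s" "inverse (chi k) = c + 2 * h * s"
    unfolding chi_inv[OF assms(1), symmetric] unfolding k matrix_inv_rot
    by (simp_all add: chi_def rot_def c_def s_def h_def)
  obtain p q r where Z: "Z $ 1 $ 1 = p" "Z $ 1 $ 2 = q" "Z $ 2 $ 1 = r" "Z $ 2 $ 2 = - p"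
    using sl2c_22[OF assms(2)] by auto
  have Ad: "Ad k Z $ 1 $ 1 = (c * p - s * r) * c + (c * q + s * p) * (- s)"
    "Ad k Z $ 1 $ 2 = (c * p - s * r) * s + (c * q + s * p) * c"
    "Ad k Z $ 2 $ 1 = (s * p + c * r) * c + (s * q - c * p) * (- s)"
    "Ad k Z $ 2 $ 2 = (s * p + c * r) * s + (s * q - c * p) * c"
    unfolding Ad_def k matrix_inv_rot
    by (simp_all add: matrix_mult_2 complexify_def map_matrix_nth rot_def Z flip: c_def s_def)
  show "coordX (Ad k Z) = chi k ^ 2 * coordX Z"
    unfolding coord_defs h_def[symmetric] Ad chi(1) Z power2_eq_square by (simp add: algebra_simps hh ss)
  show "coordY (Ad k Z) = inverse (chi k) ^ 2 * coordY Z"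
    unfolding coord_defs h_def[symmetric] Ad chi(2) Z power2_eq_square by (simp add: algebra_simps hh ss)
  show "coordH (Ad k Z) = coordH Z"
    unfolding coord_defs h_def[symmetric] Ad Z by (simp add: algebra_simps hh ss)
  show "Ad k Z \<in> sl2c" by (simp add: sl2c_def trace_2 Ad algebra_simps)
qed

lemma chi_rot_powi: "chi (rot \<theta>) powi n = exp (- \<i> * of_int n * of_real \<theta>)"
  by (simp add: chi_rot exp_power_int algebra_simps)

section \<open>\<open>(\<gg>, K)\<close>-modules\<close>

locale gk = fixes M :: "'u gk_module" (structure)
  assumes gk: "is_gk_module M"

sublocale gk \<subseteq> cvec M
  by (rule cvec.intro) (use gk in \<open>simp add: is_gk_module_def\<close>)

context gk
begin

abbreviation xx where "xx \<equiv> gact M X_mat"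
abbreviation yy where "yy \<equiv> gact M Y_mat"
abbreviation hh where "hh \<equiv> gact M H_mat"

lemma gact_linear: "Z \<in> sl2c \<Longrightarrow> linear_map CC M M (gact M Z)"
  using gk by (simp add: is_gk_module_def lie_action_def)

lemma kact_linear: "k \<in> SO2 \<Longrightarrow> linear_map CC M M (kact M k)"
  using gk by (simp add: is_gk_module_def group_action_K_def)

lemmas gact_closed [simp, intro] = linear_mapD(1)[OF gact_linear]
lemmas gact_add = linear_mapD(2)[OF gact_linear]
lemmas gact_smult = linear_mapD(3)[OF gact_linear]
lemmas kact_closed [simp, intro] = linear_mapD(1)[OF kact_linear]
lemmas kact_add = linear_mapD(2)[OF kact_linear]
lemmas kact_smult = linear_mapD(3)[OF kact_linear]

lemma gact_scale: "Z \<in> sl2c \<Longrightarrow> v \<in> V \<Longrightarrow> gact M (map_matrix ((*) c) Z) v = c \<odot> gact M Z v"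
  using gk by (simp add: is_gk_module_def lie_action_def)

lemma gact_plus: "Z \<in> sl2c \<Longrightarrow> Z' \<in> sl2c \<Longrightarrow> v \<in> V \<Longrightarrow> gact M (Z + Z') v = gact M Z v \<oplus> gact M Z' v"
  using gk by (simp add: is_gk_module_def lie_action_def)

lemma gact_bracket:
  "Z \<in> sl2c \<Longrightarrow> Z' \<in> sl2c \<Longrightarrow> v \<in> V \<Longrightarrow>
    gact M (lie_bracket Z Z') v = gact M Z (gact M Z' v) \<ominus> gact M Z' (gact M Z v)"
  using gk by (simp add: is_gk_module_def lie_action_def)

lemma gact_coords:
  assumes "Z \<in> sl2c" "v \<in> V"
  shows "gact M Z v = coordX Z \<odot> xx v \<oplus> (coordH Z \<odot> hh v \<oplus> coordY Z \<odot> yy v)"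
  using assms by (subst sl2c_coords[OF assms(1)]) (simp only: gact_plus gact_scale sl2c_closed basis_in_sl2c)

lemma bracket_HX: "v \<in> V \<Longrightarrow> hh (xx v) \<ominus> xx (hh v) = 2 \<odot> xx v"
  and bracket_HY: "v \<in> V \<Longrightarrow> hh (yy v) \<ominus> yy (hh v) = (- 2) \<odot> yy v"
  and bracket_XY: "v \<in> V \<Longrightarrow> xx (yy v) \<ominus> yy (xx v) = hh v"
  using gact_bracket[of H_mat X_mat v] gact_bracket[of H_mat Y_mat v] gact_bracket[of X_mat Y_mat v]
  by (simp_all add: bracket_basis gact_scale)

lemma kact_mult: "k \<in> SO2 \<Longrightarrow> k' \<in> SO2 \<Longrightarrow> v \<in> V \<Longrightarrow> kact M (k ** k') v = kact M k (kact M k' v)"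
  and kact_one: "v \<in> V \<Longrightarrow> kact M (mat 1) v = v"
  using gk by (simp_all add: is_gk_module_def group_action_K_def)

lemma weight_space_iff: "v \<in> weight_space M n \<longleftrightarrow> v \<in> V \<and> hh v = of_int n \<odot> v"
  by (simp add: weight_space_def)

lemma submodule_weight_space: "submodule (weight_space M n) CC M"
  by (rule submoduleI')
    (auto simp: weight_space_iff gact_add gact_smult smult_add_right smult_smult mult.commute
      linear_map_zero[OF cvec_axioms cvec_axioms gact_linear])

text \<open>The functions \<open>\<theta> \<mapsto> \<phi> (rot \<theta> v)\<close>, for \<open>\<phi>\<close> a functional, solve the same
  linear differential equation as \<open>\<theta> \<mapsto> exp (- \<i> n \<theta>)\<close>.\<close>

lemma kact_weight:
  assumes v: "v \<in> weight_space M n" and k: "k \<in> SO2"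
  shows "kact M k v = chi k powi n \<odot> v"
proof -
  have vV: "v \<in> V" and Hv: "hh v = of_int n \<odot> v" using v by (auto simp: weight_space_iff)
  have "kact M (rot \<theta>) v = exp (- \<i> * of_int n * of_real \<theta>) \<odot> v" for \<theta>
  proof (rule vector_eqI)
    fix \<phi> assume \<phi>: "\<phi> \<in> functionals"
    define c where "c = - \<i> * of_int n"
    define g where "g \<theta> = \<phi> (kact M (rot \<theta>) v)" for \<theta>
    have g: "(g has_vector_derivative c * g t) (at t)" for t
    proof -
      have "\<forall>s. \<forall>v\<in>V. has_derivative_at_0 M (\<lambda>t. kact M (rot (t * s)) v) (gact M (complexify (s *\<^sub>R J_mat)) v)"
        using gk unfolding is_gk_module_def by (elim conjE)
      then have "has_derivative_at_0 M (\<lambda>h. kact M (rot (h * 1)) v) (gact M (complexify (1 *\<^sub>R J_mat)) v)"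
        using vV by (elim allE[of _ 1] ballE[of _ _ v]) auto
      then obtain U where U: "submodule U CC M"
        and der: "\<And>\<psi>. \<psi> \<in> dual_space M U \<Longrightarrow>
          ((\<lambda>h. \<psi> (kact M (rot (h * 1)) v)) has_vector_derivative \<psi> (gact M (complexify (1 *\<^sub>R J_mat)) v)) (at 0)"
        unfolding has_derivative_at_0_def fd_subspace_def by (elim exE conjE) (rule that, assumption, drule (1) bspec, assumption)
      \<comment> \<open>The differential is given only at \<open>0\<close>. The group law carries it
        to \<open>t\<close>: what is tested at \<open>0\<close> is the functional
        \<open>\<phi>\<close> composed with the action of \<open>rot t\<close>.\<close>
      define \<psi> where "\<psi> w = \<phi> (kact M (rot t) w)" for w
      have "\<psi> \<in> dual_space M U"
        using submodule_subset[OF U] \<phi> unfolding \<psi>_def dual_space_def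
        by (auto simp: kact_add kact_smult subset_iff)
      from der[OF this]
      have "((\<lambda>h. \<phi> (kact M (rot t) (kact M (rot h) v))) has_vector_derivative
          \<phi> (kact M (rot t) ((- \<i>) \<odot> hh v))) (at 0)"
        using J_mat_eq[of 1] vV by (simp add: \<psi>_def gact_scale)
      moreover have "\<phi> (kact M (rot t) ((- \<i>) \<odot> hh v)) = c * g t"
        using vV \<phi> by (simp add: Hv smult_smult kact_smult functional_smult g_def c_def)
      moreover have "\<phi> (kact M (rot t) (kact M (rot h) v)) = g (h + t)" for h
        using vV by (simp add: g_def rot_add kact_mult add.commute[of h])
      ultimately have "((\<lambda>h. g (h + t)) has_vector_derivative c * g t) (at 0)" by simp
      then have "((\<lambda>h. g (h + t)) \<circ> (\<lambda>s. s - t) has_vector_derivative 1 *\<^sub>R (c * g t)) (at t)"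
        by (intro vector_diff_chain_at) (auto intro!: derivative_eq_intros)
      then show ?thesis by (simp add: o_def)
    qed
    \<comment> \<open>Integrating factor: the derivative of this product vanishes, so the product is
      constant.\<close>
    define e where "e t = exp (- c * of_real t) * g t" for t
    have e: "(e has_vector_derivative 0) (at t)" for t
    proof -
      have "((\<lambda>t. exp (- c * of_real t)) has_vector_derivative (- c * exp (- c * of_real t))) (at t)"
        by (rule has_vector_derivative_real_field[of "\<lambda>z. exp (- c * z)", unfolded o_def])
          (auto intro!: derivative_eq_intros)
      from has_vector_derivative_mult[OF this g[of t]] show ?thesis
        unfolding e_def by (simp add: algebra_simps)
    qed
    have "e \<theta> = e 0"
      by (rule has_derivative_zero_unique[of UNIV])
        (use e in \<open>auto simp: has_vector_derivative_def\<close>)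
    then have "exp (- c * of_real \<theta>) * g \<theta> = g 0" by (simp add: e_def)
    then have "exp (c * of_real \<theta>) * (exp (- c * of_real \<theta>) * g \<theta>) = exp (c * of_real \<theta>) * g 0" by simp
    then have "g \<theta> = exp (c * of_real \<theta>) * g 0" by (simp add: mult.assoc[symmetric] exp_add[symmetric])
    then show "\<phi> (kact M (rot \<theta>) v) = \<phi> (exp (- \<i> * of_int n * of_real \<theta>) \<odot> v)"
      using vV \<phi> by (simp add: g_def c_def rot_0 kact_one functional_smult)
  qed (use vV in auto)
  then show ?thesis using k by (elim SO2_eq_rot) (simp only: chi_rot_powi)
qed

end

section \<open>Power series in a nilpotent operator\<close>

text \<open>The sum stops before \<open>m\<close>; for an operator whose \<open>m\<close>-th power
  is zero this is the whole series, and no convergence is involved.\<close>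

definition (in cvec) fps_act :: "nat \<Rightarrow> ('u \<Rightarrow> 'u) \<Rightarrow> complex fps \<Rightarrow> 'u \<Rightarrow> 'u" where
  "fps_act m T a v = (\<Oplus>k\<in>{..<m}. fps_nth a k \<odot> (T ^^ k) v)"

locale nil_op = cvec M for M :: "(complex, 'u, 'a) module_scheme" (structure) +
  fixes T :: "'u \<Rightarrow> 'u" and m :: nat
  assumes T_linear: "linear_map CC M M T" and T_nil: "v \<in> V \<Longrightarrow> (T ^^ m) v = \<zero>"
begin

abbreviation ps :: "complex fps \<Rightarrow> 'u \<Rightarrow> 'u" where "ps \<equiv> fps_act m T"

lemmas T_pow_linear = linear_map_funpow[OF T_linear]
lemmas T_pow_closed [simp, intro] = linear_mapD(1)[OF T_pow_linear]
lemmas T_pow_add = linear_mapD(2)[OF T_pow_linear]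
lemmas T_pow_smult = linear_mapD(3)[OF T_pow_linear]
lemmas T_closed [simp, intro] = linear_mapD(1)[OF T_linear]
lemmas T_smult = linear_mapD(3)[OF T_linear]

lemma T_nil_ge: "v \<in> V \<Longrightarrow> m \<le> k \<Longrightarrow> (T ^^ k) v = \<zero>"
  using T_nil[of "(T ^^ (k - m)) v"] funpow_add[of m "k - m" T] by simp

lemma ps_closed [simp, intro]: "v \<in> V \<Longrightarrow> ps a v \<in> V"
  by (auto simp: fps_act_def intro!: M.finsum_closed)

lemma functional_ps:
  "\<phi> \<in> functionals \<Longrightarrow> v \<in> V \<Longrightarrow> \<phi> (ps a v) = (\<Sum>k<m. fps_nth a k * \<phi> ((T ^^ k) v))"
  by (simp add: fps_act_def functional_simps Pi_def)

lemma ps_linear: "linear_map CC M M (ps a)"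
  unfolding linear_map_def
  by (auto intro!: vector_eqI
      simp: functional_simps functional_ps T_pow_add T_pow_smult sum.distrib algebra_simps sum_distrib_left)

lemmas ps_add_right = linear_mapD(2)[OF ps_linear]
lemmas ps_smult_right = linear_mapD(3)[OF ps_linear]
lemmas ps_zero_right [simp] = linear_map_zero[OF cvec_axioms cvec_axioms ps_linear]

lemma ps_add: "v \<in> V \<Longrightarrow> ps (a + b) v = ps a v \<oplus> ps b v"
  by (rule vector_eqI) (auto simp: functional_simps functional_ps sum.distrib algebra_simps)

lemma ps_0 [simp]: "v \<in> V \<Longrightarrow> ps 0 v = \<zero>"
  by (rule vector_eqI) (auto simp: functional_simps functional_ps)

lemma ps_fps_X_power:
  assumes "v \<in> V"
  shows "ps (fps_const c * fps_X ^ j) v = c \<odot> (T ^^ j) v"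
proof (rule vector_eqI)
  fix \<phi> assume \<phi>: "\<phi> \<in> functionals"
  have "\<phi> (ps (fps_const c * fps_X ^ j) v) = (\<Sum>k<m. if k = j then c * \<phi> ((T ^^ k) v) else 0)"
    unfolding functional_ps[OF \<phi> assms] by (intro sum.cong) auto
  also have "\<dots> = c * \<phi> ((T ^^ j) v)"
    using T_nil_ge[OF assms, of j] functional_zero[OF \<phi>] by auto
  finally show "\<phi> (ps (fps_const c * fps_X ^ j) v) = \<phi> (c \<odot> (T ^^ j) v)"
    using assms \<phi> by (simp add: functional_simps)
qed (use assms in auto)

lemma ps_const [simp]: "v \<in> V \<Longrightarrow> ps (fps_const c) v = c \<odot> v"
  using ps_fps_X_power[of v c 0] by simp

lemma ps_1 [simp]: "v \<in> V \<Longrightarrow> ps 1 v = v"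
  using ps_const[of v 1] by simp

lemma ps_X_power: "v \<in> V \<Longrightarrow> ps (fps_X ^ j) v = (T ^^ j) v"
  using ps_fps_X_power[of v 1 j] by simp

lemma ps_X [simp]: "v \<in> V \<Longrightarrow> ps fps_X v = T v"
  using ps_X_power[of v 1] by simp

lemma ps_mult:
  assumes v: "v \<in> V"
  shows "ps (a * b) v = ps a (ps b v)"
proof (rule vector_eqI)
  fix \<phi> assume \<phi>: "\<phi> \<in> functionals"
  define s where "s k = \<phi> ((T ^^ k) v)" for k
  have s: "s k = 0" if "m \<le> k" for k
    using T_nil_ge[OF v that] functional_zero[OF \<phi>] by (simp add: s_def)
  have s': "k < m" if "s k \<noteq> 0" for k
    using s[of k] that by (cases "k < m") auto
  have i: "\<phi> ((T ^^ i) (ps b v)) = (\<Sum>j<m. fps_nth b j * s (i + j))" for i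
  proof -
    have "(\<lambda>v. \<phi> ((T ^^ i) v)) \<in> functionals"
      using \<phi> by (simp add: dual_space_def T_pow_add T_pow_smult)
    from functional_ps[OF this v] show ?thesis
      by (simp add: s_def funpow_add)
  qed
  let ?g = "\<lambda>i j. fps_nth a i * (fps_nth b j * s (i + j))"
  have "\<phi> (ps a (ps b v)) = (\<Sum>i<m. \<Sum>j<m. ?g i j)"
    using v \<phi> by (simp add: functional_ps i sum_distrib_left)
  also have "\<dots> = (\<Sum>(i, j)\<in>{..<m} \<times> {..<m}. ?g i j)"
    by (rule sum.cartesian_product)
  \<comment> \<open>Pairs with \<open>i + j \<ge> m\<close> contribute nothing, since that power of
    \<open>T\<close> is zero; what is left is the Cauchy product.\<close>
  also have "\<dots> = (\<Sum>(i, j)\<in>{(i, j). i + j < m}. ?g i j)"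
    by (rule sum.mono_neutral_right) (auto dest: s')
  also have "\<dots> = (\<Sum>k<m. \<Sum>i\<le>k. ?g i (k - i))"
    by (rule sum.triangle_reindex)
  also have "\<dots> = (\<Sum>k<m. fps_nth (a * b) k * s k)"
    by (auto simp: fps_mult_nth sum_distrib_right atLeast0AtMost mult.assoc intro!: sum.cong)
  also have "\<dots> = \<phi> (ps (a * b) v)"
    using v \<phi> by (simp add: functional_ps s_def)
  finally show "\<phi> (ps (a * b) v) = \<phi> (ps a (ps b v))" by simp
qed (use v in auto)

lemma ps_extend:
  assumes "v \<in> V" "m \<le> n"
  shows "fps_act n T a v = ps a v"
  unfolding fps_act_def
  by (rule M.add.finprod_mono_neutral_cong_right) (use assms T_nil_ge in auto)

lemma ps_submodule:
  assumes "submodule U CC M" "\<And>v. v \<in> U \<Longrightarrow> T v \<in> U" "v \<in> U"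
  shows "ps a v \<in> U"
proof -
  have "(T ^^ k) v \<in> U" for k by (induction k) (use assms in auto)
  then show ?thesis unfolding fps_act_def
    by (intro submodule_finsum[OF assms(1)] submodule_smult[OF assms(1)]) auto
qed

end

text \<open>\<open>f\<close> intertwines all powers of the two operators. Both cut-offs are raised
  to their maximum, so that sums of the same length are compared.\<close>

lemma ps_commute:
  fixes M :: "(complex, 'u, 'a) module_scheme" and N :: "(complex, 'w, 'b) module_scheme"
  assumes M: "nil_op M T m" and N: "nil_op N T' m'" and f: "linear_map CC M N f"
    and c: "\<And>v. v \<in> carrier M \<Longrightarrow> f (T v) = T' (f v)" and v: "v \<in> carrier M"
  shows "f (cvec.fps_act M m T a v) = cvec.fps_act N m' T' a (f v)"
proof -
  interpret M: nil_op M T m by fact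
  interpret N: nil_op N T' m' by fact
  let ?n = "max m m'"
  have cp: "f ((T ^^ k) v) = (T' ^^ k) (f v)" for k
    by (induction k) (use v c in auto)
  have "f (M.fps_act ?n T a v) = N.fps_act ?n T' a (f v)"
    unfolding M.fps_act_def N.fps_act_def
    by (subst linear_map_finsum[OF M.cvec_axioms N.cvec_axioms f])
      (use v in \<open>auto simp: linear_mapD[OF f] cp\<close>)
  then show ?thesis
    using M.ps_extend[OF v, of ?n] N.ps_extend[OF linear_mapD(1)[OF f v], of ?n] by simp
qed

section \<open>Modules over the order\<close>

text \<open>\<open>\<AA>\<close> consists of the matrices whose \<open>(r, s)\<close> entry is divisible by \<open>t\<close> to the power \<open>eps r s\<close>.\<close>

definition eps :: "3 \<Rightarrow> 3 \<Rightarrow> nat" where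
  "eps r s = (if r = s \<or> s = 1 then 0 else 1)"

text \<open>The generators of the order at the positions \<open>r s\<close> and \<open>s t\<close>
  multiply to the generator at \<open>r t\<close> times this power of the variable. The subtraction
  never truncates, as \<open>eps_triangle\<close> records.\<close>

definition delta :: "3 \<Rightarrow> 3 \<Rightarrow> 3 \<Rightarrow> nat" where
  "delta r s t = eps r s + eps s t - eps r t"

lemma three_distinct [simp]: "(1::3) \<noteq> 2" "(1::3) \<noteq> 3" "(2::3) \<noteq> 3" "(2::3) \<noteq> 1" "(3::3) \<noteq> 1" "(3::3) \<noteq> 2"
  by simp_all

lemma eps_triangle: "eps r s + eps s t = delta r s t + eps r t"
  by (auto simp: eps_def delta_def)

lemma order_A_simps [simp]:
  "mult order_A = (**)" "one order_A = mat 1" "zero order_A = 0" "add order_A = (+)"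
  by (simp_all add: order_A_def)

lemma order_A_iff: "a \<in> carrier order_A \<longleftrightarrow> (\<forall>r s. fps_X ^ eps r s dvd a $ r $ s)"
  by (simp add: order_A_def forall_3 eps_def)

lemma order_A_entry:
  assumes "a \<in> carrier order_A"
  shows "a $ r $ s = fps_X ^ eps r s * fps_shift (eps r s) (a $ r $ s)"
proof -
  obtain b where "a $ r $ s = fps_X ^ eps r s * b" using assms by (auto simp: order_A_iff dvd_def)
  then show ?thesis by (simp add: mult.commute)
qed

lemma order_A_mult_entry:
  assumes "a \<in> carrier order_A" "b \<in> carrier order_A"
  shows "a $ r $ s * b $ s $ t = fps_X ^ eps r t *
    (fps_X ^ delta r s t * (fps_shift (eps r s) (a $ r $ s) * fps_shift (eps s t) (b $ s $ t)))"
  by (subst order_A_entry[OF assms(1), of r s], subst order_A_entry[OF assms(2), of s t])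
    (simp add: mult.assoc mult.left_commute[of _ "fps_X ^ eps s t"] power_add[symmetric]
      flip: mult.assoc, simp add: eps_triangle add.commute power_add mult_ac)

lemma mat_mult_entry: "((a :: fmat3) ** b) $ r $ t = (\<Sum>s\<in>UNIV. a $ r $ s * b $ s $ t)"
  by (simp add: matrix_matrix_mult_def)

text \<open>Closure under products is the triangle inequality for the exponents
  \<open>eps\<close>.\<close>

lemma ring_order_A: "Ring.ring order_A"
proof -
  have mult: "x ** y \<in> carrier order_A" if "x \<in> carrier order_A" "y \<in> carrier order_A" for x y
    using that by (auto simp: order_A_iff[of "x ** y"] mat_mult_entry order_A_mult_entry intro!: dvd_sum)
  have add: "x + y \<in> carrier order_A" if "x \<in> carrier order_A" "y \<in> carrier order_A" for x y
    using that by (auto simp: order_A_iff intro!: dvd_add)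
  have neg: "- x \<in> carrier order_A" if "x \<in> carrier order_A" for x
    using that by (auto simp: order_A_iff)
  have 0: "0 \<in> carrier order_A" and 1: "mat 1 \<in> carrier order_A"
    by (auto simp: order_A_iff mat_def eps_def)
  have "abelian_group order_A"
    by (rule abelian_groupI) (auto simp: add 0 add.assoc add.commute intro: bexI[OF _ neg])
  moreover have "monoid order_A"
    by (rule monoidI) (auto simp: mult 1 matrix_mul_assoc)
  ultimately show ?thesis
    by (rule ringI) (auto simp: vec_eq_iff mat_mult_entry distrib_left distrib_right sum.distrib)
qed

lemma mat_elem_nth: "mat_elem r s b $ i $ j = (if i = r \<and> j = s then b else 0)"
  by (simp add: mat_elem_def)

lemma mat_elem_in_order_A: "fps_X ^ eps r s dvd b \<Longrightarrow> mat_elem r s b \<in> carrier order_A"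
  by (auto simp: order_A_iff mat_elem_nth)

lemma mat_in_order_A: "mat b \<in> carrier order_A"
  by (auto simp: order_A_iff mat_def eps_def)

lemma mat_elem_mult: "mat_elem r s a ** mat_elem s' t b = (if s = s' then mat_elem r t (a * b) else 0)"
  by (auto simp: vec_eq_iff mat_mult_entry mat_elem_nth if_distrib[of "\<lambda>x. x * _"] if_distrib[of "\<lambda>x. _ * x"]
      cong: if_cong)

lemma mat_mult_mat_elem: "mat a ** mat_elem r s b = mat_elem r s (a * b)"
  by (auto simp: vec_eq_iff mat_mult_entry mat_elem_nth mat_def if_distrib[of "\<lambda>x. x * _"] cong: if_cong)

lemma mat_elem_mult_mat: "mat_elem r s b ** mat a = mat_elem r s (a * b)"
  by (auto simp: vec_eq_iff mat_mult_entry mat_elem_nth mat_def if_distrib[of "\<lambda>x. _ * x"] mult.commute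
      cong: if_cong)

lemma mat_mult_mat: "mat a ** mat b = (mat (a * b) :: fmat3)"
  by (auto simp: vec_eq_iff mat_mult_entry mat_def if_distrib[of "\<lambda>x. x * _"] cong: if_cong)

lemma mat_add: "mat (a + b) = (mat a + mat b :: fmat3)"
  by (auto simp: vec_eq_iff mat_def)

lemma fmat3_eq_sum: "(a :: fmat3) = (\<Sum>r\<in>UNIV. \<Sum>s\<in>UNIV. mat_elem r s (a $ r $ s))"
proof -
  have "(\<Sum>r\<in>UNIV. \<Sum>s\<in>UNIV. mat_elem r s (a $ r $ s)) $ i $ j = a $ i $ j" for i j
  proof -
    have "(\<Sum>r\<in>UNIV. \<Sum>s\<in>UNIV. mat_elem r s (a $ r $ s)) $ i $ j
        = (\<Sum>r\<in>UNIV. \<Sum>s\<in>UNIV. if s = j then if r = i then a $ r $ s else 0 else 0)"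
      unfolding sum_component mat_elem_nth by (intro sum.cong refl) auto
    then show ?thesis by simp
  qed
  then show ?thesis by (simp only: vec_eq_iff) simp
qed

text \<open>The data of a nilpotent representation of the Gelfand quiver on one space: \<open>e\<close> projects onto the
  components, \<open>th r s\<close> is the operator of \<open>t\<^bsup>eps r s\<^esup> E\<^sub>r\<^sub>s\<close>, and \<open>T\<close> is the operator of \<open>t\<close>.\<close>

locale gelfand_module = nil_op M T m for M :: "(complex, 'u, 'a) module_scheme" (structure) and T m +
  fixes e :: "3 \<Rightarrow> 'u \<Rightarrow> 'u" and th :: "3 \<Rightarrow> 3 \<Rightarrow> 'u \<Rightarrow> 'u"
  assumes e_linear: "linear_map CC M M (e r)"
    and e_e: "v \<in> V \<Longrightarrow> e r (e s v) = (if r = s then e r v else \<zero>)"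
    and e_sum: "v \<in> V \<Longrightarrow> v = (\<Oplus>r\<in>UNIV. e r v)"
    and th_linear: "linear_map CC M M (th r s)"
    and e_th: "v \<in> V \<Longrightarrow> e r (th r s v) = th r s v"
    and th_e: "v \<in> V \<Longrightarrow> th r s (e s v) = th r s v"
    and th_diag: "v \<in> V \<Longrightarrow> th r r v = e r v"
    and th_th: "v \<in> V \<Longrightarrow> th r s (th s t v) = (T ^^ delta r s t) (th r t v)"
    and T_th: "v \<in> V \<Longrightarrow> T (th r s v) = th r s (T v)"
begin

lemmas e_closed [simp, intro] = linear_mapD(1)[OF e_linear]
lemmas th_closed [simp, intro] = linear_mapD(1)[OF th_linear]
lemmas th_add = linear_mapD(2)[OF th_linear]
lemmas th_smult = linear_mapD(3)[OF th_linear]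
lemmas th_zero [simp] = linear_map_zero[OF cvec_axioms cvec_axioms th_linear]

lemma th_th_0: "v \<in> V \<Longrightarrow> s \<noteq> s' \<Longrightarrow> th r s (th s' t v) = \<zero>"
  by (metis e_e e_th th_closed th_e th_zero)

lemma th_ps: "v \<in> V \<Longrightarrow> th r s (ps a v) = ps a (th r s v)"
  using T_th by (intro ps_commute[OF nil_op_axioms nil_op_axioms th_linear]) auto

text \<open>An entry of a matrix in the order is a power series times the \<open>eps r s\<close>-th
  power of the variable. \<open>fps_shift\<close> extracts the series, which acts through
  \<open>T\<close>, and \<open>th r s\<close> accounts for the rest. Outside the order the shift
  drops coefficients, so multiplicativity is claimed only on the carrier.\<close>

definition order_act :: "fmat3 \<Rightarrow> 'u \<Rightarrow> 'u" where
  "order_act a v = (\<Oplus>r\<in>UNIV. \<Oplus>s\<in>UNIV. ps (fps_shift (eps r s) (a $ r $ s)) (th r s v))"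

lemma order_act_closed [simp, intro]: "v \<in> V \<Longrightarrow> order_act a v \<in> V"
  by (auto simp: order_act_def intro!: M.finsum_closed)

lemma functional_order_act:
  "\<phi> \<in> functionals \<Longrightarrow> v \<in> V \<Longrightarrow>
    \<phi> (order_act a v) = (\<Sum>r\<in>UNIV. \<Sum>s\<in>UNIV. \<phi> (ps (fps_shift (eps r s) (a $ r $ s)) (th r s v)))"
  by (simp add: order_act_def functional_finsum Pi_def)

lemma order_act_linear: "linear_map CC M M (order_act a)"
  unfolding linear_map_def
  by (auto intro!: vector_eqI simp: functional_add functional_smult functional_order_act th_add th_smult
      ps_add_right ps_smult_right sum.distrib sum_distrib_left)

lemma order_act_add: "v \<in> V \<Longrightarrow> order_act (a + b) v = order_act a v \<oplus> order_act b v"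
  by (rule vector_eqI)
    (auto simp: functional_add functional_order_act fps_shift_add ps_add sum.distrib)

lemma order_act_mat_elem:
  assumes "v \<in> V"
  shows "order_act (mat_elem r s b) v = ps (fps_shift (eps r s) b) (th r s v)"
proof (rule vector_eqI)
  fix \<phi> assume \<phi>: "\<phi> \<in> functionals"
  have "\<phi> (order_act (mat_elem r s b) v)
      = (\<Sum>i\<in>UNIV. \<Sum>j\<in>UNIV. if j = s then if i = r then \<phi> (ps (fps_shift (eps r s) b) (th r s v)) else 0 else 0)"
    unfolding functional_order_act[OF \<phi> assms] mat_elem_nth
    using assms \<phi> by (intro sum.cong refl) (auto simp: functional_zero)
  then show "\<phi> (order_act (mat_elem r s b) v) = \<phi> (ps (fps_shift (eps r s) b) (th r s v))"
    by simp
qed (use assms in auto)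

lemma order_act_mat:
  assumes "v \<in> V"
  shows "order_act (mat b) v = ps b v"
proof (rule vector_eqI)
  fix \<phi> assume \<phi>: "\<phi> \<in> functionals"
  have "\<phi> (order_act (mat b) v) = (\<Sum>i\<in>UNIV. \<Sum>j\<in>UNIV. if j = i then \<phi> (ps b (e i v)) else 0)"
    unfolding functional_order_act[OF \<phi> assms]
    using assms \<phi> by (intro sum.cong refl) (auto simp: mat_def functional_zero eps_def th_diag)
  also have "\<dots> = (\<Sum>i\<in>UNIV. \<phi> (ps b (e i v)))" by simp
  also have "\<dots> = \<phi> (ps b (\<Oplus>i\<in>UNIV. e i v))"
    using assms \<phi> by (subst linear_map_finsum[OF cvec_axioms cvec_axioms ps_linear])
      (auto simp: functional_finsum)
  finally show "\<phi> (order_act (mat b) v) = \<phi> (ps b v)"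
    using e_sum[OF assms] by simp
qed (use assms in auto)

text \<open>Applying \<open>th r s\<close> to the inner action keeps only its row \<open>s\<close>,
  by \<open>th_th_0\<close>. The composite \<open>th r s (th s t v)\<close> then costs a factor
  \<open>T ^^ delta r s t\<close>, the same surplus power that \<open>order_A_mult_entry\<close>
  finds in the entries of the matrix product.\<close>

lemma order_act_mult:
  assumes ab: "a \<in> carrier order_A" "b \<in> carrier order_A" and v: "v \<in> V"
  shows "order_act (a ** b) v = order_act a (order_act b v)"
proof (rule vector_eqI)
  fix \<phi> assume \<phi>: "\<phi> \<in> functionals"
  let ?a = "\<lambda>r s. fps_shift (eps r s) (a $ r $ s)" and ?b = "\<lambda>r s. fps_shift (eps r s) (b $ r $ s)"
  have th_b: "th r s (order_act b v) = (\<Oplus>t\<in>UNIV. ps (?b s t) (th r s (th s t v)))" for r s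
  proof (rule vector_eqI)
    fix \<phi> assume \<phi>: "\<phi> \<in> functionals"
    have "(\<lambda>v. \<phi> (th r s v)) \<in> functionals"
      using \<phi> by (simp add: dual_space_def th_add th_smult)
    from functional_order_act[OF this v, of b]
    have "\<phi> (th r s (order_act b v)) = (\<Sum>s'\<in>UNIV. \<Sum>t\<in>UNIV. \<phi> (ps (?b s' t) (th r s (th s' t v))))"
      using v by (simp add: th_ps)
    also have "\<dots> = (\<Sum>s'\<in>UNIV. if s' = s then (\<Sum>t\<in>UNIV. \<phi> (ps (?b s t) (th r s (th s t v)))) else 0)"
      using v \<phi> by (intro sum.cong refl) (auto simp: th_th_0 functional_zero)
    also have "\<dots> = \<phi> (\<Oplus>t\<in>UNIV. ps (?b s t) (th r s (th s t v)))"
      using v \<phi> by (simp add: functional_finsum Pi_def)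
    finally show "\<phi> (th r s (order_act b v)) = \<phi> (\<Oplus>t\<in>UNIV. ps (?b s t) (th r s (th s t v)))" .
  qed (use v in \<open>auto intro!: M.finsum_closed\<close>)
  have "\<phi> (order_act a (order_act b v))
      = (\<Sum>r\<in>UNIV. \<Sum>s\<in>UNIV. \<Sum>t\<in>UNIV. \<phi> (ps (?a r s) (ps (?b s t) (th r s (th s t v)))))"
    using v \<phi> by (simp add: functional_order_act th_b functional_finsum Pi_def
        linear_map_finsum[OF cvec_axioms cvec_axioms ps_linear])
  also have "\<dots> = (\<Sum>r\<in>UNIV. \<Sum>s\<in>UNIV. \<Sum>t\<in>UNIV.
      \<phi> (ps (fps_X ^ delta r s t * (?a r s * ?b s t)) (th r t v)))"
    using v by (intro sum.cong refl arg_cong[of _ _ \<phi>])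
      (simp add: th_th ps_mult ps_X_power[symmetric] flip: ps_mult, simp add: mult_ac)
  also have "\<dots> = (\<Sum>r\<in>UNIV. \<Sum>t\<in>UNIV. \<Sum>s\<in>UNIV.
      \<phi> (ps (fps_X ^ delta r s t * (?a r s * ?b s t)) (th r t v)))"
    by (intro sum.cong refl sum.swap)
  also have "\<dots> = (\<Sum>r\<in>UNIV. \<Sum>t\<in>UNIV. \<phi> (ps (fps_shift (eps r t) ((a ** b) $ r $ t)) (th r t v)))"
  proof (intro sum.cong refl)
    fix r t
    have "(a ** b) $ r $ t = (\<Sum>s\<in>UNIV. fps_X ^ delta r s t * (?a r s * ?b s t)) * fps_X ^ eps r t"
      unfolding mat_mult_entry order_A_mult_entry[OF ab] by (simp only: sum_distrib_right mult.commute[of "fps_X ^ eps r t"])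
    then have "fps_shift (eps r t) ((a ** b) $ r $ t) = (\<Sum>s\<in>UNIV. fps_X ^ delta r s t * (?a r s * ?b s t))"
      by simp
    moreover have "\<phi> (ps (\<Sum>s\<in>S. f s) (th r t v)) = (\<Sum>s\<in>S. \<phi> (ps (f s) (th r t v)))"
      if "finite S" for S :: "3 set" and f
      using that by (induction S rule: finite_induct)
        (use v \<phi> in \<open>auto simp: ps_add functional_add functional_zero\<close>)
    ultimately show "(\<Sum>s\<in>UNIV. \<phi> (ps (fps_X ^ delta r s t * (?a r s * ?b s t)) (th r t v)))
        = \<phi> (ps (fps_shift (eps r t) ((a ** b) $ r $ t)) (th r t v))" by simp
  qed
  also have "\<dots> = \<phi> (order_act (a ** b) v)"
    using v \<phi> by (simp add: functional_order_act)
  finally show "\<phi> (order_act (a ** b) v) = \<phi> (order_act a (order_act b v))" by simp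
qed (use v in auto)

lemma T_e:
  "v \<in> V \<Longrightarrow> T (e 1 v) = th 1 2 (th 2 1 v)" "v \<in> V \<Longrightarrow> T (e 2 v) = th 2 1 (th 1 2 v)"
  "v \<in> V \<Longrightarrow> T (e 3 v) = th 3 1 (th 1 3 v)"
  by (simp_all add: th_th delta_def eps_def th_diag)

lemma th_23_32: "v \<in> V \<Longrightarrow> th 2 3 v = th 2 1 (th 1 3 v)" "v \<in> V \<Longrightarrow> th 3 2 v = th 3 1 (th 1 2 v)"
  by (simp_all add: th_th delta_def eps_def)

end

text \<open>Compatibility with the idempotents and the four arrows suffices: on each component
  \<open>T\<close> is a product of two arrows, and so are \<open>th 2 3\<close> and
  \<open>th 3 2\<close>. Power series in \<open>T\<close> follow by
  \<open>ps_commute\<close>.\<close>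

lemma order_act_commute:
  fixes M :: "(complex, 'u, 'a) module_scheme" and N :: "(complex, 'w, 'b) module_scheme"
  assumes M: "gelfand_module M T m e th" and N: "gelfand_module N T' m' e' th'"
    and f: "linear_map CC M N f" and v: "v \<in> carrier M"
    and e: "\<And>r v. v \<in> carrier M \<Longrightarrow> f (e r v) = e' r (f v)"
    and th: "\<And>v. v \<in> carrier M \<Longrightarrow> f (th 1 2 v) = th' 1 2 (f v)"
      "\<And>v. v \<in> carrier M \<Longrightarrow> f (th 2 1 v) = th' 2 1 (f v)"
      "\<And>v. v \<in> carrier M \<Longrightarrow> f (th 1 3 v) = th' 1 3 (f v)"
      "\<And>v. v \<in> carrier M \<Longrightarrow> f (th 3 1 v) = th' 3 1 (f v)"
  shows "f (gelfand_module.order_act M T m th a v) = gelfand_module.order_act N T' m' th' a (f v)"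
proof -
  interpret M: gelfand_module M T m e th by fact
  interpret N: gelfand_module N T' m' e' th' by fact
  note f_closed = linear_mapD(1)[OF f]
  note fsum = linear_map_finsum[OF M.cvec_axioms N.cvec_axioms f]
  have th': "f (th r s v) = th' r s (f v)" if v: "v \<in> carrier M" for r s v
  proof -
    have "\<forall>r s. f (th r s v) = th' r s (f v)"
      unfolding forall_3
      using v by (simp add: th e M.th_diag N.th_diag M.th_23_32 N.th_23_32 f_closed)
    then show ?thesis by blast
  qed
  have T: "f (T v) = T' (f v)" if v: "v \<in> carrier M" for v
  proof -
    have "\<forall>r. f (T (e r v)) = T' (e' r (f v))"
      unfolding forall_3 using v by (simp add: M.T_e N.T_e th' f_closed)
    moreover have "f (T v) = (\<Oplus>\<^bsub>N\<^esub>r\<in>UNIV. f (T (e r v)))"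
      using v by (subst M.e_sum[OF v], subst linear_map_finsum[OF M.cvec_axioms M.cvec_axioms M.T_linear])
        (auto simp: fsum)
    moreover have "T' (f v) = (\<Oplus>\<^bsub>N\<^esub>r\<in>UNIV. T' (e' r (f v)))"
      using f_closed[OF v]
      by (subst N.e_sum[OF f_closed[OF v]], subst linear_map_finsum[OF N.cvec_axioms N.cvec_axioms N.T_linear]) auto
    ultimately show ?thesis by simp
  qed
  show ?thesis
    unfolding M.order_act_def N.order_act_def using v
    by (subst fsum, simp, blast intro: M.M.finsum_closed, subst fsum)
      (auto simp: th' ps_commute[OF M.nil_op_axioms N.nil_op_axioms f T] intro!: M.M.finsum_closed)
qed

section \<open>Finite dimensional modules over the order\<close>

text \<open>Gaussian elimination, by induction on the set \<open>B\<close> of equations; there are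
  more unknowns \<open>c k\<close> than equations.\<close>

lemma linear_dependence:
  fixes g :: "'k \<Rightarrow> 'b \<Rightarrow> complex"
  assumes "finite B" "finite K" "card B < card K"
  shows "\<exists>c. (\<exists>k\<in>K. c k \<noteq> 0) \<and> (\<forall>b\<in>B. (\<Sum>k\<in>K. c k * g k b) = 0)"
  using assms
proof (induction B arbitrary: K g rule: finite_induct)
  case empty
  then have "K \<noteq> {}" by auto
  then show ?case by (intro exI[of _ "\<lambda>_. 1"]) auto
next
  case (insert x B)
  show ?case
  proof (cases "\<exists>j\<in>K. g j x \<noteq> 0")
    case False
    then have x: "(\<Sum>k\<in>K. c k * g k x) = 0" for c by simp
    have "card B < card K" using insert.prems insert.hyps by simp
    from insert.IH[OF insert.prems(1) this, of g] show ?thesis using x by auto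
  next
    case True
    then obtain j where j: "j \<in> K" "g j x \<noteq> 0" by auto
    let ?K = "K - {j}"
    have "card B < card ?K" using insert.prems insert.hyps j by simp
    \<comment> \<open>Subtracting the multiple of \<open>g j\<close> that kills the coordinate
      \<open>x\<close> leaves one equation and one unknown fewer. The coefficient \<open>d j\<close>
      below is then chosen so that the equation at \<open>x\<close> holds too.\<close>
    from insert.IH[OF _ this, of "\<lambda>k b. g k b - g k x / g j x * g j b"] insert.prems(1)
    obtain c where c: "\<exists>k\<in>?K. c k \<noteq> 0"
      "\<forall>b\<in>B. (\<Sum>k\<in>?K. c k * (g k b - g k x / g j x * g j b)) = 0"
      by auto
    define d where "d k = (if k = j then - (\<Sum>k\<in>?K. c k * (g k x / g j x)) else c k)" for k
    have d: "(\<Sum>k\<in>K. d k * g k b) = (\<Sum>k\<in>?K. c k * (g k b - g k x / g j x * g j b))" for b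
    proof -
      have "(\<Sum>k\<in>K. d k * g k b) = d j * g j b + (\<Sum>k\<in>?K. d k * g k b)"
        using j insert.prems(1) by (simp add: sum.remove)
      also have "(\<Sum>k\<in>?K. d k * g k b) = (\<Sum>k\<in>?K. c k * g k b)"
        by (intro sum.cong) (auto simp: d_def)
      also have "d j * g j b = - (\<Sum>k\<in>?K. c k * (g k x / g j x) * g j b)"
        by (simp add: d_def sum_distrib_right)
      finally show ?thesis by (simp add: sum_subtractf right_diff_distrib mult.assoc)
    qed
    have "(\<Sum>k\<in>K. d k * g k x) = 0"
      unfolding d using j(2) by simp
    moreover have "\<exists>k\<in>K. d k \<noteq> 0" using c(1) by (auto simp: d_def)
    ultimately show ?thesis using c(2) d by (intro exI[of _ d]) auto
  qed
qed

lemma abelian_group_cong: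
  assumes "abelian_group N" "carrier N' = carrier N" "add N' = add N" "zero N' = zero N"
  shows "abelian_group N'"
proof -
  interpret N: abelian_group N by fact
  show ?thesis
    by (rule abelian_groupI)
      (use N.a_inv_closed N.l_neg in \<open>auto simp: assms(2-) N.a_assoc intro: N.a_comm\<close>)
qed

locale left_A = fixes N :: "(fmat3, 'u) module"
  assumes N_obj: "N \<in> Obj Rep_A"
begin

abbreviation U where "U \<equiv> underlying_vspace N"

lemma U_simps [simp]: "carrier U = carrier N" "add U = add N" "zero U = zero N"
  by (simp_all add: underlying_vspace_def)

lemma U_smult: "c \<odot>\<^bsub>U\<^esub> v = mat (fps_const c) \<odot>\<^bsub>N\<^esub> v"
  by (simp add: underlying_vspace_def)

lemma left_module_N: "left_module order_A N" and fd_N: "fd_subspace U (carrier N)"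
  using N_obj by (simp_all add: Rep_A_def)

lemma act_closed: "a \<in> carrier order_A \<Longrightarrow> v \<in> carrier N \<Longrightarrow> a \<odot>\<^bsub>N\<^esub> v \<in> carrier N"
  and act_add_left: "a \<in> carrier order_A \<Longrightarrow> b \<in> carrier order_A \<Longrightarrow> v \<in> carrier N \<Longrightarrow>
    (a + b) \<odot>\<^bsub>N\<^esub> v = a \<odot>\<^bsub>N\<^esub> v \<oplus>\<^bsub>N\<^esub> b \<odot>\<^bsub>N\<^esub> v"
  and act_add_right: "a \<in> carrier order_A \<Longrightarrow> v \<in> carrier N \<Longrightarrow> w \<in> carrier N \<Longrightarrow>
    a \<odot>\<^bsub>N\<^esub> (v \<oplus>\<^bsub>N\<^esub> w) = a \<odot>\<^bsub>N\<^esub> v \<oplus>\<^bsub>N\<^esub> a \<odot>\<^bsub>N\<^esub> w"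
  and act_mult: "a \<in> carrier order_A \<Longrightarrow> b \<in> carrier order_A \<Longrightarrow> v \<in> carrier N \<Longrightarrow>
    a \<odot>\<^bsub>N\<^esub> (b \<odot>\<^bsub>N\<^esub> v) = (a ** b) \<odot>\<^bsub>N\<^esub> v"
  and act_one: "v \<in> carrier N \<Longrightarrow> mat 1 \<odot>\<^bsub>N\<^esub> v = v"
  and abelian_group_N: "abelian_group N"
  using left_module_N by (auto simp: left_module_def)

lemma cvec_U: "cvec U"
proof (rule cvec.intro, rule moduleI[OF cring_CC])
  show "abelian_group U"
    by (rule abelian_group_cong[OF abelian_group_N]) simp_all
qed (simp_all add: U_smult act_closed act_add_left[symmetric] act_add_right act_mult act_one mat_in_order_A
    mat_mult_mat mat_add[symmetric] fps_const_add[symmetric] fps_const_mult[symmetric]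
    del: fps_const_add fps_const_mult)

end

sublocale left_A \<subseteq> cvec "underlying_vspace N"
  by (rule cvec_U)

context left_A
begin

lemma U_smult_mem [simp, intro]: "v \<in> carrier N \<Longrightarrow> c \<odot>\<^bsub>U\<^esub> v \<in> carrier N"
  using smult_mem[of v c] by simp

text \<open>Scalar matrices are central, so the action of the order commutes with that of
  \<open>\<complex>\<close>.\<close>

lemma act_linear:
  assumes "a \<in> carrier order_A"
  shows "linear_map CC U U (\<lambda>v. a \<odot>\<^bsub>N\<^esub> v)"
proof -
  have "a ** mat b = mat b ** a" for b
    by (auto simp: vec_eq_iff mat_mult_entry mat_def if_distrib[of "\<lambda>x. x * _"]
        if_distrib[of "\<lambda>x. _ * x"] mult.commute cong: if_cong)
  then show ?thesis
    using assms by (auto simp: linear_map_def U_smult act_closed act_add_right act_mult mat_in_order_A)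
qed

lemma act_zero_left: "v \<in> carrier N \<Longrightarrow> 0 \<odot>\<^bsub>N\<^esub> v = \<zero>\<^bsub>N\<^esub>"
proof -
  assume "v \<in> carrier N"
  moreover have "mat (fps_const 0) = (0 :: fmat3)" by (simp add: mat_def vec_eq_iff)
  ultimately show ?thesis using smult_0[of v] by (simp add: U_smult)
qed

lemma act_sum:
  assumes "finite K" "\<And>k. k \<in> K \<Longrightarrow> a k \<in> carrier order_A" "v \<in> carrier N"
  shows "(\<Sum>k\<in>K. a k) \<odot>\<^bsub>N\<^esub> v = (\<Oplus>\<^bsub>U\<^esub>k\<in>K. a k \<odot>\<^bsub>N\<^esub> v) \<and> (\<Sum>k\<in>K. a k) \<in> carrier order_A"
  using assms(1,2)
proof (induction K rule: finite_induct)
  case empty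
  have "(\<Sum>k\<in>{}. a k) \<odot>\<^bsub>N\<^esub> v = \<zero>\<^bsub>N\<^esub>" using assms(3) by (simp add: act_zero_left)
  then show ?case by (simp add: order_A_iff)
next
  case (insert x F)
  interpret A: Ring.ring order_A by (rule ring_order_A)
  have "a x + (\<Sum>k\<in>F. a k) \<in> carrier order_A"
    using insert A.add.m_closed[of "a x" "\<Sum>k\<in>F. a k"] by simp
  moreover have "(\<Oplus>\<^bsub>U\<^esub>k\<in>insert x F. a k \<odot>\<^bsub>N\<^esub> v) = a x \<odot>\<^bsub>N\<^esub> v \<oplus>\<^bsub>U\<^esub> (\<Oplus>\<^bsub>U\<^esub>k\<in>F. a k \<odot>\<^bsub>N\<^esub> v)"
    using insert assms(3) by (intro M.finsum_insert) (auto simp: act_closed)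
  ultimately show ?case using insert assms(3) by (simp add: act_add_left)
qed

definition tT :: "'u \<Rightarrow> 'u" where "tT v = mat fps_X \<odot>\<^bsub>N\<^esub> v"
definition te :: "3 \<Rightarrow> 'u \<Rightarrow> 'u" where "te r v = mat_elem r r 1 \<odot>\<^bsub>N\<^esub> v"
definition tth :: "3 \<Rightarrow> 3 \<Rightarrow> 'u \<Rightarrow> 'u" where "tth r s v = mat_elem r s (fps_X ^ eps r s) \<odot>\<^bsub>N\<^esub> v"

lemma tT_power: "v \<in> carrier N \<Longrightarrow> (tT ^^ k) v = mat (fps_X ^ k) \<odot>\<^bsub>N\<^esub> v"
  by (induction k) (auto simp: tT_def act_one act_mult mat_in_order_A mat_mult_mat)

lemma polynomial_act:
  assumes "finite K" "v \<in> carrier N"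
  shows "mat (\<Sum>k\<in>K. fps_const (c k) * fps_X ^ k) \<odot>\<^bsub>N\<^esub> v = (\<Oplus>\<^bsub>U\<^esub>k\<in>K. c k \<odot>\<^bsub>U\<^esub> (tT ^^ k) v)"
proof -
  have "mat (\<Sum>k\<in>K. fps_const (c k) * fps_X ^ k) = (\<Sum>k\<in>K. mat (fps_const (c k) * fps_X ^ k) :: fmat3)"
    by (auto simp: vec_eq_iff mat_def sum_component)
  then show ?thesis
    using assms act_sum[of K "\<lambda>k. mat (fps_const (c k) * fps_X ^ k)" v]
    by (simp add: mat_in_order_A U_smult tT_power act_mult mat_mult_mat)
qed

text \<open>The powers \<open>t\<^sup>k v\<close> are linearly dependent, and a nonzero power series is \<open>t\<^sup>r\<close> times a unit.\<close>

lemma tT_nilpotent: "\<exists>m. \<forall>v\<in>carrier N. (tT ^^ m) v = \<zero>\<^bsub>N\<^esub>"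
proof -
  obtain B where B: "B \<subseteq> carrier N" "finite B" "carrier N \<subseteq> span_of B"
    using fd_N by (auto simp: fd_subspace_iff)
  \<comment> \<open>The powers from \<open>0\<close> to \<open>card B\<close> give one vector more
    than the spanning set \<open>B\<close> has elements, so the same exponent works for all
    \<open>v\<close>.\<close>
  have "(tT ^^ card B) v = \<zero>\<^bsub>N\<^esub>" if v: "v \<in> carrier N" for v
  proof -
    have pc: "(tT ^^ k) v \<in> carrier N" for k
      using v by (simp add: tT_power act_closed mat_in_order_A)
    have "\<exists>c. (tT ^^ k) v = (\<Oplus>\<^bsub>U\<^esub>b\<in>B. c b \<odot>\<^bsub>U\<^esub> b)" for k
      using B(3) pc[of k] by (auto simp: span_of_def)
    then obtain g where g: "\<And>k. (tT ^^ k) v = (\<Oplus>\<^bsub>U\<^esub>b\<in>B. g k b \<odot>\<^bsub>U\<^esub> b)" by metis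
    obtain c where c: "\<exists>k\<in>{..card B}. c k \<noteq> 0" "\<And>b. b \<in> B \<Longrightarrow> (\<Sum>k\<le>card B. c k * g k b) = 0"
      using linear_dependence[of B "{..card B}" g] B(2) by auto
    define q where "q = (\<Sum>k\<le>card B. fps_const (c k) * fps_X ^ k)"
    have qn: "fps_nth q k = (if k \<le> card B then c k else 0)" for k
      by (simp add: q_def fps_sum_nth if_distrib[of "\<lambda>x. _ * x"] cong: if_cong)
    have q0: "q \<noteq> 0" and sd: "subdegree q \<le> card B"
    proof -
      obtain k where k: "k \<le> card B" "fps_nth q k \<noteq> 0" using c(1) qn by auto
      then show "q \<noteq> 0" by auto
      show "subdegree q \<le> card B" using subdegree_leI[OF k(2)] k(1) by simp
    qed
    have "mat q \<odot>\<^bsub>N\<^esub> v = (\<Oplus>\<^bsub>U\<^esub>k\<in>{..card B}. c k \<odot>\<^bsub>U\<^esub> (tT ^^ k) v)"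
      unfolding q_def by (rule polynomial_act[OF _ v]) simp
    also have "\<dots> = \<zero>\<^bsub>U\<^esub>"
    proof (rule vector_eqI[OF _ M.zero_closed])
      fix \<phi> assume \<phi>: "\<phi> \<in> dual_space U (carrier U)"
      have "\<phi> ((tT ^^ k) v) = (\<Sum>b\<in>B. g k b * \<phi> b)" for k
        unfolding g using \<phi> B by (subst functional_finsum) (auto simp: functional_smult subset_iff intro!: sum.cong)
      then have "\<phi> (\<Oplus>\<^bsub>U\<^esub>k\<in>{..card B}. c k \<odot>\<^bsub>U\<^esub> (tT ^^ k) v) = (\<Sum>k\<le>card B. c k * (\<Sum>b\<in>B. g k b * \<phi> b))"
        using \<phi> pc by (subst functional_finsum) (auto simp: functional_smult)
      also have "\<dots> = (\<Sum>b\<in>B. (\<Sum>k\<le>card B. c k * g k b) * \<phi> b)"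
        by (simp add: sum_distrib_left sum_distrib_right mult.assoc sum.swap[of _ B])
      also have "\<dots> = \<phi> \<zero>\<^bsub>U\<^esub>" using c(2) functional_zero[OF \<phi>] by simp
      finally show "\<phi> (\<Oplus>\<^bsub>U\<^esub>k\<in>{..card B}. c k \<odot>\<^bsub>U\<^esub> (tT ^^ k) v) = \<phi> \<zero>\<^bsub>U\<^esub>" .
    qed (rule M.finsum_closed, use pc in simp)
    finally have qv: "mat q \<odot>\<^bsub>N\<^esub> v = \<zero>\<^bsub>N\<^esub>" by simp
    \<comment> \<open>\<open>q\<close> is the unit \<open>?u\<close> times a power of the variable
      with exponent at most \<open>card B\<close>. Hence \<open>fps_X ^ card B\<close> is a multiple
      of \<open>q\<close>, which annihilates \<open>v\<close>.\<close>
    let ?u = "fps_shift (subdegree q) q"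
    have "?u * inverse ?u = 1" using q0 by (intro inverse_mult_eq_1') simp
    then have "q * inverse ?u = fps_X ^ subdegree q"
      by (metis (no_types, lifting) mult.assoc mult.commute mult.right_neutral subdegree_decompose)
    then have "fps_X ^ card B = (fps_X ^ (card B - subdegree q) * inverse ?u) * q"
      using sd by (metis (no_types, lifting) le_add_diff_inverse2 mult.assoc mult.commute power_add)
    then have "(tT ^^ card B) v = mat (fps_X ^ (card B - subdegree q) * inverse ?u) \<odot>\<^bsub>N\<^esub> (mat q \<odot>\<^bsub>N\<^esub> v)"
      using v by (simp add: tT_power act_mult mat_in_order_A mat_mult_mat)
    also have "\<dots> = \<zero>\<^bsub>N\<^esub>"
      unfolding qv using linear_map_zero[OF cvec_axioms cvec_axioms act_linear[OF mat_in_order_A]] by simp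
    finally show ?thesis .
  qed
  then show ?thesis by blast
qed

definition nilA :: nat where "nilA = (SOME m. \<forall>v\<in>carrier N. (tT ^^ m) v = \<zero>\<^bsub>N\<^esub>)"

lemma mat_elem_eps_in [simp]: "mat_elem r s (fps_X ^ eps r s * b) \<in> carrier order_A"
  "mat_elem r s (fps_X ^ eps r s) \<in> carrier order_A" "mat_elem r r b \<in> carrier order_A"
  by (auto intro!: mat_elem_in_order_A simp: eps_def[of r r])

lemma gelfand: "gelfand_module U tT nilA te tth"
proof (intro gelfand_module.intro nil_op.intro nil_op_axioms.intro gelfand_module_axioms.intro cvec_axioms)
  show "linear_map CC U U tT" "\<And>r. linear_map CC U U (te r)" "\<And>r s. linear_map CC U U (tth r s)"
    unfolding tT_def te_def tth_def by (intro act_linear; simp add: mat_in_order_A)+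
  show "(tT ^^ nilA) v = \<zero>\<^bsub>U\<^esub>" if "v \<in> carrier U" for v
    using someI_ex[OF tT_nilpotent] that by (simp add: nilA_def)
  fix v r s t assume v: "v \<in> carrier U"
  show "te r (te s v) = (if r = s then te r v else \<zero>\<^bsub>U\<^esub>)"
    using v by (simp add: te_def act_mult mat_elem_mult act_zero_left)
  show "te r (tth r s v) = tth r s v" "tth r s (te s v) = tth r s v"
    using v by (simp_all add: te_def tth_def act_mult mat_elem_mult)
  show "tth r r v = te r v" by (simp add: te_def tth_def eps_def)
  show "tth r s (tth s t v) = (tT ^^ delta r s t) (tth r t v)"
    using v by (simp add: tT_power act_closed tth_def act_mult mat_in_order_A mat_elem_mult mat_mult_mat_elem
        eps_triangle flip: power_add)
  show "tT (tth r s v) = tth r s (tT v)"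
    using v by (simp add: tT_def tth_def act_mult mat_in_order_A mat_mult_mat_elem mat_elem_mult_mat)
  have "(\<Sum>r\<in>UNIV. mat_elem r r 1) = (mat 1 :: fmat3)"
  proof -
    have "(\<Sum>r\<in>UNIV. mat_elem r r 1) $ i $ j = (mat 1 :: fmat3) $ i $ j" for i j
    proof -
      have "(\<Sum>r\<in>UNIV. mat_elem r r 1 :: fmat3) $ i $ j = (\<Sum>r\<in>UNIV. if r = i then if i = j then 1 else 0 else 0)"
        unfolding sum_component mat_elem_nth by (intro sum.cong refl) auto
      then show ?thesis by (simp add: mat_def)
    qed
    then show ?thesis by (simp only: vec_eq_iff) simp
  qed
  then show "v = (\<Oplus>\<^bsub>U\<^esub>r\<in>UNIV. te r v)"
    using v act_sum[of UNIV "\<lambda>r. mat_elem r r 1" v] by (simp add: te_def act_one)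
qed

end

sublocale left_A \<subseteq> G: gelfand_module "underlying_vspace N" tT nilA te tth
  by (rule gelfand)

context left_A
begin

text \<open>No continuity of the action in the variable is assumed. Splitting \<open>b\<close> at
  \<open>nilA\<close> into a polynomial and a multiple of \<open>fps_X ^ nilA\<close> shows that it
  still acts as the truncated series, because the second part acts as zero.\<close>

lemma mat_act: "v \<in> carrier N \<Longrightarrow> mat b \<odot>\<^bsub>N\<^esub> v = G.ps b v"
proof -
  assume v: "v \<in> carrier N"
  define A S where "A = fps_shift nilA b" and "S = (\<Sum>k<nilA. fps_const (fps_nth b k) * fps_X ^ k)"
  have "fps_cutoff nilA b = S"
    unfolding S_def
    by (rule fps_ext) (simp add: fps_sum_nth if_distrib[of "\<lambda>x. _ * x"] cong: if_cong)
  then have "b = A * fps_X ^ nilA + S"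
    using fps_shift_cutoff[of nilA b] by (simp add: A_def)
  then have "mat b = (mat A ** mat (fps_X ^ nilA) + mat S :: fmat3)"
    by (simp only: mat_add mat_mult_mat)
  then have "mat b \<odot>\<^bsub>N\<^esub> v = (mat A ** mat (fps_X ^ nilA)) \<odot>\<^bsub>N\<^esub> v \<oplus>\<^bsub>N\<^esub> mat S \<odot>\<^bsub>N\<^esub> v"
    using v by (simp only: act_add_left mat_mult_mat mat_in_order_A)
  also have "(mat A ** mat (fps_X ^ nilA)) \<odot>\<^bsub>N\<^esub> v = mat A \<odot>\<^bsub>N\<^esub> (tT ^^ nilA) v"
    using v by (simp only: tT_power act_mult mat_in_order_A)
  also have "mat S \<odot>\<^bsub>N\<^esub> v = (\<Oplus>\<^bsub>U\<^esub>k\<in>{..<nilA}. fps_nth b k \<odot>\<^bsub>U\<^esub> (tT ^^ k) v)"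
    unfolding S_def using v by (intro polynomial_act) simp_all
  also have "mat A \<odot>\<^bsub>N\<^esub> (tT ^^ nilA) v = \<zero>\<^bsub>N\<^esub>"
    using G.T_nil[of v] v linear_map_zero[OF cvec_axioms cvec_axioms act_linear[OF mat_in_order_A]] by simp
  finally have "mat b \<odot>\<^bsub>N\<^esub> v = \<zero>\<^bsub>U\<^esub> \<oplus>\<^bsub>U\<^esub> G.ps b v"
    by (simp add: fps_act_def)
  also have "\<dots> = G.ps b v"
    using v G.ps_closed[of v b] by (intro M.l_zero) simp
  finally show ?thesis .
qed

text \<open>Each entry of \<open>a\<close> contributes a scalar power series times a generator of
  the order, so the action is determined by \<open>te\<close>, \<open>tth\<close> and
  \<open>tT\<close>: every finite dimensional module is the one built from its quiver data.\<close>

lemma act_eq_order_act: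
  assumes a: "a \<in> carrier order_A" and v: "v \<in> carrier N"
  shows "a \<odot>\<^bsub>N\<^esub> v = G.order_act a v"
proof -
  have el: "mat_elem r s (a $ r $ s) = mat (fps_shift (eps r s) (a $ r $ s)) ** mat_elem r s (fps_X ^ eps r s)" for r s
    by (subst order_A_entry[OF a]) (simp add: mat_mult_mat_elem mult.commute)
  have el_in: "mat_elem r s (a $ r $ s) \<in> carrier order_A" for r s
    by (subst order_A_entry[OF a]) simp
  have el_act: "mat_elem r s (a $ r $ s) \<odot>\<^bsub>N\<^esub> v = G.ps (fps_shift (eps r s) (a $ r $ s)) (tth r s v)" for r s
    unfolding el using v by (simp add: tth_def mat_act act_closed flip: act_mult[OF mat_in_order_A])
  have in': "(\<Sum>s\<in>UNIV. mat_elem r s (a $ r $ s)) \<in> carrier order_A" for r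
    using act_sum[of UNIV "\<lambda>s. mat_elem r s (a $ r $ s)" v] v el_in by simp
  have "a \<odot>\<^bsub>N\<^esub> v = (\<Sum>r\<in>UNIV. \<Sum>s\<in>UNIV. mat_elem r s (a $ r $ s)) \<odot>\<^bsub>N\<^esub> v"
    by (simp add: fmat3_eq_sum[symmetric])
  also have "\<dots> = (\<Oplus>\<^bsub>U\<^esub>r\<in>UNIV. (\<Sum>s\<in>UNIV. mat_elem r s (a $ r $ s)) \<odot>\<^bsub>N\<^esub> v)"
    using act_sum[of UNIV "\<lambda>r. \<Sum>s\<in>UNIV. mat_elem r s (a $ r $ s)" v] in' v by simp
  also have "\<dots> = G.order_act a v"
    unfolding G.order_act_def
    using act_sum[of UNIV "\<lambda>s. mat_elem _ s (a $ _ $ s)" v] el_in v by (simp add: el_act)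
  finally show ?thesis .
qed

lemma linear_map_underlying:
  "linear_map order_A N N' f \<Longrightarrow> linear_map CC U (underlying_vspace N') f"
  by (auto simp: linear_map_def underlying_vspace_def mat_in_order_A)

end

text \<open>Both actions are built from the idempotents and the arrows, so only these have to be
  checked.\<close>

lemma A_linearI:
  assumes N: "left_A N" and N': "left_A N'"
    and f: "linear_map CC (underlying_vspace N) (underlying_vspace N') f"
    and e: "\<And>r v. v \<in> carrier N \<Longrightarrow> f (mat_elem r r 1 \<odot>\<^bsub>N\<^esub> v) = mat_elem r r 1 \<odot>\<^bsub>N'\<^esub> f v"
    and th: "\<And>v. v \<in> carrier N \<Longrightarrow> f (mat_elem 1 2 fps_X \<odot>\<^bsub>N\<^esub> v) = mat_elem 1 2 fps_X \<odot>\<^bsub>N'\<^esub> f v"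
      "\<And>v. v \<in> carrier N \<Longrightarrow> f (mat_elem 2 1 1 \<odot>\<^bsub>N\<^esub> v) = mat_elem 2 1 1 \<odot>\<^bsub>N'\<^esub> f v"
      "\<And>v. v \<in> carrier N \<Longrightarrow> f (mat_elem 1 3 fps_X \<odot>\<^bsub>N\<^esub> v) = mat_elem 1 3 fps_X \<odot>\<^bsub>N'\<^esub> f v"
      "\<And>v. v \<in> carrier N \<Longrightarrow> f (mat_elem 3 1 1 \<odot>\<^bsub>N\<^esub> v) = mat_elem 3 1 1 \<odot>\<^bsub>N'\<^esub> f v"
  shows "linear_map order_A N N' f"
proof -
  interpret N: left_A N by fact
  interpret N': left_A N' by fact
  have c: "f v \<in> carrier N'" if "v \<in> carrier N" for v
    using linear_mapD(1)[OF f, of v] that by simp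
  have "f (N.G.order_act a v) = N'.G.order_act a (f v)" if "v \<in> carrier N" for a v
    by (rule order_act_commute[OF N.gelfand N'.gelfand f])
      (use that e th in \<open>simp_all add: N.te_def N'.te_def N.tth_def N'.tth_def eps_def\<close>)
  then have "f (a \<odot>\<^bsub>N\<^esub> v) = a \<odot>\<^bsub>N'\<^esub> f v" if "v \<in> carrier N" "a \<in> carrier order_A" for a v
    using that c by (simp add: N.act_eq_order_act N'.act_eq_order_act)
  then show ?thesis
    using linear_mapD(2)[OF f] c by (auto simp: linear_map_def)
qed

lemma fd_subspace_cong:
  assumes "cvec M" "cvec M'" "carrier M = carrier M'" "add M = add M'"
    "\<And>c v. v \<in> carrier M \<Longrightarrow> c \<odot>\<^bsub>M\<^esub> v = c \<odot>\<^bsub>M'\<^esub> v" "fd_subspace M W"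
  shows "fd_subspace M' W"
  using fd_subspace_image[of M M' "\<lambda>v. v" W] assms by (simp add: linear_map_def)

definition order_module :: "(complex, 'u, 'a) module_scheme \<Rightarrow> ('u \<Rightarrow> 'u) \<Rightarrow> nat \<Rightarrow> (3 \<Rightarrow> 3 \<Rightarrow> 'u \<Rightarrow> 'u) \<Rightarrow> (fmat3, 'u) module" where
  "order_module M T m th = \<lparr>carrier = carrier M, mult = undefined, one = undefined, zero = zero M,
     add = add M, smult = gelfand_module.order_act M T m th\<rparr>"

context gelfand_module
begin

abbreviation OM where "OM \<equiv> order_module M T m th"

lemma OM_simps [simp]:
  "carrier OM = V" "zero OM = \<zero>" "add OM = add M" "smult OM = order_act"
  by (simp_all add: order_module_def)

lemma left_module_OM: "left_module order_A OM"
proof -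
  have "abelian_group OM"
    by (rule abelian_group_cong[OF M.abelian_group_axioms]) simp_all
  then show ?thesis
    unfolding left_module_def
    using order_act_mat[of _ 1] linear_mapD(2)[OF order_act_linear]
    by (auto simp: ring_order_A order_act_add order_act_mult)
qed

lemma underlying_OM: "v \<in> V \<Longrightarrow> c \<odot>\<^bsub>underlying_vspace OM\<^esub> v = c \<odot> v"
  by (simp add: underlying_vspace_def order_act_mat)

lemma cvec_underlying_OM: "cvec (underlying_vspace OM)"
proof (rule cvec.intro, rule moduleI[OF cring_CC])
  show "abelian_group (underlying_vspace OM)"
    by (rule abelian_group_cong[OF M.abelian_group_axioms]) (simp_all add: underlying_vspace_def)
qed (simp_all add: underlying_vspace_def order_act_mat smult_add_left smult_add_right smult_smult)

lemma OM_obj: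
  assumes "fd_subspace M V"
  shows "OM \<in> Obj Rep_A"
proof -
  have "fd_subspace (underlying_vspace OM) V"
    by (rule fd_subspace_cong[OF cvec_axioms cvec_underlying_OM _ _ _ assms])
      (simp_all add: underlying_OM, simp_all add: underlying_vspace_def)
  then show ?thesis using left_module_OM by (simp add: Rep_A_def)
qed

lemma OM_mat_elem:
  "v \<in> V \<Longrightarrow> mat_elem r r 1 \<odot>\<^bsub>OM\<^esub> v = e r v"
  "v \<in> V \<Longrightarrow> mat_elem r s (fps_X ^ eps r s) \<odot>\<^bsub>OM\<^esub> v = th r s v"
  by (simp_all add: order_act_mat_elem eps_def[of r r] th_diag)

lemma component_OM: "component OM r = e r ` V"
  by (auto simp: component_def OM_mat_elem simp del: OM_simps(4))

text \<open>An equality of records, possible because \<open>vspace_on\<close> cuts the operations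
  down to \<open>W\<close>, where the two scalar multiplications agree.\<close>

lemma vspace_on_OM: "W \<subseteq> V \<Longrightarrow> vspace_on (underlying_vspace OM) W = vspace_on M W"
  using underlying_OM
  by (auto simp: vspace_on_def underlying_vspace_def order_act_mat restrict_def fun_eq_iff subset_iff)

end

section \<open>Harish-Chandra modules with central character near that of \<open>l\<close>\<close>

text \<open>The weights are numbered by \<open>i\<close>, where \<open>i\<close> stands for the weight \<open>2 i - l - 1\<close>.\<close>

definition kap :: "nat \<Rightarrow> int \<Rightarrow> complex" where
  "kap l i = of_int ((i - 1) * (int l + 1 - i))"

lemma kap_eq_0_iff: "kap l i = 0 \<longleftrightarrow> i = 1 \<or> i = int l + 1"
  by (auto simp: kap_def simp del: of_int_mult of_int_diff of_int_add)

lemma kap_diff: "kap l i - kap l (i + 1) = of_int (- int l - 1 + 2 * i)"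
  by (simp add: kap_def algebra_simps)

text \<open>Positions \<open>1\<close>, \<open>2\<close>, \<open>3\<close> stand for the vertices
  \<open>*\<close>, \<open>-\<close>, \<open>+\<close>, whose weights \<open>-l+1\<close>,
  \<open>-l-1\<close>, \<open>l+1\<close> carry the numbers \<open>1\<close>, \<open>0\<close>,
  \<open>l+1\<close>.\<close>

definition idx :: "nat \<Rightarrow> 3 \<Rightarrow> int" where
  "idx l r = (if r = 1 then 1 else if r = 2 then 0 else int l + 1)"

definition casT :: "nat \<Rightarrow> 'u gk_module \<Rightarrow> 'u \<Rightarrow> 'u" where
  "casT l M v = (1 / 4) \<odot>\<^bsub>M\<^esub> (casimir M v \<ominus>\<^bsub>M\<^esub> ((of_nat l)\<^sup>2 - 1) \<odot>\<^bsub>M\<^esub> v)"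

definition casN :: "nat \<Rightarrow> 'u gk_module \<Rightarrow> nat" where
  "casN l M = (SOME m. \<forall>v\<in>carrier M. (casT l M ^^ m) v = \<zero>\<^bsub>M\<^esub>)"

definition wsp :: "nat \<Rightarrow> 'u gk_module \<Rightarrow> int \<Rightarrow> 'u set" where
  "wsp l M i = weight_space M (- int l - 1 + 2 * i)"

locale hcl = gk M for M :: "'u gk_module" (structure) +
  fixes l :: nat
  assumes l_pos: "l > 0" and HC: "harish_chandra M" and HCl: "in_HC_l l M"
begin

abbreviation W where "W \<equiv> wsp l M"
abbreviation pr where "pr \<equiv> dproj M W"
abbreviation D where "D \<equiv> casT l M"

end

sublocale hcl \<subseteq> graded M "wsp l M" "dproj M (wsp l M)"
  by (rule graded_dproj) (use HCl in \<open>auto simp: in_HC_l_def cvec_axioms wsp_def[abs_def]\<close>)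

context hcl
begin

section \<open>Ladder operators and the Casimir operator\<close>

lemma W_iff: "v \<in> W i \<longleftrightarrow> v \<in> V \<and> hh v = of_int (- int l - 1 + 2 * i) \<odot> v"
  unfolding wsp_def by (rule weight_space_iff)

lemma kact_W: "v \<in> W i \<Longrightarrow> k \<in> SO2 \<Longrightarrow> kact M k v = chi k powi (- int l - 1 + 2 * i) \<odot> v"
  unfolding wsp_def by (rule kact_weight)

lemma X_W:
  assumes "v \<in> W i"
  shows "xx v \<in> W (i + 1)"
proof -
  have v: "v \<in> V" "hh v = of_int (- int l - 1 + 2 * i) \<odot> v" using assms by (auto simp: W_iff)
  have "hh (xx v) = of_int (- int l - 1 + 2 * (i + 1)) \<odot> xx v"
  proof (rule vector_eqI)
    fix \<phi> assume "\<phi> \<in> functionals"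
    then show "\<phi> (hh (xx v)) = \<phi> (of_int (- int l - 1 + 2 * (i + 1)) \<odot> xx v)"
      using v arg_cong[OF bracket_HX[OF v(1)], of \<phi>] gact_smult[of X_mat v]
      by (simp add: functional_simps algebra_simps)
  qed (use v in auto)
  then show ?thesis using v by (simp add: W_iff)
qed

lemma Y_W:
  assumes "v \<in> W i"
  shows "yy v \<in> W (i - 1)"
proof -
  have v: "v \<in> V" "hh v = of_int (- int l - 1 + 2 * i) \<odot> v" using assms by (auto simp: W_iff)
  have "hh (yy v) = of_int (- int l - 1 + 2 * (i - 1)) \<odot> yy v"
  proof (rule vector_eqI)
    fix \<phi> assume "\<phi> \<in> functionals"
    then show "\<phi> (hh (yy v)) = \<phi> (of_int (- int l - 1 + 2 * (i - 1)) \<odot> yy v)"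
      using v arg_cong[OF bracket_HY[OF v(1)], of \<phi>] gact_smult[of Y_mat v]
      by (simp add: functional_simps algebra_simps)
  qed (use v in auto)
  then show ?thesis using v by (simp add: W_iff)
qed

lemma casimir_linear: "linear_map CC M M (casimir M)"
  unfolding linear_map_def casimir_def
  by (auto intro!: vector_eqI simp: gact_add gact_smult functional_simps algebra_simps)

lemmas casimir_closed [simp, intro] = linear_mapD(1)[OF casimir_linear]

lemma D_linear: "linear_map CC M M D"
  unfolding linear_map_def casT_def
  using linear_mapD[OF casimir_linear]
  by (auto intro!: vector_eqI simp: functional_simps algebra_simps)

lemmas D_closed [simp, intro] = linear_mapD(1)[OF D_linear]
lemmas D_add = linear_mapD(2)[OF D_linear]
lemmas D_smult = linear_mapD(3)[OF D_linear]

text \<open>The definition of the Casimir operator, solved for \<open>XY\<close> on a vector of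
  known weight.\<close>

lemma XY_eq:
  assumes "v \<in> W i"
  shows "xx (yy v) = D v \<oplus> kap l i \<odot> v"
proof -
  have v: "v \<in> V" "hh v = of_int (- int l - 1 + 2 * i) \<odot> v" using assms by (auto simp: W_iff)
  show ?thesis
  proof (rule vector_eqI)
    fix \<phi> assume "\<phi> \<in> functionals"
    then show "\<phi> (xx (yy v)) = \<phi> (D v \<oplus> kap l i \<odot> v)"
      using v gact_smult[of H_mat v]
      by (simp add: casT_def casimir_def functional_simps kap_def power2_eq_square)
        (simp add: field_simps)
  qed (use v in auto)
qed

text \<open>\<open>YX = XY - H\<close>, and by \<open>kap_diff\<close> subtracting the weight turns
  \<open>kap l i\<close> into \<open>kap l (i + 1)\<close>.\<close>

lemma YX_eq:
  assumes "v \<in> W i"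
  shows "yy (xx v) = D v \<oplus> kap l (i + 1) \<odot> v"
proof -
  have v: "v \<in> V" "hh v = of_int (- int l - 1 + 2 * i) \<odot> v" using assms by (auto simp: W_iff)
  show ?thesis
  proof (rule vector_eqI)
    fix \<phi> assume \<phi>: "\<phi> \<in> functionals"
    have "\<phi> (yy (xx v)) = \<phi> (xx (yy v)) - (kap l i - kap l (i + 1)) * \<phi> v"
      unfolding kap_diff
      using v \<phi> arg_cong[OF bracket_XY[OF v(1)], of \<phi>] by (simp add: functional_simps algebra_simps)
    then show "\<phi> (yy (xx v)) = \<phi> (D v \<oplus> kap l (i + 1) \<odot> v)"
      using v \<phi> by (simp add: XY_eq[OF assms] functional_simps algebra_simps)
  qed (use v in auto)
qed

lemma D_W:
  assumes "v \<in> W i"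
  shows "D v \<in> W i"
proof -
  have v: "v \<in> V" using assms W_mem by blast
  have "D v = xx (yy v) \<oplus> (- kap l i) \<odot> v"
    using v by (intro vector_eqI) (auto simp: XY_eq[OF assms] functional_simps)
  moreover have "xx (yy v) \<in> W i" using X_W[OF Y_W[OF assms]] by simp
  ultimately show ?thesis
    using assms by (auto intro!: submodule_add[OF W_submodule] submodule_smult[OF W_submodule])
qed

text \<open>Centrality of the Casimir element without a computation in the enveloping algebra: on
  \<open>W i\<close> the two readings of \<open>XYX\<close> involve the same scalar
  \<open>kap l (i + 1)\<close>, which cancels.\<close>

lemma D_X: "v \<in> V \<Longrightarrow> D (xx v) = xx (D v)"
proof (induction v rule: graded_induct)
  case (homogeneous i v)
  have v: "v \<in> V" using homogeneous W_mem by blast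
  have "xx (D v \<oplus> kap l (i + 1) \<odot> v) = D (xx v) \<oplus> kap l (i + 1) \<odot> xx v"
    using XY_eq[OF X_W[OF homogeneous]] YX_eq[OF homogeneous] by simp
  then have "xx (D v) \<oplus> kap l (i + 1) \<odot> xx v = D (xx v) \<oplus> kap l (i + 1) \<odot> xx v"
    using v by (simp add: gact_add gact_smult)
  then show ?case using v by simp
qed (simp add: D_add gact_add)

lemma D_Y: "v \<in> V \<Longrightarrow> D (yy v) = yy (D v)"
proof (induction v rule: graded_induct)
  case (homogeneous i v)
  have v: "v \<in> V" using homogeneous W_mem by blast
  have "yy (D v \<oplus> kap l i \<odot> v) = D (yy v) \<oplus> kap l i \<odot> yy v"
    using YX_eq[OF Y_W[OF homogeneous]] XY_eq[OF homogeneous] by simp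
  then have "yy (D v) \<oplus> kap l i \<odot> yy v = D (yy v) \<oplus> kap l i \<odot> yy v"
    using v by (simp add: gact_add gact_smult)
  then show ?case using v by simp
qed (simp add: D_add gact_add)

lemma D_pr: "v \<in> V \<Longrightarrow> pr i (D v) = D (pr i v)"
proof (induction v rule: graded_induct)
  case (homogeneous j v)
  then show ?case
    using D_W[OF homogeneous] linear_map_zero[OF cvec_axioms cvec_axioms D_linear]
    by (cases "i = j") (auto simp: p_same p_other)
qed (simp add: D_add p_add)

lemma D_nilpotent: "\<exists>m. \<forall>v\<in>V. (D ^^ m) v = \<zero>"
proof -
  let ?C = "\<lambda>w. casimir M w \<ominus> ((of_nat l)\<^sup>2 - 1) \<odot> w"
  obtain m where m: "\<And>v. v \<in> V \<Longrightarrow> (?C ^^ m) v = \<zero>"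
    using HCl by (auto simp: in_HC_l_def)
  have lin: "linear_map CC M M ?C"
    unfolding linear_map_def using linear_mapD[OF casimir_linear]
    by (auto intro!: vector_eqI simp: functional_simps algebra_simps)
  have "(D ^^ k) v = (1 / 4) ^ k \<odot> (?C ^^ k) v \<and> (?C ^^ k) v \<in> V" if "v \<in> V" for k v
  proof (induction k)
    case (Suc k)
    then show ?case using linear_mapD(1,3)[OF lin]
      by (simp add: casT_def[of l M "_ \<odot> _"] smult_smult)
  qed (use that in auto)
  then show ?thesis using m by (metis smult_zero)
qed

lemma D_nil: "v \<in> V \<Longrightarrow> (D ^^ casN l M) v = \<zero>"
  using someI_ex[OF D_nilpotent] by (simp add: casN_def)

end

sublocale hcl \<subseteq> D: nil_op M "casT l M" "casN l M"
  using D_linear D_nil by (intro nil_op.intro nil_op_axioms.intro cvec_axioms) auto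

context hcl
begin

section \<open>Bijectivity of \<open>X\<close> and \<open>Y\<close> between neighbouring weight
  spaces\<close>

lemma ps_W: "v \<in> W i \<Longrightarrow> D.ps a v \<in> W i"
  by (rule D.ps_submodule[OF W_submodule D_W])

abbreviation shift where "shift i \<equiv> fps_X + fps_const (kap l i)"

lemma ps_shift: "v \<in> V \<Longrightarrow> D.ps (shift i) v = D v \<oplus> kap l i \<odot> v"
  by (simp add: D.ps_add)

lemma shift_inverse:
  assumes "kap l i \<noteq> 0"
  shows "shift i * inverse (shift i) = 1"
  using assms by (intro inverse_mult_eq_1') simp

text \<open>The inverse is \<open>Y\<close> followed by the inverse of
  \<open>T + kap l (i + 1)\<close>. The excluded \<open>i\<close> are exactly those for which this
  scalar is zero.\<close>

lemma X_bij:
  assumes "i \<noteq> 0" "i \<noteq> int l"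
  shows "bij_betw xx (W i) (W (i + 1))"
proof -
  have k: "kap l (i + 1) \<noteq> 0" using assms by (simp add: kap_eq_0_iff)
  let ?s = "shift (i + 1)"
  show ?thesis
  proof (rule bij_betw_byWitness[where f' = "\<lambda>v. D.ps (inverse ?s) (yy v)"])
    show "\<forall>v\<in>W i. D.ps (inverse ?s) (yy (xx v)) = v"
      using k by (auto simp: YX_eq ps_shift[symmetric] W_mem D.ps_mult[symmetric] shift_inverse
          mult.commute[of "inverse _"])
    show "\<forall>v\<in>W (i + 1). xx (D.ps (inverse ?s) (yy v)) = v"
    proof
      fix v assume v: "v \<in> W (i + 1)"
      then have "xx (D.ps (inverse ?s) (yy v)) = D.ps (inverse ?s) (xx (yy v))"
        using W_mem by (intro ps_commute[OF D.nil_op_axioms D.nil_op_axioms gact_linear]) (auto simp: D_X)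
      also have "\<dots> = v"
        using k v by (simp add: XY_eq[OF v] ps_shift[symmetric] W_mem D.ps_mult[symmetric] shift_inverse
          mult.commute[of "inverse _"])
      finally show "xx (D.ps (inverse ?s) (yy v)) = v" .
    qed
    show "xx ` W i \<subseteq> W (i + 1)" using X_W by auto
    show "(\<lambda>v. D.ps (inverse ?s) (yy v)) ` W (i + 1) \<subseteq> W i"
      using ps_W Y_W by fastforce
  qed
qed

lemma Y_bij:
  assumes "i \<noteq> 1" "i \<noteq> int l + 1"
  shows "bij_betw yy (W i) (W (i - 1))"
proof -
  have k: "kap l i \<noteq> 0" using assms by (simp add: kap_eq_0_iff)
  let ?s = "shift i"
  show ?thesis
  proof (rule bij_betw_byWitness[where f' = "\<lambda>v. D.ps (inverse ?s) (xx v)"])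
    show "\<forall>v\<in>W i. D.ps (inverse ?s) (xx (yy v)) = v"
      using k by (auto simp: XY_eq ps_shift[symmetric] W_mem D.ps_mult[symmetric] shift_inverse
          mult.commute[of "inverse _"])
    show "\<forall>v\<in>W (i - 1). yy (D.ps (inverse ?s) (xx v)) = v"
    proof
      fix v assume v: "v \<in> W (i - 1)"
      then have "yy (D.ps (inverse ?s) (xx v)) = D.ps (inverse ?s) (yy (xx v))"
        using W_mem by (intro ps_commute[OF D.nil_op_axioms D.nil_op_axioms gact_linear]) (auto simp: D_Y)
      also have "\<dots> = v"
        using k YX_eq[OF v] W_mem[OF v]
        by (simp add: ps_shift[symmetric] D.ps_mult[symmetric] shift_inverse mult.commute[of "inverse _"])
      finally show "yy (D.ps (inverse ?s) (xx v)) = v" .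
    qed
    show "yy ` W i \<subseteq> W (i - 1)" using Y_W by auto
    show "(\<lambda>v. D.ps (inverse ?s) (xx v)) ` W (i - 1) \<subseteq> W i"
      using ps_W X_W by fastforce
  qed
qed

lemma X_pow_bij:
  assumes "\<And>j. i \<le> j \<Longrightarrow> j < i + int n \<Longrightarrow> j \<noteq> 0 \<and> j \<noteq> int l"
  shows "bij_betw (xx ^^ n) (W i) (W (i + int n))"
  using assms
proof (induction n)
  case (Suc n)
  then have "bij_betw (xx ^^ n) (W i) (W (i + int n))" by auto
  have eq: "i + int n + 1 = i + int (Suc n)" by simp
  have "i + int n \<noteq> 0" "i + int n \<noteq> int l" using Suc.prems[of "i + int n"] by auto
  from bij_betw_trans[OF \<open>bij_betw (xx ^^ n) _ _\<close> X_bij[OF this]] show ?case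
    unfolding eq by (simp only: funpow.simps)
qed (auto simp: bij_betw_def inj_on_def)

lemma Y_pow_bij:
  assumes "i \<le> 0"
  shows "bij_betw (yy ^^ n) (W i) (W (i - int n))"
proof (induction n)
  case (Suc n)
  have eq: "i - int n - 1 = i - int (Suc n)" by simp
  have "i - int n \<noteq> 1" "i - int n \<noteq> int l + 1" using assms by auto
  from bij_betw_trans[OF Suc.IH Y_bij[OF this]] show ?case
    unfolding eq by (simp only: funpow.simps)
qed (auto simp: bij_betw_def inj_on_def)

abbreviation Xs where "Xs \<equiv> X_star l M"

text \<open>The \<open>l - 1\<close> steps start at the numbers from \<open>1\<close> to
  \<open>l - 1\<close>, so they avoid the exceptional steps at \<open>0\<close> and
  \<open>l\<close>; for \<open>l = 1\<close> there is no step at all.\<close>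

lemma Xs_bij: "bij_betw Xs (W 1) (W (int l))"
proof -
  have "1 + int (l - 1) = int l" using l_pos by simp
  then show ?thesis unfolding X_star_def using X_pow_bij[of 1 "l - 1"] by fastforce
qed

lemma Xs_linear: "linear_map CC M M Xs"
  unfolding X_star_def by (rule linear_map_funpow[OF gact_linear]) simp

lemmas Xs_closed [simp, intro] = linear_mapD(1)[OF Xs_linear]

lemma D_X_pow: "v \<in> V \<Longrightarrow> D ((xx ^^ n) v) = (xx ^^ n) (D v)"
  using linear_mapD(1)[OF linear_map_funpow[OF gact_linear[of X_mat]]]
  by (induction n) (auto simp: D_X)

lemma D_Y_pow: "v \<in> V \<Longrightarrow> D ((yy ^^ n) v) = (yy ^^ n) (D v)"
  using linear_mapD(1)[OF linear_map_funpow[OF gact_linear[of Y_mat]]]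
  by (induction n) (auto simp: D_Y)

lemma Xs_W: "v \<in> W 1 \<Longrightarrow> Xs v \<in> W (int l)"
  using Xs_bij by (auto simp: bij_betw_def)

definition Xi where "Xi = inv_into (W 1) Xs"

lemma Xi: "v \<in> W (int l) \<Longrightarrow> Xi v \<in> W 1" "v \<in> W (int l) \<Longrightarrow> Xs (Xi v) = v" "u \<in> W 1 \<Longrightarrow> Xi (Xs u) = u"
  using Xs_bij by (auto simp: Xi_def bij_betw_def inv_into_into f_inv_into_f)

lemma Xi_eqI: "u \<in> W 1 \<Longrightarrow> Xs u = v \<Longrightarrow> Xi v = u"
  using Xi(3) by blast

lemma Xs_D: "v \<in> V \<Longrightarrow> Xs (D v) = D (Xs v)"
  by (simp add: X_star_def D_X_pow)

lemma Xi_add: "v \<in> W (int l) \<Longrightarrow> w \<in> W (int l) \<Longrightarrow> Xi (v \<oplus> w) = Xi v \<oplus> Xi w"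
  by (rule Xi_eqI)
    (simp_all add: submodule_add[OF W_submodule] linear_mapD[OF Xs_linear] Xi W_mem[OF Xi(1)])

lemma Xi_smult: "v \<in> W (int l) \<Longrightarrow> Xi (c \<odot> v) = c \<odot> Xi v"
  by (rule Xi_eqI)
    (simp_all add: submodule_smult[OF W_submodule] linear_mapD[OF Xs_linear] Xi W_mem[OF Xi(1)])

lemma Xi_D: "v \<in> W (int l) \<Longrightarrow> Xi (D v) = D (Xi v)"
  by (rule Xi_eqI) (simp_all add: D_W Xs_D Xi W_mem[OF Xi(1)])

subsection \<open>The quiver representation of a Harish-Chandra module\<close>

text \<open>\<open>al s\<close> is the arrow from the vertex \<open>s\<close> to \<open>*\<close>,
  and \<open>be r\<close> the arrow from \<open>*\<close> to \<open>r\<close>, both the identity at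
  \<open>*\<close> itself. Every \<open>hth r s\<close> with \<open>r \<noteq> s\<close> factors
  through \<open>*\<close>. The diagonal is treated apart, because \<open>be r\<close> after
  \<open>al r\<close> is the operator \<open>T\<close> and not the identity when \<open>r\<close> is
  an outer vertex.\<close>

definition al :: "3 \<Rightarrow> 'u \<Rightarrow> 'u" where
  "al s v = (if s = 1 then v else if s = 2 then xx v else Xi (yy v))"
definition be :: "3 \<Rightarrow> 'u \<Rightarrow> 'u" where
  "be r v = (if r = 1 then v else if r = 2 then yy v else xx (Xs v))"
definition hth :: "3 \<Rightarrow> 3 \<Rightarrow> 'u \<Rightarrow> 'u" where
  "hth r s v = (if r = s then pr (idx l r) v else be r (al s (pr (idx l s) v)))"
definition he :: "3 \<Rightarrow> 'u \<Rightarrow> 'u" where "he r v = pr (idx l r) v"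

lemma cases_3: "(r::3) = 1 \<or> r = 2 \<or> r = 3"
  using exhaust_3 by blast

lemma Y_W_l: "v \<in> W (int l + 1) \<Longrightarrow> yy v \<in> W (int l)"
  using Y_W[of v "int l + 1"] by simp

lemma al_W: "v \<in> W (idx l s) \<Longrightarrow> al s v \<in> W 1"
  using cases_3[of s] X_W[of v 0] Y_W_l[of v] by (auto simp: al_def idx_def intro!: Xi)

lemma be_W: "v \<in> W 1 \<Longrightarrow> be r v \<in> W (idx l r)"
  using cases_3[of r] Y_W[of v 1] X_W[OF Xs_W[of v]] by (auto simp: be_def idx_def add.commute)

lemma al_linear:
  "v \<in> W (idx l s) \<Longrightarrow> w \<in> W (idx l s) \<Longrightarrow> al s (v \<oplus> w) = al s v \<oplus> al s w"
  "v \<in> W (idx l s) \<Longrightarrow> al s (c \<odot> v) = c \<odot> al s v"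
  "v \<in> W (idx l s) \<Longrightarrow> al s (D v) = D (al s v)"
  using cases_3[of s] Y_W_l[of v] Y_W_l[of w]
  by (auto simp: al_def idx_def gact_add gact_smult W_mem Xi_add Xi_smult Xi_D D_X D_Y[symmetric])

lemma be_linear: "linear_map CC M M (be r)"
  using linear_mapD[OF Xs_linear] by (auto simp: be_def linear_map_def gact_add gact_smult)

lemma be_D: "v \<in> V \<Longrightarrow> be r (D v) = D (be r v)"
  using linear_mapD(1)[OF Xs_linear]
  by (auto simp: be_def D_X D_Y Xs_D)

text \<open>The scalars of the two steps in question vanish, so leaving \<open>*\<close> and coming
  back is \<open>T\<close> alone, on the minus side as on the plus side. This is the relation of the
  quiver.\<close>

lemma al_be:
  assumes v: "v \<in> W 1"
  shows "al s (be s v) = (if s = 1 then v else D v)"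
proof -
  have k: "kap l 1 = 0" "kap l (int l + 1) = 0" by (simp_all add: kap_eq_0_iff)
  have "xx (yy v) = D v" using XY_eq[OF v] k W_mem[OF v] by simp
  moreover have "yy (xx (Xs v)) = D (Xs v)"
    using YX_eq[OF Xs_W[OF v]] k W_mem[OF Xs_W[OF v]] by simp
  then have "Xi (yy (xx (Xs v))) = D v"
    using Xs_W[OF v] v by (simp add: Xi_D Xi)
  ultimately show ?thesis using cases_3[of s] by (auto simp: al_def be_def)
qed

lemma be_al:
  assumes v: "v \<in> W (idx l s)"
  shows "be s (al s v) = (if s = 1 then v else D v)"
proof -
  have k: "kap l 1 = 0" "kap l (int l + 1) = 0" by (simp_all add: kap_eq_0_iff)
  have "yy (xx v) = D v" if "v \<in> W 0" using YX_eq[OF that] k W_mem[OF that] by simp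
  moreover have "xx (Xs (Xi (yy v))) = D v" if "v \<in> W (int l + 1)"
    using XY_eq[OF that] k W_mem[OF that] Y_W_l[OF that] by (simp add: Xi)
  ultimately show ?thesis using cases_3[of s] v by (auto simp: al_def be_def idx_def)
qed

lemma idx_inj: "idx l r = idx l s \<longleftrightarrow> r = s"
  using cases_3[of r] cases_3[of s] l_pos by (auto simp: idx_def)

definition EU :: "'u set" where "EU = {v \<in> V. \<forall>i. i \<notin> range (idx l) \<longrightarrow> pr i v = \<zero>}"

lemma EU_V: "v \<in> EU \<Longrightarrow> v \<in> V"
  by (simp add: EU_def)

lemma EU_submodule: "submodule EU CC M"
  unfolding EU_def by (rule submoduleI') (auto simp: p_add p_smult)

lemma W_EU: "v \<in> W (idx l r) \<Longrightarrow> v \<in> EU"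
  using p_other W_mem by (fastforce simp: EU_def)

abbreviation ME where "ME \<equiv> M\<lparr>carrier := EU\<rparr>"

lemma ME_cvec: "cvec ME"
  by (rule cvec.intro) (rule submodule.submodule_is_module[OF EU_submodule cvec])

lemma hth_W: "v \<in> V \<Longrightarrow> hth r s v \<in> W (idx l r)"
  using p_mem by (auto simp: hth_def intro!: be_W al_W)

lemma hth_W_eq: "v \<in> W (idx l s) \<Longrightarrow> hth r s v = (if r = s then v else be r (al s v))"
  by (auto simp: hth_def p_same)

lemma hth_linear: "linear_map CC M M (hth r s)"
  using W_mem[OF hth_W] al_W[OF p_mem, THEN W_mem] p_mem[of _ "idx l s"]
  by (auto simp: linear_map_def hth_def p_add p_smult al_linear linear_mapD[OF be_linear])

lemma hth_hth:
  assumes v: "v \<in> V"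
  shows "hth r s (hth s t v) = (D ^^ delta r s t) (hth r t v)"
proof -
  let ?v = "pr (idx l t) v"
  have vt: "?v \<in> W (idx l t)" using p_mem[OF v] .
  have alv: "al t ?v \<in> W 1" using al_W[OF vt] .
  consider "r = s" | "r \<noteq> s" "s = t" | "r \<noteq> s" "s \<noteq> t" "s = 1" | "r \<noteq> s" "s \<noteq> t" "s \<noteq> 1" by blast
  then show ?thesis
  proof cases
    case 1
    then show ?thesis using hth_W[OF v, of r t] by (simp add: hth_W_eq delta_def eps_def)
  next
    case 2
    then show ?thesis using vt v by (simp add: hth_W_eq delta_def eps_def hth_def p_same p_p)
  next
    case 3
    \<comment> \<open>Through \<open>*\<close> the composite is \<open>be r\<close> after
      \<open>al t\<close>. It is \<open>hth r t\<close> itself unless \<open>r = t\<close>, where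
      the loop is \<open>D\<close> by \<open>be_al\<close>.\<close>
    then have "hth r s (hth s t v) = be r (al t ?v)"
      using hth_W_eq[OF hth_W[OF v], of r s t] by (simp add: hth_def be_def al_def)
    then show ?thesis using 3 be_al[OF vt] by (auto simp: hth_def delta_def eps_def)
  next
    case 4
    \<comment> \<open>Through an outer vertex \<open>s\<close> the path contains the loop at
      \<open>*\<close> that visits \<open>s\<close>; \<open>al_be\<close> turns it into one factor
      \<open>D\<close>. If \<open>r = t\<close> is an outer vertex, \<open>be_al\<close> supplies a
      second one.\<close>
    then have "hth r s (hth s t v) = D (be r (al t ?v))"
      using hth_W_eq[OF hth_W[OF v], of r s t] al_be[OF alv, of s] W_mem[OF alv]
      by (simp add: hth_def be_D)
    then show ?thesis using 4 be_al[OF vt] by (auto simp: hth_def delta_def eps_def)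
  qed
qed

lemma D_hth: "v \<in> V \<Longrightarrow> D (hth r s v) = hth r s (D v)"
  using p_mem[of v "idx l s"] W_mem[OF al_W[OF p_mem, of v s]]
  by (simp add: hth_def D_pr be_D al_linear)

lemma EU_range_sum:
  assumes v: "v \<in> EU"
  shows "v = (\<Oplus>r\<in>UNIV. he r v)"
proof -
  have "v = (\<Oplus>i\<in>range (idx l). pr i v)"
    using v by (intro decompose) (auto simp: EU_def)
  also have "\<dots> = (\<Oplus>r\<in>UNIV. pr (idx l r) v)"
    using EU_V[OF v] by (intro M.add.finprod_reindex) (auto simp: inj_on_def idx_inj)
  finally show ?thesis by (simp add: he_def)
qed

lemma ME_finsum: "f \<in> A \<rightarrow> EU \<Longrightarrow> finsum ME f A = finsum M f A"
proof -
  interpret E: cvec ME by (rule ME_cvec)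
  show "f \<in> A \<rightarrow> EU \<Longrightarrow> finsum ME f A = finsum M f A"
  proof (induction A rule: infinite_finite_induct)
    case (insert x F)
    then show ?case using EU_V by (auto simp: Pi_def)
  next
    case (infinite A)
    then show ?case by (simp add: finsum_def finprod_def)
  next
    case empty
    have "finsum ME f {} = \<zero>" using E.M.finsum_empty[of f] by simp
    then show ?case by simp
  qed
qed

lemma D_EU: "v \<in> EU \<Longrightarrow> D v \<in> EU"
  using linear_map_zero[OF cvec_axioms cvec_axioms D_linear] by (simp add: EU_def D_pr)

lemma ME_gelfand: "gelfand_module ME D (casN l M) he hth"
proof (intro gelfand_module.intro nil_op.intro nil_op_axioms.intro gelfand_module_axioms.intro ME_cvec)
  show "linear_map CC ME ME D"
    by (simp add: linear_map_def Pi_def D_EU D_add D_smult EU_V)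
  show "linear_map CC ME ME (he r)" for r
    by (simp add: linear_map_def Pi_def he_def p_add p_smult W_EU[OF p_mem[OF EU_V]] EU_V)
  show "linear_map CC ME ME (hth r s)" for r s
    by (simp add: linear_map_def Pi_def W_EU[OF hth_W[OF EU_V]] EU_V linear_mapD[OF hth_linear])
  fix v r s t assume v: "v \<in> carrier ME"
  then have vE: "v \<in> EU" and vV: "v \<in> V" using EU_V by auto
  show "(D ^^ casN l M) v = \<zero>\<^bsub>ME\<^esub>" using D_nil[OF vV] by simp
  show "he r (he s v) = (if r = s then he r v else \<zero>\<^bsub>ME\<^esub>)"
    using vV by (simp add: he_def p_p idx_inj)
  show "v = (\<Oplus>\<^bsub>ME\<^esub>r\<in>UNIV. he r v)"
    using EU_range_sum[OF vE] W_EU[OF p_mem[OF vV]] by (subst ME_finsum) (auto simp: he_def)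
  show "he r (hth r s v) = hth r s v" using hth_W[OF vV] by (simp add: he_def p_same)
  show "hth r s (he s v) = hth r s v" using vV by (simp add: hth_def he_def p_p)
  show "hth r r v = he r v" by (simp add: hth_def he_def)
  show "hth r s (hth s t v) = (D ^^ delta r s t) (hth r t v)" by (rule hth_hth[OF vV])
  show "D (hth r s v) = hth r s (D v)" by (rule D_hth[OF vV])
qed

end

section \<open>The functor\<close>

lemma (in gelfand_module) OM_arrows:
  assumes "v \<in> V"
  shows "mat_elem 1 2 fps_X \<odot>\<^bsub>OM\<^esub> v = th 1 2 v" "mat_elem 2 1 1 \<odot>\<^bsub>OM\<^esub> v = th 2 1 v"
    "mat_elem 1 3 fps_X \<odot>\<^bsub>OM\<^esub> v = th 1 3 v" "mat_elem 3 1 1 \<odot>\<^bsub>OM\<^esub> v = th 3 1 v"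
  using OM_mat_elem(2)[OF assms, of 1 2] OM_mat_elem(2)[OF assms, of 2 1]
    OM_mat_elem(2)[OF assms, of 1 3] OM_mat_elem(2)[OF assms, of 3 1]
  by (simp_all add: eps_def del: OM_simps)

definition E_obj :: "nat \<Rightarrow> 'u gk_module \<Rightarrow> (fmat3, 'u) module" where
  "E_obj l M = order_module (M\<lparr>carrier := hcl.EU M l\<rparr>) (casT l M) (casN l M) (hcl.hth M l)"

text \<open>The elements of \<open>\<AA>\<close> by which \<open>X\<close> and \<open>Y\<close> act on the components when all weight spaces
  in a chain are identified with one of the three distinguished ones.\<close>

definition cc :: "nat \<Rightarrow> int \<Rightarrow> 3" where
  "cc l i = (if i \<le> 0 then 2 else if i \<le> int l then 1 else 3)"

definition xi :: "nat \<Rightarrow> int \<Rightarrow> fmat3" where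
  "xi l i = (if i < 0 then mat_elem 2 2 (fps_X + fps_const (kap l (i + 1))) else if i = 0 then mat_elem 1 2 fps_X
     else if i < int l then mat_elem 1 1 1 else if i = int l then mat_elem 3 1 1 else mat_elem 3 3 1)"

definition et :: "nat \<Rightarrow> int \<Rightarrow> fmat3" where
  "et l i = (if i \<le> 0 then mat_elem 2 2 1 else if i = 1 then mat_elem 2 1 1
     else if i \<le> int l then mat_elem 1 1 (fps_X + fps_const (kap l i))
     else if i = int l + 1 then mat_elem 1 3 fps_X else mat_elem 3 3 (fps_X + fps_const (kap l i)))"

lemma xi_et_in [simp]: "xi l i \<in> carrier order_A" "et l i \<in> carrier order_A"
  by (auto simp: xi_def et_def eps_def intro!: mat_elem_in_order_A)

lemma cc_idx: "l > 0 \<Longrightarrow> cc l (idx l r) = r"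
  using exhaust_3[of r] by (auto simp: cc_def idx_def)

lemma xi_cc: "l > 0 \<Longrightarrow> mat_elem (cc l (i + 1)) (cc l (i + 1)) 1 ** xi l i = xi l i"
  "l > 0 \<Longrightarrow> xi l i ** mat_elem (cc l i) (cc l i) 1 = xi l i"
  by (auto simp: xi_def cc_def mat_elem_mult)

lemma et_cc: "l > 0 \<Longrightarrow> mat_elem (cc l (i - 1)) (cc l (i - 1)) 1 ** et l i = et l i"
  "l > 0 \<Longrightarrow> et l i ** mat_elem (cc l i) (cc l i) 1 = et l i"
  by (auto simp: et_def cc_def mat_elem_mult)

lemma kap_zero: "kap l 1 = 0" "kap l (int l + 1) = 0" "kap l (1 + int l) = 0"
  by (simp_all add: kap_def)

text \<open>The matrix form of the formulas for \<open>XY\<close> and \<open>YX\<close>. Inside a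
  chain one of the two factors is an idempotent and the other carries the series; between two chains
  the arrows multiply to \<open>fps_X\<close>, and there the scalar is zero by
  \<open>kap_zero\<close>.\<close>

lemma xi_et: "l > 0 \<Longrightarrow> xi l (i - 1) ** et l i = mat (fps_X + fps_const (kap l i)) ** mat_elem (cc l i) (cc l i) 1"
  "l > 0 \<Longrightarrow> et l (i + 1) ** xi l i = mat (fps_X + fps_const (kap l (i + 1))) ** mat_elem (cc l i) (cc l i) 1"
  by (auto simp: xi_def et_def cc_def mat_elem_mult mat_mult_mat_elem kap_zero)

context hcl
begin

abbreviation E where "E \<equiv> E_obj l M"

end

sublocale hcl \<subseteq> G: gelfand_module "M\<lparr>carrier := EU\<rparr>" "casT l M" "casN l M" he hth
  by (rule ME_gelfand)

context hcl
begin

lemma E_eq: "E = G.OM"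
  by (simp add: E_obj_def)

lemma E_simps [simp]: "carrier E = EU" "add E = add M" "zero E = \<zero>"
  by (simp_all add: E_obj_def order_module_def)

lemma ME_fd: "fd_subspace ME EU"
proof -
  have "fd_subspace M EU"
    unfolding EU_def
    using HC by (intro fd_subspace_finite_support) (auto simp: harish_chandra_def wsp_def)
  then obtain B where B: "B \<subseteq> EU" "finite B" "\<And>v. v \<in> EU \<Longrightarrow> \<exists>c. v = (\<Oplus>b\<in>B. c b \<odot> b)"
    by (auto simp: fd_subspace_def)
  have "finsum ME (\<lambda>b. c b \<odot> b) B = finsum M (\<lambda>b. c b \<odot> b) B" for c
    using B(1) submodule_smult[OF EU_submodule] by (intro ME_finsum) auto
  then show ?thesis
    unfolding fd_subspace_def using B G.carrier_is_submodule by auto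
qed

lemma left_A_E: "left_A E"
  unfolding E_eq using G.OM_obj ME_fd by (intro left_A.intro) simp

lemma E_mat_elem: "v \<in> EU \<Longrightarrow> mat_elem r r 1 \<odot>\<^bsub>E\<^esub> v = pr (idx l r) v"
  using G.OM_mat_elem(1)[of v r] by (simp add: E_eq he_def del: G.OM_simps)

lemma E_arrows:
  assumes "v \<in> EU"
  shows "mat_elem 1 2 fps_X \<odot>\<^bsub>E\<^esub> v = hth 1 2 v" "mat_elem 2 1 1 \<odot>\<^bsub>E\<^esub> v = hth 2 1 v"
    "mat_elem 1 3 fps_X \<odot>\<^bsub>E\<^esub> v = hth 1 3 v" "mat_elem 3 1 1 \<odot>\<^bsub>E\<^esub> v = hth 3 1 v"
  using G.OM_arrows[of v] assms by (simp_all add: E_eq del: G.OM_simps)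

lemma E_shift:
  assumes "v \<in> W (idx l r)"
  shows "mat_elem r r (fps_X + fps_const c) \<odot>\<^bsub>E\<^esub> v = D v \<oplus> c \<odot> v"
proof -
  have v: "v \<in> EU" using W_EU[OF assms] .
  have "mat_elem r r (fps_X + fps_const c) \<odot>\<^bsub>E\<^esub> v = G.ps (fps_X + fps_const c) (hth r r v)"
    using v by (simp add: E_eq G.order_act_mat_elem eps_def)
  also have "hth r r v = v" using assms by (simp add: hth_def p_same)
  also have "G.ps (fps_X + fps_const c) v = D v \<oplus> c \<odot> v"
    using v G.ps_add[of v fps_X "fps_const c"] by simp
  finally show ?thesis .
qed

lemma component_E: "component E r = W (idx l r)"
proof -
  have "component E r = he r ` EU" using G.component_OM[of r] by (simp add: E_eq)
  also have "\<dots> = W (idx l r)"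
  proof
    show "he r ` EU \<subseteq> W (idx l r)" using p_mem EU_V by (auto simp: he_def)
    show "W (idx l r) \<subseteq> he r ` EU" using W_EU p_same by (force simp: he_def image_iff)
  qed
  finally show ?thesis .
qed

lemma vspace_on_E: "vspace_on (underlying_vspace E) (W (idx l r)) = vspace_on M (W (idx l r))"
proof -
  have "W (idx l r) \<subseteq> carrier ME" using W_EU by auto
  from G.vspace_on_OM[OF this] show ?thesis
    by (simp add: E_eq) (simp add: vspace_on_def)
qed

lemma idx_simps: "idx l 1 = 1" "idx l 2 = 0" "idx l 3 = int l + 1"
  by (simp_all add: idx_def)

lemma wsp_simps: "W 1 = weight_space M (- int l + 1)" "W 0 = weight_space M (- int l - 1)"
  "W (int l + 1) = weight_space M (int l + 1)" "W (int l) = weight_space M (int l - 1)"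
  by (simp_all add: wsp_def algebra_simps)

text \<open>The components of \<open>E\<close> are the weight spaces themselves, and on them
  \<open>hth\<close> reduces to the prescribed \<open>X\<close>, \<open>Y\<close>,
  \<open>X_star\<close> and its inverse; hence an equality and not just an isomorphism.\<close>

lemma quiver_rep_of_E: "quiver_rep_of E = gelfand_rep_of l M"
proof -
  have c: "component E 2 = W 0" "component E 1 = W 1" "component E 3 = W (int l + 1)"
    using component_E[of 2] component_E[of 1] component_E[of 3] by (simp_all add: idx_simps)
  have v: "vspace_on (underlying_vspace E) (W 0) = vspace_on M (W 0)"
    "vspace_on (underlying_vspace E) (W 1) = vspace_on M (W 1)"
    "vspace_on (underlying_vspace E) (W (int l + 1)) = vspace_on M (W (int l + 1))"
    using vspace_on_E[of 2] vspace_on_E[of 1] vspace_on_E[of 3] by (simp_all add: idx_simps)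
  have a: "(\<lambda>v\<in>W 0. mat_elem 1 2 fps_X \<odot>\<^bsub>E\<^esub> v) = (\<lambda>v\<in>W 0. xx v)"
    "(\<lambda>v\<in>W 1. mat_elem 2 1 1 \<odot>\<^bsub>E\<^esub> v) = (\<lambda>v\<in>W 1. yy v)"
    "(\<lambda>v\<in>W (int l + 1). mat_elem 1 3 fps_X \<odot>\<^bsub>E\<^esub> v) = (\<lambda>v\<in>W (int l + 1). inv_into (W 1) Xs (yy v))"
    "(\<lambda>v\<in>W 1. mat_elem 3 1 1 \<odot>\<^bsub>E\<^esub> v) = (\<lambda>v\<in>W 1. xx (Xs v))"
    using W_EU[of _ 1] W_EU[of _ 2] W_EU[of _ 3] hth_W_eq[of _ 1 2] hth_W_eq[of _ 1 3] hth_W_eq[of _ 2 1] hth_W_eq[of _ 3 1]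
    by (auto intro!: restrict_ext simp: E_arrows idx_simps al_def be_def Xi_def)
  show ?thesis
    unfolding quiver_rep_of_def gelfand_rep_of_def Let_def c a v wsp_simps[symmetric] ..
qed

subsection \<open>Chains of weight spaces\<close>

text \<open>Transport from the distinguished weight space of a chain to \<open>W i\<close>: by
  \<open>Y\<close> in the chain descending from \<open>0\<close>, by \<open>X\<close> in the chains
  ascending from \<open>1\<close> and from \<open>l + 1\<close>. This choice explains
  \<open>xi\<close> and \<open>et\<close>: in an ascending chain \<open>xi\<close> is an idempotent
  and \<open>et\<close> carries the series, in the descending one it is the other way round.\<close>

definition Pm :: "int \<Rightarrow> 'u \<Rightarrow> 'u" where
  "Pm i = (if i \<le> 0 then yy ^^ nat (- i) else if i \<le> int l then xx ^^ nat (i - 1) else xx ^^ nat (i - int l - 1))"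

abbreviation Wc where "Wc i \<equiv> W (idx l (cc l i))"

lemma Pm_linear: "linear_map CC M M (Pm i)"
  by (simp add: Pm_def linear_map_funpow gact_linear)

lemma Pm_bij: "bij_betw (Pm i) (Wc i) (W i)"
proof -
  consider "i \<le> 0" | "0 < i" "i \<le> int l" | "int l < i" by linarith
  then show ?thesis
  proof cases
    case 1
    then show ?thesis using Y_pow_bij[of 0 "nat (- i)"] by (simp add: Pm_def cc_def idx_def)
  next
    case 2
    then show ?thesis using X_pow_bij[of 1 "nat (i - 1)"] by (simp add: Pm_def cc_def idx_def)
  next
    case 3
    then show ?thesis using X_pow_bij[of "int l + 1" "nat (i - int l - 1)"] by (simp add: Pm_def cc_def idx_def)
  qed
qed

lemma Pm_W: "u \<in> Wc i \<Longrightarrow> Pm i u \<in> W i"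
  using Pm_bij by (auto simp: bij_betw_def)

lemma Pm_D: "u \<in> V \<Longrightarrow> D (Pm i u) = Pm i (D u)"
  by (simp add: Pm_def D_X_pow D_Y_pow)

lemma Pm_shift: "u \<in> V \<Longrightarrow> Pm i (D u \<oplus> c \<odot> u) = D (Pm i u) \<oplus> c \<odot> Pm i u"
  by (simp add: linear_mapD[OF Pm_linear] Pm_D)

text \<open>In an ascending chain \<open>X\<close> is one more step of the transport. In the
  descending chain it undoes the last step and leaves \<open>T + kap\<close>. At \<open>0\<close>
  and at \<open>l\<close> it is the arrow that enters or leaves \<open>*\<close>.\<close>

lemma Pm_X:
  assumes u: "u \<in> Wc i"
  shows "Pm (i + 1) (xi l i \<odot>\<^bsub>E\<^esub> u) = xx (Pm i u)"
proof -
  have uV: "u \<in> V" "u \<in> EU" using u W_mem W_EU by blast+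
  consider "i < 0" | "i = 0" | "0 < i" "i < int l" | "i = int l" | "int l < i" by linarith
  then show ?thesis
  proof cases
    case 1
    then have c: "cc l i = 2" "cc l (i + 1) = 2" by (simp_all add: cc_def)
    have "Suc (nat (- i - 1)) = nat (- i)" using 1 by linarith
    moreover have "nat (- (i + 1)) = nat (- i - 1)" by (simp add: algebra_simps)
    ultimately have "Pm i u = yy (Pm (i + 1) u)"
      using 1 by (simp add: Pm_def funpow_Suc_right[symmetric] flip: funpow.simps(2))
        (metis comp_apply funpow.simps(2))
    then have "xx (Pm i u) = D (Pm (i + 1) u) \<oplus> kap l (i + 1) \<odot> Pm (i + 1) u"
      using XY_eq[OF Pm_W[of u "i + 1"]] u c by simp
    then show ?thesis
      using 1 E_shift[of u 2] u c uV by (simp add: xi_def Pm_shift)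
  next
    case 2
    then show ?thesis using u uV l_pos hth_W_eq[of u 2 1]
      by (simp add: xi_def Pm_def E_arrows cc_def be_def al_def)
  next
    case 3
    then have "Suc (nat (i - 1)) = nat i" by linarith
    then have "(xx ^^ nat i) u = xx ((xx ^^ nat (i - 1)) u)" by (metis comp_apply funpow.simps(2))
    then show ?thesis using 3 u uV E_mat_elem[of u 1]
      by (simp add: xi_def Pm_def cc_def p_same)
  next
    case 4
    then show ?thesis using u uV l_pos hth_W_eq[of u 1 3]
      by (simp add: xi_def Pm_def E_arrows cc_def be_def al_def X_star_def nat_diff_distrib)
  next
    case 5
    then have "Suc (nat (i - int l - 1)) = nat (i - int l)" by linarith
    then have "(xx ^^ nat (i - int l)) u = xx ((xx ^^ nat (i - int l - 1)) u)" by (metis comp_apply funpow.simps(2))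
    then show ?thesis using 5 u uV E_mat_elem[of u 3]
      by (simp add: xi_def Pm_def cc_def p_same)
  qed
qed

lemma Pm_Y:
  assumes u: "u \<in> Wc i"
  shows "Pm (i - 1) (et l i \<odot>\<^bsub>E\<^esub> u) = yy (Pm i u)"
proof -
  have uV: "u \<in> V" "u \<in> EU" using u W_mem W_EU by blast+
  consider "i \<le> 0" | "i = 1" | "1 < i" "i \<le> int l" | "i = int l + 1" | "int l + 1 < i" by linarith
  then show ?thesis
  proof cases
    case 1
    then have "Suc (nat (- i)) = nat (1 - i)" by linarith
    then have "(yy ^^ nat (1 - i)) u = yy ((yy ^^ nat (- i)) u)" by (metis comp_apply funpow.simps(2))
    then show ?thesis using 1 u uV E_mat_elem[of u 2]
      by (simp add: et_def Pm_def cc_def p_same)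
  next
    case 2
    then show ?thesis using u uV l_pos hth_W_eq[of u 1 2]
      by (simp add: et_def Pm_def E_arrows cc_def be_def al_def)
  next
    case 3
    then have c: "cc l i = 1" "cc l (i - 1) = 1" by (simp_all add: cc_def)
    have "Suc (nat (i - 2)) = nat (i - 1)" using 3 by linarith
    then have "(xx ^^ nat (i - 1)) u = xx ((xx ^^ nat (i - 2)) u)" by (metis comp_apply funpow.simps(2))
    then have "Pm i u = xx (Pm (i - 1) u)" using 3 by (simp add: Pm_def)
    then have "yy (Pm i u) = D (Pm (i - 1) u) \<oplus> kap l i \<odot> Pm (i - 1) u"
      using YX_eq[OF Pm_W[of u "i - 1"]] u c by simp
    then show ?thesis
      using 3 E_shift[of u 1] u c uV by (simp add: et_def Pm_shift)
  next
    case 4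
    then have u': "u \<in> W (int l + 1)" using u l_pos by (simp add: cc_def idx_def)
    \<comment> \<open>Here \<open>Y\<close> leads from \<open>l + 1\<close> to \<open>l\<close>,
      whereas the arrow into \<open>*\<close> goes on with the inverse of \<open>X_star\<close>. The
      transport \<open>Pm (int l)\<close> is \<open>X_star\<close> and undoes this.\<close>
    have "nat (int l - 1) = l - 1" using l_pos by linarith
    then have "(xx ^^ nat (int l - 1)) = Xs" by (simp add: X_star_def)
    then show ?thesis using 4 u u' uV l_pos hth_W_eq[of u 3 1] Xi(2)[OF Y_W_l[OF u']]
      by (simp add: et_def Pm_def E_arrows cc_def be_def al_def)
  next
    case 5
    then have c: "cc l i = 3" "cc l (i - 1) = 3" by (simp_all add: cc_def)
    have "Suc (nat (i - int l - 2)) = nat (i - int l - 1)" using 5 by linarith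
    then have "(xx ^^ nat (i - int l - 1)) u = xx ((xx ^^ nat (i - int l - 2)) u)" by (metis comp_apply funpow.simps(2))
    moreover have "i - 1 - int l - 1 = i - int l - 2" by simp
    ultimately have "Pm i u = xx (Pm (i - 1) u)" using 5 by (simp add: Pm_def)
    then have "yy (Pm i u) = D (Pm (i - 1) u) \<oplus> kap l i \<odot> Pm (i - 1) u"
      using YX_eq[OF Pm_W[of u "i - 1"]] u c by simp
    then show ?thesis
      using 5 E_shift[of u 3] u c uV by (simp add: et_def Pm_shift)
  qed
qed

lemma Pm_idx: "Pm (idx l r) u = u"
  using cases_3[of r] l_pos by (auto simp: Pm_def idx_def)

end

subsection \<open>Morphisms\<close>

lemma gk_homD:
  assumes "f \<in> gk_hom M M'"
  shows "linear_map CC M M' f" "Z \<in> sl2c \<Longrightarrow> v \<in> carrier M \<Longrightarrow> f (gact M Z v) = gact M' Z (f v)"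
    "k \<in> SO2 \<Longrightarrow> v \<in> carrier M \<Longrightarrow> f (kact M k v) = kact M' k (f v)" "f \<in> extensional (carrier M)"
  using assms by (auto simp: gk_hom_def)

locale hcl_hom = A: hcl M l + B: hcl M' l for M M' :: "'u gk_module" and l +
  fixes f :: "'u \<Rightarrow> 'u"
  assumes f: "f \<in> gk_hom M M'"
begin

lemmas f_linear = gk_homD(1)[OF f]
lemmas f_closed = linear_mapD(1)[OF f_linear]
lemmas f_gact = gk_homD(2)[OF f]
lemmas f_zero = linear_map_zero[OF A.cvec_axioms B.cvec_axioms f_linear]

lemma f_W: "v \<in> A.W i \<Longrightarrow> f v \<in> B.W i"
  by (auto simp: A.W_iff B.W_iff f_closed linear_mapD(3)[OF f_linear] simp flip: f_gact)

lemma f_pr: "v \<in> carrier M \<Longrightarrow> f (A.pr i v) = B.pr i (f v)"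
proof (induction v rule: A.graded_induct)
  case (homogeneous j v)
  then show ?case using f_W[OF homogeneous]
    by (cases "i = j") (auto simp: A.p_same A.p_other B.p_same B.p_other f_zero)
qed (simp add: A.p_add B.p_add linear_mapD[OF f_linear] f_closed)

lemma f_X_pow: "v \<in> carrier M \<Longrightarrow> f ((A.xx ^^ n) v) = (B.xx ^^ n) (f v)"
  and f_Y_pow: "v \<in> carrier M \<Longrightarrow> f ((A.yy ^^ n) v) = (B.yy ^^ n) (f v)"
  using linear_mapD(1)[OF A.linear_map_funpow[OF A.gact_linear]]
  by (induction n) (auto simp: f_gact)

lemma f_Pm: "v \<in> carrier M \<Longrightarrow> f (A.Pm i v) = B.Pm i (f v)"
  by (simp add: A.Pm_def B.Pm_def f_X_pow f_Y_pow)

lemma f_Xi: "v \<in> A.W (int l) \<Longrightarrow> f (A.Xi v) = B.Xi (f v)"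
  using A.Xi[of v] f_W by (intro B.Xi_eqI[symmetric]) (auto simp: X_star_def A.W_mem simp flip: f_X_pow)

lemma f_hth: "v \<in> carrier M \<Longrightarrow> f (A.hth r s v) = B.hth r s (f v)"
proof -
  assume v: "v \<in> carrier M"
  let ?v = "A.pr (idx l s) v"
  have "f (A.al s ?v) = B.al s (f ?v)"
    using A.cases_3[of s] A.Y_W_l[of ?v] A.p_mem[OF v, of "idx l s"] v
    by (auto simp: A.al_def B.al_def f_gact f_Xi A.idx_simps)
  moreover have "f (A.be r w) = B.be r (f w)" if "w \<in> carrier M" for w
    using that A.Xs_closed[OF that]
    by (auto simp: A.be_def B.be_def f_gact X_star_def f_X_pow)
  ultimately show ?thesis
    using v A.W_mem[OF A.al_W[OF A.p_mem[OF v]]]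
    by (auto simp: A.hth_def B.hth_def f_pr)
qed

lemma f_EU: "v \<in> A.EU \<Longrightarrow> f v \<in> B.EU"
  by (auto simp: A.EU_def B.EU_def f_closed f_zero simp flip: f_pr)

lemma restrict_A_hom: "restrict f A.EU \<in> A_hom A.E B.E"
proof -
  have "linear_map order_A A.E B.E (restrict f A.EU)"
  proof (rule A_linearI[OF A.left_A_E B.left_A_E])
    interpret UE: left_A A.E by (rule A.left_A_E)
    interpret UE': left_A B.E by (rule B.left_A_E)
    show "linear_map CC UE.U UE'.U (restrict f A.EU)"
      using A.submodule_add[OF A.EU_submodule] A.submodule_smult[OF A.EU_submodule]
      by (auto simp: linear_map_def f_EU linear_mapD[OF f_linear] A.EU_V
          A.G.underlying_OM[unfolded A.E_eq[symmetric], simplified]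
          B.G.underlying_OM[unfolded B.E_eq[symmetric], simplified])
    fix v assume v: "v \<in> carrier A.E"
    have cl: "A.hth r s v \<in> A.EU" for r s using v A.W_EU[OF A.hth_W] A.EU_V by simp
    show "restrict f A.EU (mat_elem r r 1 \<odot>\<^bsub>A.E\<^esub> v) = mat_elem r r 1 \<odot>\<^bsub>B.E\<^esub> restrict f A.EU v" for r
      using v A.W_EU[OF A.p_mem, of v r] by (simp add: A.E_mat_elem B.E_mat_elem f_EU f_pr A.EU_V)
    show "restrict f A.EU (mat_elem 1 2 fps_X \<odot>\<^bsub>A.E\<^esub> v) = mat_elem 1 2 fps_X \<odot>\<^bsub>B.E\<^esub> restrict f A.EU v"
      "restrict f A.EU (mat_elem 2 1 1 \<odot>\<^bsub>A.E\<^esub> v) = mat_elem 2 1 1 \<odot>\<^bsub>B.E\<^esub> restrict f A.EU v"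
      "restrict f A.EU (mat_elem 1 3 fps_X \<odot>\<^bsub>A.E\<^esub> v) = mat_elem 1 3 fps_X \<odot>\<^bsub>B.E\<^esub> restrict f A.EU v"
      "restrict f A.EU (mat_elem 3 1 1 \<odot>\<^bsub>A.E\<^esub> v) = mat_elem 3 1 1 \<odot>\<^bsub>B.E\<^esub> restrict f A.EU v"
      using v cl by (simp_all add: A.E_arrows B.E_arrows f_EU f_hth A.EU_V)
  qed
  then show ?thesis by (simp add: A_hom_def)
qed

end

text \<open>Morphisms commute with the transports \<open>Pm\<close>, and every homogeneous vector is
  the transport of a vector of \<open>EU\<close>; this is faithfulness.\<close>

lemma gk_hom_eqI:
  assumes "hcl M l" "hcl M' l" "f \<in> gk_hom M M'" "g \<in> gk_hom M M'"
    "restrict f (hcl.EU M l) = restrict g (hcl.EU M l)"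
  shows "f = g"
proof -
  interpret A: hcl M l by fact
  interpret B: hcl M' l by fact
  interpret f: hcl_hom M M' l f by unfold_locales fact
  interpret g: hcl_hom M M' l g by unfold_locales fact
  have eq: "f v = g v" if "v \<in> A.EU" for v
    using fun_cong[OF assms(5), of v] that by simp
  have "f v = g v" if "v \<in> carrier M" for v
    using that
  proof (induction v rule: A.graded_induct)
    case (homogeneous i v)
    then obtain u where "u \<in> A.Wc i" "v = A.Pm i u"
      using A.Pm_bij[of i] by (auto simp: bij_betw_def)
    then show ?case using eq[OF A.W_EU] A.W_mem by (simp add: f.f_Pm g.f_Pm)
  qed (simp add: linear_mapD[OF f.f_linear] linear_mapD[OF g.f_linear])
  then show ?thesis
    using gk_homD(4)[OF assms(3)] gk_homD(4)[OF assms(4)] by (intro extensionalityI) auto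
qed

text \<open>A morphism of \<open>\<AA>\<close>-modules is transported along the chains of weight spaces.\<close>

lemma exists_gk_hom:
  assumes "hcl M l" "hcl M' l" and h: "h \<in> A_hom (E_obj l M) (E_obj l M')"
  shows "\<exists>f\<in>gk_hom M M'. restrict f (hcl.EU M l) = h"
proof -
  interpret A: hcl M l by fact
  interpret B: hcl M' l by fact
  interpret UE: left_A A.E by (rule A.left_A_E)
  interpret UE': left_A B.E by (rule B.left_A_E)
  have lp: "l > 0" by (rule A.l_pos)
  have h_lin: "linear_map order_A A.E B.E h" and h_ext: "h \<in> extensional A.EU"
    using h by (auto simp: A_hom_def)
  have h_act: "h (a \<odot>\<^bsub>A.E\<^esub> v) = a \<odot>\<^bsub>B.E\<^esub> h v" if "a \<in> carrier order_A" "v \<in> A.EU" for a v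
    using h_lin that by (auto simp: linear_map_def)
  have h_mem: "h v \<in> B.EU" if "v \<in> A.EU" for v
    using h_lin that by (auto simp: linear_map_def)
  have hU: "linear_map CC UE.U UE'.U h" by (rule UE.linear_map_underlying[OF h_lin])
  have h_add: "h (v \<oplus>\<^bsub>M\<^esub> w) = h v \<oplus>\<^bsub>M'\<^esub> h w" if "v \<in> A.EU" "w \<in> A.EU" for v w
    using linear_mapD(2)[OF hU, of v w] that by simp
  have h_smult: "h (c \<odot>\<^bsub>M\<^esub> v) = c \<odot>\<^bsub>M'\<^esub> h v" if "v \<in> A.EU" for c v
    using linear_mapD(3)[OF hU, of v c] that h_mem[OF that]
    by (simp add: A.G.underlying_OM[unfolded A.E_eq[symmetric], simplified]
          B.G.underlying_OM[unfolded B.E_eq[symmetric], simplified])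
  have h_W: "h u \<in> B.W (idx l r)" if "u \<in> A.W (idx l r)" for u r
  proof -
    have u: "u \<in> A.EU" using A.W_EU[OF that] .
    have "h u = h (mat_elem r r 1 \<odot>\<^bsub>A.E\<^esub> u)" using that u by (simp add: A.E_mat_elem A.p_same)
    also have "\<dots> = B.pr (idx l r) (h u)"
      using u h_mem[OF u] by (simp add: h_act B.E_mat_elem)
    finally show ?thesis using B.p_mem[OF B.EU_V[OF h_mem[OF u]]] by metis
  qed
  define Q where "Q i = inv_into (A.Wc i) (A.Pm i)" for i
  have Q: "Q i v \<in> A.Wc i" "A.Pm i (Q i v) = v" if "v \<in> A.W i" for i v
    using A.Pm_bij[of i] that by (auto simp: Q_def bij_betw_def inv_into_into f_inv_into_f)
  have Q': "Q i (A.Pm i u) = u" if "u \<in> A.Wc i" for i u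
    using A.Pm_bij[of i] that by (auto simp: Q_def bij_betw_def)
  \<comment> \<open>\<open>h\<close> conjugated by the transports: the only possible value on
    \<open>W i\<close>, since a morphism commutes with them.\<close>
  define F where "F i v = B.Pm i (h (Q i v))" for i v
  have F_Pm: "F i (A.Pm i u) = B.Pm i (h u)" if "u \<in> A.Wc i" for i u
    using Q'[OF that] by (simp add: F_def)
  have F_W: "F i v \<in> B.W i" if "v \<in> A.W i" for i v
    unfolding F_def by (intro B.Pm_W h_W Q that)
  have F_add: "F i (v \<oplus>\<^bsub>M\<^esub> w) = F i v \<oplus>\<^bsub>M'\<^esub> F i w" if "v \<in> A.W i" "w \<in> A.W i" for i v w
  proof -
    note q = Q(1)[OF that(1)] Q(1)[OF that(2)]
    have "v \<oplus>\<^bsub>M\<^esub> w = A.Pm i (Q i v \<oplus>\<^bsub>M\<^esub> Q i w)"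
      using A.W_mem[OF q(1)] A.W_mem[OF q(2)] that by (simp add: linear_mapD[OF A.Pm_linear] Q)
    then have "F i (v \<oplus>\<^bsub>M\<^esub> w) = B.Pm i (h (Q i v \<oplus>\<^bsub>M\<^esub> Q i w))"
      using q A.submodule_add[OF A.W_submodule] by (simp add: F_Pm)
    then show ?thesis
      using q A.W_EU h_W[OF q(1)] h_W[OF q(2)] B.W_mem
      by (simp add: h_add linear_mapD[OF B.Pm_linear] F_def)
  qed
  have F_smult: "F i (c \<odot>\<^bsub>M\<^esub> v) = c \<odot>\<^bsub>M'\<^esub> F i v" if "v \<in> A.W i" for i c v
  proof -
    note q = Q(1)[OF that]
    have "c \<odot>\<^bsub>M\<^esub> v = A.Pm i (c \<odot>\<^bsub>M\<^esub> Q i v)"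
      using A.W_mem[OF q] that by (simp add: linear_mapD[OF A.Pm_linear] Q)
    then have "F i (c \<odot>\<^bsub>M\<^esub> v) = B.Pm i (h (c \<odot>\<^bsub>M\<^esub> Q i v))"
      using q A.submodule_smult[OF A.W_submodule] by (simp add: F_Pm)
    then show ?thesis
      using q A.W_EU h_W[OF q] B.W_mem by (simp add: h_smult linear_mapD[OF B.Pm_linear] F_def)
  qed
  have F_zero: "F i \<zero>\<^bsub>M\<^esub> = \<zero>\<^bsub>M'\<^esub>" for i
    using F_smult[of "\<zero>\<^bsub>M\<^esub>" i 0] F_W[of "\<zero>\<^bsub>M\<^esub>" i] B.W_mem by simp
  \<comment> \<open>The idempotents on the left in \<open>xi_cc\<close> and \<open>et_cc\<close>
    show in which component the result lies, so that \<open>F_Pm\<close> applies to it.\<close>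
  have xi_W: "xi l i \<odot>\<^bsub>A.E\<^esub> u \<in> A.Wc (i + 1)" "et l i \<odot>\<^bsub>A.E\<^esub> u \<in> A.Wc (i - 1)" if u: "u \<in> A.EU" for u i
  proof -
    have "mat_elem (cc l (i + 1)) (cc l (i + 1)) 1 \<odot>\<^bsub>A.E\<^esub> (xi l i \<odot>\<^bsub>A.E\<^esub> u) = xi l i \<odot>\<^bsub>A.E\<^esub> u"
      "mat_elem (cc l (i - 1)) (cc l (i - 1)) 1 \<odot>\<^bsub>A.E\<^esub> (et l i \<odot>\<^bsub>A.E\<^esub> u) = et l i \<odot>\<^bsub>A.E\<^esub> u"
      using u by (simp_all add: UE.act_mult xi_cc[OF lp] et_cc[OF lp])
    moreover have "xi l i \<odot>\<^bsub>A.E\<^esub> u \<in> A.EU" "et l i \<odot>\<^bsub>A.E\<^esub> u \<in> A.EU"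
      using u UE.act_closed[of "xi l i" u] UE.act_closed[of "et l i" u] by simp_all
    ultimately show "xi l i \<odot>\<^bsub>A.E\<^esub> u \<in> A.Wc (i + 1)" "et l i \<odot>\<^bsub>A.E\<^esub> u \<in> A.Wc (i - 1)"
      using A.p_mem[OF A.EU_V] by (metis A.E_mat_elem)+
  qed
  have F_X: "F (i + 1) (gact M X_mat v) = gact M' X_mat (F i v)" if v: "v \<in> A.W i" for i v
  proof -
    let ?u = "Q i v"
    have u: "?u \<in> A.Wc i" "v = A.Pm i ?u" "?u \<in> A.EU" using Q[OF v] A.W_EU by auto
    have "gact M X_mat v = A.Pm (i + 1) (xi l i \<odot>\<^bsub>A.E\<^esub> ?u)"
      using A.Pm_X[OF u(1)] u(2) by simp
    then have "F (i + 1) (gact M X_mat v) = B.Pm (i + 1) (h (xi l i \<odot>\<^bsub>A.E\<^esub> ?u))"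
      using F_Pm[OF xi_W(1)[OF u(3)]] by simp
    also have "\<dots> = gact M' X_mat (B.Pm i (h ?u))"
      using u by (simp add: h_act B.Pm_X[OF h_W])
    finally show ?thesis by (simp add: F_def)
  qed
  have F_Y: "F (i - 1) (gact M Y_mat v) = gact M' Y_mat (F i v)" if v: "v \<in> A.W i" for i v
  proof -
    let ?u = "Q i v"
    have u: "?u \<in> A.Wc i" "v = A.Pm i ?u" "?u \<in> A.EU" using Q[OF v] A.W_EU by auto
    have "gact M Y_mat v = A.Pm (i - 1) (et l i \<odot>\<^bsub>A.E\<^esub> ?u)"
      using A.Pm_Y[OF u(1)] u(2) by simp
    then have "F (i - 1) (gact M Y_mat v) = B.Pm (i - 1) (h (et l i \<odot>\<^bsub>A.E\<^esub> ?u))"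
      using F_Pm[OF xi_W(2)[OF u(3)]] by simp
    also have "\<dots> = gact M' Y_mat (B.Pm i (h ?u))"
      using u by (simp add: h_act B.Pm_Y[OF h_W])
    finally show ?thesis by (simp add: F_def)
  qed
  \<comment> \<open>The map is put together from its homogeneous parts. The support stays finite
    because \<open>F i\<close> maps zero to zero.\<close>
  have "\<exists>w\<in>carrier M'. \<forall>i. B.pr i w = F i (A.pr i v)" if v: "v \<in> carrier M" for v
  proof (rule B.exists_with_components)
    show "F i (A.pr i v) \<in> B.W i" for i by (intro F_W A.p_mem v)
    show "finite {i. F i (A.pr i v) \<noteq> \<zero>\<^bsub>M'\<^esub>}"
      by (rule finite_subset[OF _ A.p_finite[OF v]]) (auto simp: F_zero)
  qed
  then obtain f0 where f0: "\<And>v. v \<in> carrier M \<Longrightarrow> f0 v \<in> carrier M'"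
    "\<And>v i. v \<in> carrier M \<Longrightarrow> B.pr i (f0 v) = F i (A.pr i v)" by metis
  have f0_W: "f0 v = F i v" if v: "v \<in> A.W i" for i v
  proof (rule B.p_ext)
    fix j
    show "B.pr j (f0 v) = B.pr j (F i v)"
      using v F_W[OF v] A.W_mem[OF v]
      by (cases "j = i") (auto simp: f0 A.p_same A.p_other B.p_same B.p_other F_zero)
  qed (use v A.W_mem B.W_mem F_W f0 in blast)+
  have f0_add: "f0 (v \<oplus>\<^bsub>M\<^esub> w) = f0 v \<oplus>\<^bsub>M'\<^esub> f0 w" if "v \<in> carrier M" "w \<in> carrier M" for v w
    using that by - (rule B.p_ext, simp_all add: f0 B.p_add A.p_add F_add A.p_mem)
  have f0_smult: "f0 (c \<odot>\<^bsub>M\<^esub> v) = c \<odot>\<^bsub>M'\<^esub> f0 v" if "v \<in> carrier M" for c v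
    using that by - (rule B.p_ext, simp_all add: f0 B.p_smult A.p_smult F_smult A.p_mem)
  have f0_X: "f0 (gact M X_mat v) = gact M' X_mat (f0 v)" if "v \<in> carrier M" for v
    using that
  proof (induction v rule: A.graded_induct)
    case (homogeneous i v)
    then show ?case by (simp add: f0_W[OF A.X_W] F_X f0_W)
  qed (simp add: A.gact_add B.gact_add f0_add f0)
  have f0_Y: "f0 (gact M Y_mat v) = gact M' Y_mat (f0 v)" if "v \<in> carrier M" for v
    using that
  proof (induction v rule: A.graded_induct)
    case (homogeneous i v)
    then show ?case by (simp add: f0_W[OF A.Y_W] F_Y f0_W)
  qed (simp add: A.gact_add B.gact_add f0_add f0)
  have f0_H: "f0 (gact M H_mat v) = gact M' H_mat (f0 v)" if "v \<in> carrier M" for v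
    using that
  proof (induction v rule: A.graded_induct)
    case (homogeneous i v)
    then show ?case using F_W[OF homogeneous] by (simp add: A.W_iff B.W_iff f0_W f0_smult)
  qed (simp add: A.gact_add B.gact_add f0_add f0)
  have f0_gact: "f0 (gact M Z v) = gact M' Z (f0 v)" if "Z \<in> sl2c" "v \<in> carrier M" for Z v
    unfolding A.gact_coords[OF that] B.gact_coords[OF that(1) f0(1)[OF that(2)]]
    using that by (simp add: f0 f0_add f0_smult f0_X f0_Y f0_H)
  have f0_kact: "f0 (kact M k v) = kact M' k (f0 v)" if k: "k \<in> SO2" and "v \<in> carrier M" for k v
    using that(2)
  proof (induction v rule: A.graded_induct)
    case (homogeneous i v)
    then show ?case
      using A.W_mem[OF homogeneous]
      by (simp add: A.kact_W[OF homogeneous k] B.kact_W[OF F_W[OF homogeneous] k] f0_smult f0_W)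
  qed (use k in \<open>simp add: A.kact_add B.kact_add f0_add f0\<close>)
  let ?f = "restrict f0 (carrier M)"
  have "?f \<in> gk_hom M M'"
    by (auto simp: gk_hom_def linear_map_def f0 f0_add f0_smult f0_gact f0_kact)
  moreover have "restrict ?f A.EU = h"
  proof (rule extensionalityI[of _ A.EU])
    fix v assume v: "v \<in> A.EU"
    \<comment> \<open>At the three distinguished numbers the transports are the identity, so
      conjugation changes nothing.\<close>
    have r: "f0 u = h u" if "u \<in> A.W (idx l r)" for u r
      using f0_W[OF that] F_Pm[of u "idx l r"] that lp by (simp add: cc_idx A.Pm_idx B.Pm_idx)
    have f0U: "linear_map CC UE.U M' f0" "linear_map CC UE.U M' h"
      using h_mem B.EU_V A.EU_V
      by (auto simp: linear_map_def f0 f0_add f0_smult h_add h_smult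
          A.G.underlying_OM[unfolded A.E_eq[symmetric], simplified])
    have m: "A.he r v \<in> A.W (idx l r)" for r
      using A.p_mem[OF A.EU_V[OF v]] by (simp add: A.he_def)
    have v_sum: "v = (\<Oplus>\<^bsub>UE.U\<^esub>r\<in>UNIV. A.he r v)"
      using UE.G.e_sum[of v] v A.E_mat_elem[OF v] by (simp add: UE.te_def A.he_def)
    have "f0 v = (\<Oplus>\<^bsub>M'\<^esub>r\<in>UNIV. f0 (A.he r v))"
      by (subst v_sum, subst linear_map_finsum[OF UE.cvec_axioms B.cvec_axioms f0U(1)])
        (use m A.W_EU in auto)
    also have "\<dots> = (\<Oplus>\<^bsub>M'\<^esub>r\<in>UNIV. h (A.he r v))" using r[OF m] by simp
    also have "\<dots> = h v"
      by (subst (2) v_sum, subst linear_map_finsum[OF UE.cvec_axioms B.cvec_axioms f0U(2)])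
        (use m A.W_EU in auto)
    finally show "restrict ?f A.EU v = h v" using v A.EU_V by simp
  qed (use h_ext in auto)
  ultimately show ?thesis by blast
qed

section \<open>Essential surjectivity\<close>

text \<open>An infinite type is in bijection with its square, so a list folds into one element by
  iterated pairing. The fold separates lists of equal length; pairing it with an encoding of the
  length separates all lists.\<close>

lemma exists_inj_lists:
  assumes "infinite (UNIV :: 'a set)"
  shows "\<exists>g :: 'a list \<Rightarrow> 'a. inj g"
proof -
  have "\<exists>p :: 'a \<times> 'a \<Rightarrow> 'a. bij_betw p (UNIV \<times> UNIV) UNIV"
    using card_of_Times_same_infinite[OF assms] by (simp only: card_of_ordIso)
  then obtain p :: "'a \<times> 'a \<Rightarrow> 'a" where "bij_betw p (UNIV \<times> UNIV) UNIV" ..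
  then have "inj p" by (simp add: bij_betw_def)
  then have p: "p (a, b) = p (a', b') \<longleftrightarrow> a = a' \<and> b = b'" for a b a' b'
    by (simp add: inj_eq)
  obtain e :: "nat \<Rightarrow> 'a" where e: "inj e"
    using infinite_countable_subset[OF assms] by auto
  define c where "c xs = foldr (\<lambda>x y. p (x, y)) xs undefined" for xs :: "'a list"
  have c: "xs = ys" if "length xs = length ys" "c xs = c ys" for xs ys
    using that by (induction xs ys rule: list_induct2) (auto simp: c_def p)
  have "inj (\<lambda>xs. p (e (length xs), c xs))"
  proof (rule injI)
    fix xs ys assume "p (e (length xs), c xs) = p (e (length ys), c ys)"
    then have "length xs = length ys" "c xs = c ys" using e by (auto simp: p inj_def)
    then show "xs = ys" by (rule c)
  qed
  then show ?thesis by blast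
qed

text \<open>A function is recorded as the list of its values on a symmetric window containing its
  support. The length of the list gives back the window, and outside it the value is
  \<open>z\<close>.\<close>

lemma exists_inj_finite_support:
  fixes z :: 'a
  assumes "infinite (UNIV :: 'a set)"
  shows "\<exists>g :: (int \<Rightarrow> 'a) \<Rightarrow> 'a. inj_on g {f. finite {i. f i \<noteq> z}}"
proof -
  obtain g :: "'a list \<Rightarrow> 'a" where g: "inj g" using exists_inj_lists[OF assms] by blast
  have "\<exists>k::nat. \<forall>i. f i \<noteq> z \<longrightarrow> \<bar>i\<bar> \<le> int k" if "finite {i. f i \<noteq> z}" for f :: "int \<Rightarrow> 'a"
  proof -
    define K where "K = (\<Sum>i\<in>{i. f i \<noteq> z}. nat \<bar>i\<bar>)"
    have "nat \<bar>i\<bar> \<le> K" if "f i \<noteq> z" for i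
      unfolding K_def using \<open>finite _\<close> that by (intro member_le_sum) auto
    then show ?thesis by (intro exI[of _ K]) (auto simp: nat_le_iff)
  qed
  then obtain k :: "(int \<Rightarrow> 'a) \<Rightarrow> nat"
    where k: "\<And>f i. finite {i. f i \<noteq> z} \<Longrightarrow> f i \<noteq> z \<Longrightarrow> \<bar>i\<bar> \<le> int (k f)" by metis
  have "inj_on (\<lambda>f. g (map f [- int (k f)..int (k f)])) {f. finite {i. f i \<noteq> z}}"
  proof (rule inj_onI)
    fix f h :: "int \<Rightarrow> 'a"
    assume fh: "f \<in> {f. finite {i. f i \<noteq> z}}" "h \<in> {f. finite {i. f i \<noteq> z}}"
      and "g (map f [- int (k f)..int (k f)]) = g (map h [- int (k h)..int (k h)])"
    then have eq: "map f [- int (k f)..int (k f)] = map h [- int (k h)..int (k h)]"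
      using g by (auto simp: inj_def)
    from arg_cong[OF eq, of length] have kk: "k f = k h" by simp
    show "f = h"
    proof
      fix i
      show "f i = h i"
      proof (cases "\<bar>i\<bar> \<le> int (k f)")
        case True
        then have "i \<in> set [- int (k f)..int (k f)]" by auto
        then show ?thesis using eq unfolding kk map_eq_conv by blast
      next
        case False
        then have "f i = z" "h i = z" using k[of f i] k[of h i] fh kk by auto
        then show ?thesis by simp
      qed
    qed
  qed
  then show ?thesis by blast
qed

text \<open>The weight spaces of the module belonging to an \<open>\<AA>\<close>-module are copies of its components, so that
  its vectors are finitely supported functions; these are encoded in the universe by \<open>code\<close>.\<close>

definition Cm :: "(fmat3, 'u) module \<Rightarrow> nat \<Rightarrow> int \<Rightarrow> 'u set" where
  "Cm N l i = {u \<in> carrier N. mat_elem (cc l i) (cc l i) 1 \<odot>\<^bsub>N\<^esub> u = u}"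

definition FF :: "(fmat3, 'u) module \<Rightarrow> nat \<Rightarrow> (int \<Rightarrow> 'u) set" where
  "FF N l = {f. (\<forall>i. f i \<in> Cm N l i) \<and> finite {i. f i \<noteq> \<zero>\<^bsub>N\<^esub>}}"

text \<open>The multiples of a nonzero vector embed \<open>\<complex>\<close> into
  \<open>'u\<close>, which is therefore infinite. A zero module may live in a finite type, but then
  at most one function has to be encoded.\<close>

lemma (in left_A) exists_code: "\<exists>code :: (int \<Rightarrow> 'u) \<Rightarrow> 'u. inj_on code (FF N l)"
proof (cases "carrier N \<subseteq> {\<zero>\<^bsub>N\<^esub>}")
  case True
  then have "FF N l \<subseteq> {\<lambda>_. \<zero>\<^bsub>N\<^esub>}" by (auto simp: FF_def Cm_def)
  then have "inj_on (\<lambda>_. undefined) (FF N l)" by (auto simp: inj_on_def)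
  then show ?thesis by blast
next
  case False
  then obtain v where v: "v \<in> carrier N" "v \<noteq> \<zero>\<^bsub>N\<^esub>" by auto
  obtain \<phi> where \<phi>: "\<phi> \<in> dual_space U (carrier U)" "\<phi> v = 1"
    using exists_functional[of v] v by auto
  have "inj (\<lambda>c. c \<odot>\<^bsub>U\<^esub> v)"
  proof (rule injI)
    fix c d assume "c \<odot>\<^bsub>U\<^esub> v = d \<odot>\<^bsub>U\<^esub> v"
    then have "\<phi> (c \<odot>\<^bsub>U\<^esub> v) = \<phi> (d \<odot>\<^bsub>U\<^esub> v)" by simp
    then show "c = d" using functional_smult[OF \<phi>(1), of v] v \<phi> by simp
  qed
  then have "infinite (UNIV :: 'u set)"
    using infinite_UNIV_char_0[where ?'a = complex] by (metis finite_imageD rev_finite_subset subset_UNIV)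
  then obtain g :: "(int \<Rightarrow> 'u) \<Rightarrow> 'u" where "inj_on g {f. finite {i. f i \<noteq> \<zero>\<^bsub>N\<^esub>}}"
    using exists_inj_finite_support[of "\<zero>\<^bsub>N\<^esub>"] by blast
  then have "inj_on g (FF N l)" by (rule inj_on_subset) (auto simp: FF_def)
  then show ?thesis by blast
qed

abbreviation wt :: "nat \<Rightarrow> int \<Rightarrow> int" where "wt l i \<equiv> - int l - 1 + 2 * i"

section \<open>The module of finitely supported functions\<close>

locale gmod = left_A N for N :: "(fmat3, 'u) module" +
  fixes l :: nat and code :: "(int \<Rightarrow> 'u) \<Rightarrow> 'u"
  assumes l_pos: "l > 0" and code: "inj_on code (FF N l)"
begin

abbreviation dec where "dec \<equiv> inv_into (FF N l) code"
abbreviation xa where "xa i u \<equiv> xi l i \<odot>\<^bsub>N\<^esub> u"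
abbreviation ea where "ea i u \<equiv> et l i \<odot>\<^bsub>N\<^esub> u"

definition gfun :: "cmat2 \<Rightarrow> (int \<Rightarrow> 'u) \<Rightarrow> int \<Rightarrow> 'u" where
  "gfun Z f i = coordX Z \<odot>\<^bsub>U\<^esub> xa (i - 1) (f (i - 1)) \<oplus>\<^bsub>N\<^esub>
     ((coordH Z * of_int (wt l i)) \<odot>\<^bsub>U\<^esub> f i \<oplus>\<^bsub>N\<^esub> coordY Z \<odot>\<^bsub>U\<^esub> ea (i + 1) (f (i + 1)))"

text \<open>The structure is transported along \<open>code\<close>. The action of \<open>K\<close>
  is the only one that \<open>kact_weight\<close> permits.\<close>

definition GM :: "'u gk_module" where
  "GM = \<lparr>carrier = code ` FF N l, mult = undefined, one = undefined, zero = code (\<lambda>_. \<zero>\<^bsub>N\<^esub>),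
     add = (\<lambda>v w. code (\<lambda>i. dec v i \<oplus>\<^bsub>N\<^esub> dec w i)), smult = (\<lambda>c v. code (\<lambda>i. c \<odot>\<^bsub>U\<^esub> dec v i)),
     gact = (\<lambda>Z v. code (gfun Z (dec v))),
     kact = (\<lambda>k v. code (\<lambda>i. chi k powi (wt l i) \<odot>\<^bsub>U\<^esub> dec v i))\<rparr>"

lemmas nf = functional_simps[unfolded U_simps]
lemmas N_eqI = vector_eqI[unfolded U_simps]
lemmas N_closed [simp] = M.a_closed[unfolded U_simps] M.zero_closed[unfolded U_simps]
lemmas N_zero [simp] = smult_zero[unfolded U_simps] M.l_zero[unfolded U_simps] M.r_zero[unfolded U_simps]

lemma xa_closed [simp]: "u \<in> carrier N \<Longrightarrow> xa i u \<in> carrier N"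
  and ea_closed [simp]: "u \<in> carrier N \<Longrightarrow> ea i u \<in> carrier N"
  by (simp_all add: act_closed)

lemma a_linear:
  assumes "a \<in> carrier order_A"
  shows "u \<in> carrier N \<Longrightarrow> w \<in> carrier N \<Longrightarrow> a \<odot>\<^bsub>N\<^esub> (u \<oplus>\<^bsub>N\<^esub> w) = a \<odot>\<^bsub>N\<^esub> u \<oplus>\<^bsub>N\<^esub> a \<odot>\<^bsub>N\<^esub> w"
    "u \<in> carrier N \<Longrightarrow> a \<odot>\<^bsub>N\<^esub> (c \<odot>\<^bsub>U\<^esub> u) = c \<odot>\<^bsub>U\<^esub> (a \<odot>\<^bsub>N\<^esub> u)" "a \<odot>\<^bsub>N\<^esub> \<zero>\<^bsub>N\<^esub> = \<zero>\<^bsub>N\<^esub>"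
  using linear_mapD[OF act_linear[OF assms]] linear_map_zero[OF cvec_axioms cvec_axioms act_linear[OF assms]]
  by simp_all

lemmas xa_linear [simp] = a_linear[OF xi_et_in(1)]
lemmas ea_linear [simp] = a_linear[OF xi_et_in(2)]

lemma Cm_mem: "u \<in> Cm N l i \<Longrightarrow> u \<in> carrier N"
  by (simp add: Cm_def)

lemma Cm_closed: "\<zero>\<^bsub>N\<^esub> \<in> Cm N l i" "u \<in> Cm N l i \<Longrightarrow> w \<in> Cm N l i \<Longrightarrow> u \<oplus>\<^bsub>N\<^esub> w \<in> Cm N l i"
  "u \<in> Cm N l i \<Longrightarrow> c \<odot>\<^bsub>U\<^esub> u \<in> Cm N l i"
  using a_linear[OF mat_elem_eps_in(3)] by (auto simp: Cm_def)

lemma xa_Cm: "u \<in> carrier N \<Longrightarrow> xa i u \<in> Cm N l (i + 1)"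
  and ea_Cm: "u \<in> carrier N \<Longrightarrow> ea i u \<in> Cm N l (i - 1)"
  by (simp_all add: Cm_def act_mult xi_cc[OF l_pos] et_cc[OF l_pos])

lemma XY_Cm: "u \<in> Cm N l i \<Longrightarrow> xa (i - 1) (ea i u) = tT u \<oplus>\<^bsub>N\<^esub> kap l i \<odot>\<^bsub>U\<^esub> u"
  and YX_Cm: "u \<in> Cm N l i \<Longrightarrow> ea (i + 1) (xa i u) = tT u \<oplus>\<^bsub>N\<^esub> kap l (i + 1) \<odot>\<^bsub>U\<^esub> u"
proof -
  have s: "(mat (fps_X + fps_const c) ** mat_elem (cc l i) (cc l i) 1) \<odot>\<^bsub>N\<^esub> u = tT u \<oplus>\<^bsub>N\<^esub> c \<odot>\<^bsub>U\<^esub> u"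
    if u: "u \<in> Cm N l i" for c
  proof -
    have "u \<in> carrier N" "mat_elem (cc l i) (cc l i) 1 \<odot>\<^bsub>N\<^esub> u = u" using u by (auto simp: Cm_def)
    then show ?thesis
      using act_mult[OF mat_in_order_A[of "fps_X + fps_const c"] mat_elem_eps_in(3)[of "cc l i" 1], of u]
      by (simp add: mat_add act_add_left mat_in_order_A tT_def U_smult)
  qed
  assume u: "u \<in> Cm N l i"
  then have "u \<in> carrier N" by (simp add: Cm_def)
  then show "xa (i - 1) (ea i u) = tT u \<oplus>\<^bsub>N\<^esub> kap l i \<odot>\<^bsub>U\<^esub> u"
    "ea (i + 1) (xa i u) = tT u \<oplus>\<^bsub>N\<^esub> kap l (i + 1) \<odot>\<^bsub>U\<^esub> u"
    using s[OF u] by (simp_all add: act_mult xi_et[OF l_pos])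
qed

lemma tT_closed [simp]: "u \<in> carrier N \<Longrightarrow> tT u \<in> carrier N"
  using G.T_closed[of u] by simp

lemma FF_mem: "f \<in> FF N l \<Longrightarrow> f i \<in> carrier N"
  by (simp add: FF_def Cm_def)

lemma FF_zero: "(\<lambda>_. \<zero>\<^bsub>N\<^esub>) \<in> FF N l"
  by (simp add: FF_def Cm_closed)

lemma FF_add: "f \<in> FF N l \<Longrightarrow> g \<in> FF N l \<Longrightarrow> (\<lambda>i. f i \<oplus>\<^bsub>N\<^esub> g i) \<in> FF N l"
  by (auto simp: FF_def Cm_closed intro: rev_finite_subset[of "{i. f i \<noteq> \<zero>\<^bsub>N\<^esub>} \<union> {i. g i \<noteq> \<zero>\<^bsub>N\<^esub>}"])

lemma FF_smult: "f \<in> FF N l \<Longrightarrow> (\<lambda>i. c i \<odot>\<^bsub>U\<^esub> f i) \<in> FF N l"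
  by (auto simp: FF_def Cm_closed intro: rev_finite_subset[of "{i. f i \<noteq> \<zero>\<^bsub>N\<^esub>}"])

lemma FF_xa: "f \<in> FF N l \<Longrightarrow> (\<lambda>i. xa (i - 1) (f (i - 1))) \<in> FF N l"
proof -
  assume f: "f \<in> FF N l"
  have "{i. xa (i - 1) (f (i - 1)) \<noteq> \<zero>\<^bsub>N\<^esub>} \<subseteq> (\<lambda>i. i + 1) ` {i. f i \<noteq> \<zero>\<^bsub>N\<^esub>}"
    by (auto simp: image_iff intro: exI[of _ "_ - 1"]) (metis diff_add_cancel xa_linear(3))
  moreover have "xa (i - 1) (f (i - 1)) \<in> Cm N l i" for i
    using xa_Cm[of "f (i - 1)" "i - 1"] FF_mem[OF f] by simp
  ultimately show ?thesis using f by (auto simp: FF_def intro: finite_subset)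
qed

lemma FF_ea: "f \<in> FF N l \<Longrightarrow> (\<lambda>i. ea (i + 1) (f (i + 1))) \<in> FF N l"
proof -
  assume f: "f \<in> FF N l"
  have "{i. ea (i + 1) (f (i + 1)) \<noteq> \<zero>\<^bsub>N\<^esub>} \<subseteq> (\<lambda>i. i - 1) ` {i. f i \<noteq> \<zero>\<^bsub>N\<^esub>}"
    by (auto simp: image_iff intro: exI[of _ "_ + 1"]) (metis add_diff_cancel_right' ea_linear(3))
  moreover have "ea (i + 1) (f (i + 1)) \<in> Cm N l i" for i
    using ea_Cm[of "f (i + 1)" "i + 1"] FF_mem[OF f] by simp
  ultimately show ?thesis using f by (auto simp: FF_def intro: finite_subset)
qed

lemma FF_gfun: "f \<in> FF N l \<Longrightarrow> gfun Z f \<in> FF N l"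
  unfolding gfun_def[abs_def] by (intro FF_add FF_smult FF_xa FF_ea)

lemma dec_FF: "v \<in> carrier GM \<Longrightarrow> dec v \<in> FF N l"
  by (simp add: GM_def inv_into_into)

lemma code_dec: "v \<in> carrier GM \<Longrightarrow> code (dec v) = v"
  by (simp add: GM_def f_inv_into_f)

lemma dec_code [simp]: "f \<in> FF N l \<Longrightarrow> dec (code f) = f"
  using code by simp

lemma code_mem: "f \<in> FF N l \<Longrightarrow> code f \<in> carrier GM"
  by (simp add: GM_def)

lemma dec_mem [simp]: "v \<in> carrier GM \<Longrightarrow> dec v i \<in> carrier N"
  using FF_mem[OF dec_FF] .

lemma dec_Cm: "v \<in> carrier GM \<Longrightarrow> dec v i \<in> Cm N l i"
  using dec_FF[of v] by (simp add: FF_def)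

lemma dec_finite: "v \<in> carrier GM \<Longrightarrow> finite {i. dec v i \<noteq> \<zero>\<^bsub>N\<^esub>}"
  using dec_FF[of v] by (simp add: FF_def)

lemma GM_eqI: "v \<in> carrier GM \<Longrightarrow> w \<in> carrier GM \<Longrightarrow> (\<And>i. dec v i = dec w i) \<Longrightarrow> v = w"
  using code_dec[of v] code_dec[of w] by (metis ext)

lemma GM_ops:
  "v \<oplus>\<^bsub>GM\<^esub> w = code (\<lambda>i. dec v i \<oplus>\<^bsub>N\<^esub> dec w i)" "c \<odot>\<^bsub>GM\<^esub> v = code (\<lambda>i. c \<odot>\<^bsub>U\<^esub> dec v i)"
  "\<zero>\<^bsub>GM\<^esub> = code (\<lambda>_. \<zero>\<^bsub>N\<^esub>)" "gact GM Z v = code (gfun Z (dec v))"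
  "kact GM k v = code (\<lambda>i. chi k powi (wt l i) \<odot>\<^bsub>U\<^esub> dec v i)"
  by (simp_all add: GM_def)

lemma dec_ops [simp]:
  "v \<in> carrier GM \<Longrightarrow> w \<in> carrier GM \<Longrightarrow> dec (v \<oplus>\<^bsub>GM\<^esub> w) i = dec v i \<oplus>\<^bsub>N\<^esub> dec w i"
  "v \<in> carrier GM \<Longrightarrow> dec (c \<odot>\<^bsub>GM\<^esub> v) i = c \<odot>\<^bsub>U\<^esub> dec v i"
  "dec \<zero>\<^bsub>GM\<^esub> i = \<zero>\<^bsub>N\<^esub>"
  "v \<in> carrier GM \<Longrightarrow> dec (gact GM Z v) i = gfun Z (dec v) i"
  "v \<in> carrier GM \<Longrightarrow> dec (kact GM k v) i = chi k powi (wt l i) \<odot>\<^bsub>U\<^esub> dec v i"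
  by (simp_all add: GM_ops FF_add FF_smult FF_zero FF_gfun dec_FF)

lemma GM_closed [simp]:
  "v \<in> carrier GM \<Longrightarrow> w \<in> carrier GM \<Longrightarrow> v \<oplus>\<^bsub>GM\<^esub> w \<in> carrier GM"
  "v \<in> carrier GM \<Longrightarrow> c \<odot>\<^bsub>GM\<^esub> v \<in> carrier GM" "\<zero>\<^bsub>GM\<^esub> \<in> carrier GM"
  "v \<in> carrier GM \<Longrightarrow> gact GM Z v \<in> carrier GM" "v \<in> carrier GM \<Longrightarrow> kact GM k v \<in> carrier GM"
  unfolding GM_ops by (intro code_mem FF_add FF_smult FF_zero FF_gfun dec_FF; assumption)+

lemma GM_vecI:
  "v \<in> carrier GM \<Longrightarrow> w \<in> carrier GM \<Longrightarrow>
    (\<And>\<phi> i. \<phi> \<in> dual_space U (carrier N) \<Longrightarrow> \<phi> (dec v i) = \<phi> (dec w i)) \<Longrightarrow> v = w"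
  by (rule GM_eqI, assumption, assumption, rule N_eqI) simp_all

lemma GM_cvec: "cvec GM"
proof (rule cvec.intro, rule moduleI[OF cring_CC])
  show "abelian_group GM"
  proof (rule abelian_groupI)
    show "\<exists>w\<in>carrier GM. w \<oplus>\<^bsub>GM\<^esub> v = \<zero>\<^bsub>GM\<^esub>" if "v \<in> carrier GM" for v
      using that by (intro bexI[of _ "(- 1) \<odot>\<^bsub>GM\<^esub> v"] GM_vecI) (auto simp: nf)
  qed ((rule GM_vecI; simp add: nf) | simp)+
qed ((rule GM_vecI; simp add: nf algebra_simps) | simp)+

end

sublocale gmod \<subseteq> GM: cvec GM
  by (rule GM_cvec)

context gmod
begin

section \<open>The grading of the constructed module\<close>

definition Wg :: "int \<Rightarrow> 'u set" where "Wg i = {v \<in> carrier GM. \<forall>j. j \<noteq> i \<longrightarrow> dec v j = \<zero>\<^bsub>N\<^esub>}"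
definition sg :: "int \<Rightarrow> 'u \<Rightarrow> 'u" where "sg i u = code (\<lambda>j. if j = i then u else \<zero>\<^bsub>N\<^esub>)"
definition pg :: "int \<Rightarrow> 'u \<Rightarrow> 'u" where "pg i v = sg i (dec v i)"

lemma sg_FF: "u \<in> Cm N l i \<Longrightarrow> (\<lambda>j. if j = i then u else \<zero>\<^bsub>N\<^esub>) \<in> FF N l"
  by (auto simp: FF_def Cm_closed)

lemma sg_mem [simp]: "u \<in> Cm N l i \<Longrightarrow> sg i u \<in> carrier GM"
  by (simp add: sg_def code_mem sg_FF)

lemma dec_sg: "u \<in> Cm N l i \<Longrightarrow> dec (sg i u) j = (if j = i then u else \<zero>\<^bsub>N\<^esub>)"
  by (simp add: sg_def sg_FF)

lemma sg_Wg: "u \<in> Cm N l i \<Longrightarrow> sg i u \<in> Wg i"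
  by (simp add: Wg_def dec_sg)

lemma pg_mem [simp]: "v \<in> carrier GM \<Longrightarrow> pg i v \<in> carrier GM"
  by (simp add: pg_def dec_Cm)

lemma dec_pg [simp]: "v \<in> carrier GM \<Longrightarrow> dec (pg i v) j = (if j = i then dec v i else \<zero>\<^bsub>N\<^esub>)"
  by (simp add: pg_def dec_sg dec_Cm)

lemma Wg_eq: "v \<in> Wg i \<Longrightarrow> v = sg i (dec v i)"
  by (rule GM_eqI) (auto simp: Wg_def dec_sg dec_Cm)

lemma pg_zero_iff: "v \<in> carrier GM \<Longrightarrow> pg i v = \<zero>\<^bsub>GM\<^esub> \<longleftrightarrow> dec v i = \<zero>\<^bsub>N\<^esub>"
  by (metis GM_closed(3) GM_eqI dec_ops(3) dec_pg pg_mem)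

lemma GM_graded: "graded GM Wg pg"
proof (intro graded.intro graded_axioms.intro GM_cvec)
  show "submodule (Wg i) CC GM" for i
    by (rule GM.submoduleI') (auto simp: Wg_def)
  fix v i assume v: "v \<in> carrier GM"
  show "pg i v \<in> Wg i" using v by (simp add: Wg_def)
  show "finite {i. pg i v \<noteq> \<zero>\<^bsub>GM\<^esub>}" using dec_finite[OF v] v by (simp add: pg_zero_iff)
  show "pg i (c \<odot>\<^bsub>GM\<^esub> v) = c \<odot>\<^bsub>GM\<^esub> pg i v" for c
    using v by (intro GM_vecI) auto
  fix w assume w: "w \<in> carrier GM"
  show "pg i (v \<oplus>\<^bsub>GM\<^esub> w) = pg i v \<oplus>\<^bsub>GM\<^esub> pg i w"
    using v w by (intro GM_vecI) auto
  assume eq: "\<And>i. pg i v = pg i w"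
  show "v = w"
  proof (rule GM_eqI[OF v w])
    fix i show "dec v i = dec w i"
      using arg_cong[OF eq[of i], of "\<lambda>x. dec x i"] v w by simp
  qed
next
  fix v i assume v: "v \<in> Wg i"
  then have v': "v \<in> carrier GM" by (simp add: Wg_def)
  show "pg i v = v" using v v' by (intro GM_vecI) (auto simp: Wg_def)
  show "pg j v = \<zero>\<^bsub>GM\<^esub>" if "j \<noteq> i" for j using v v' that by (simp add: Wg_def pg_zero_iff)
qed

end

sublocale gmod \<subseteq> GM: graded GM Wg pg
  by (rule GM_graded)

context gmod
begin

text \<open>The part of degree \<open>i\<close> is a linear image of the finite dimensional
  \<open>N\<close>, by way of the idempotent at \<open>cc l i\<close>.\<close>

lemma Wg_fd: "fd_subspace GM (Wg i)"
proof -
  let ?f = "\<lambda>u. sg i (mat_elem (cc l i) (cc l i) 1 \<odot>\<^bsub>N\<^esub> u)"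
  have C: "mat_elem (cc l i) (cc l i) 1 \<odot>\<^bsub>N\<^esub> u \<in> Cm N l i" if "u \<in> carrier N" for u
    using that by (simp add: Cm_def act_closed act_mult mat_elem_mult)
  have "linear_map CC U GM ?f"
    using C a_linear[OF mat_elem_eps_in(3)]
    by (auto simp: linear_map_def dec_sg Cm_closed intro!: GM_vecI)
  from fd_subspace_image[OF cvec_axioms GM_cvec this fd_N]
  have "fd_subspace GM (?f ` carrier N)" .
  moreover have "?f ` carrier N = Wg i"
  proof
    show "?f ` carrier N \<subseteq> Wg i" using C sg_Wg by auto
    show "Wg i \<subseteq> ?f ` carrier N"
    proof
      fix v assume v: "v \<in> Wg i"
      then have "dec v i \<in> Cm N l i" using dec_Cm by (simp add: Wg_def)
      then show "v \<in> ?f ` carrier N"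
        using Wg_eq[OF v] by (intro image_eqI[of _ _ "dec v i"]) (auto simp: Cm_def)
    qed
  qed
  ultimately show ?thesis by simp
qed

lemma dec_minus:
  "v \<in> carrier GM \<Longrightarrow> w \<in> carrier GM \<Longrightarrow> dec (v \<ominus>\<^bsub>GM\<^esub> w) i = dec v i \<oplus>\<^bsub>N\<^esub> (- 1) \<odot>\<^bsub>U\<^esub> dec w i"
  by (simp add: a_minus_def GM.uminus_eq_smult)

lemma GM_minus_closed [simp]: "v \<in> carrier GM \<Longrightarrow> w \<in> carrier GM \<Longrightarrow> v \<ominus>\<^bsub>GM\<^esub> w \<in> carrier GM"
  by (simp add: a_minus_def GM.uminus_eq_smult)

lemma gfun_closed [simp]: "(\<And>j. f j \<in> carrier N) \<Longrightarrow> gfun Z f i \<in> carrier N"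
  by (simp add: gfun_def)

section \<open>The actions of the Lie algebra and of \<open>K\<close> on the constructed
  module\<close>

lemma functional_gfun:
  assumes "\<phi> \<in> dual_space U (carrier N)" "\<And>j. f j \<in> carrier N"
  shows "\<phi> (gfun Z f i) = coordX Z * \<phi> (xa (i - 1) (f (i - 1))) + coordH Z * of_int (wt l i) * \<phi> (f i)
    + coordY Z * \<phi> (ea (i + 1) (f (i + 1)))"
  using assms by (simp add: gfun_def nf)

lemma GM_lie: "lie_action GM"
  unfolding lie_action_def
proof (intro conjI ballI allI)
  fix Z assume Z: "Z \<in> sl2c"
  show "linear_map CC GM GM (gact GM Z)"
    unfolding linear_map_def
    by (auto intro!: GM_vecI simp: functional_gfun nf algebra_simps)
  fix v assume v: "v \<in> carrier GM"
  show "gact GM (Z + Z') v = gact GM Z v \<oplus>\<^bsub>GM\<^esub> gact GM Z' v" for Z'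
    using v by (intro GM_vecI) (auto simp: functional_gfun nf coord_add algebra_simps)
  show "gact GM (map_matrix ((*) c) Z) v = c \<odot>\<^bsub>GM\<^esub> gact GM Z v" for c
    using v by (intro GM_vecI) (auto simp: functional_gfun nf coord_scale algebra_simps)
  fix Z' assume Z': "Z' \<in> sl2c"
  show "gact GM (lie_bracket Z Z') v = gact GM Z (gact GM Z' v) \<ominus>\<^bsub>GM\<^esub> gact GM Z' (gact GM Z v)"
  proof (rule GM_vecI)
    fix \<phi> i assume \<phi>: "\<phi> \<in> dual_space U (carrier N)"
    define a b c a' b' c' where abc: "a = coordX Z" "b = coordH Z" "c = coordY Z"
      "a' = coordX Z'" "b' = coordH Z'" "c' = coordY Z'"
    define f where "f = dec v"
    have f: "f j \<in> carrier N" for j using v by (simp add: f_def)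
    have fC: "f j \<in> Cm N l j" for j using v by (simp add: f_def dec_Cm)
    define n where "n = complex_of_int (wt l i)"
    have n: "complex_of_int (wt l (i - 1)) = n - 2" "complex_of_int (wt l (i + 1)) = n + 2"
      by (simp_all add: n_def)
    \<comment> \<open>A step down followed by a step up returns to degree \<open>i\<close>;
      \<open>XY_Cm\<close> evaluates it as \<open>tT\<close> plus the scalar \<open>kap l i\<close>.
      The opposite order, treated next, gives \<open>kap l (i + 1)\<close>.\<close>
    have XX: "\<phi> (xa (i - 1) (gfun Z1 f (i - 1))) = coordX Z1 * \<phi> (xa (i - 1) (xa (i - 2) (f (i - 2))))
        + coordH Z1 * (n - 2) * \<phi> (xa (i - 1) (f (i - 1)))
        + coordY Z1 * (\<phi> (tT (f i)) + kap l i * \<phi> (f i))" for Z1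
      using f \<phi> XY_Cm[OF fC[of i]] by (simp add: gfun_def nf n[symmetric])
    have YY: "\<phi> (ea (i + 1) (gfun Z1 f (i + 1))) = coordX Z1 * (\<phi> (tT (f i)) + kap l (i + 1) * \<phi> (f i))
        + coordH Z1 * (n + 2) * \<phi> (ea (i + 1) (f (i + 1)))
        + coordY Z1 * \<phi> (ea (i + 1) (ea (i + 2) (f (i + 2))))" for Z1
      using f \<phi> YX_Cm[OF fC[of i]] by (simp add: gfun_def nf n[symmetric] add.assoc)
    have gg: "\<phi> (gfun Z1 (gfun Z2 f) i) = coordX Z1 * \<phi> (xa (i - 1) (gfun Z2 f (i - 1)))
        + coordH Z1 * n * \<phi> (gfun Z2 f i) + coordY Z1 * \<phi> (ea (i + 1) (gfun Z2 f (i + 1)))" for Z1 Z2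
      using f \<phi> by (simp add: functional_gfun n_def)
    have g: "\<phi> (gfun Z1 f i) = coordX Z1 * \<phi> (xa (i - 1) (f (i - 1)))
        + coordH Z1 * n * \<phi> (f i) + coordY Z1 * \<phi> (ea (i + 1) (f (i + 1)))" for Z1
      using f \<phi> by (simp add: functional_gfun n_def)
    \<comment> \<open>In the commutator the terms with \<open>tT\<close> cancel and the two scalars
      differ by the weight. This is \<open>[X, Y] = H\<close>.\<close>
    have k: "kap l i = kap l (i + 1) + n" using kap_diff[of l i] by (simp add: n_def algebra_simps)
    have dg: "dec (gact GM Z1 (gact GM Z2 v)) i = gfun Z1 (gfun Z2 f) i" for Z1 Z2
    proof -
      have "dec (gact GM Z2 v) = gfun Z2 f" using v by (auto simp: f_def)
      then show ?thesis using v by simp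
    qed
    have "\<phi> (dec (gact GM Z (gact GM Z' v) \<ominus>\<^bsub>GM\<^esub> gact GM Z' (gact GM Z v)) i)
        = \<phi> (gfun Z (gfun Z' f) i) - \<phi> (gfun Z' (gfun Z f) i)"
      using v \<phi> f by (simp add: dec_minus dg nf del: dec_ops(4))
    also have "\<dots> = \<phi> (gfun (lie_bracket Z Z') f i)"
      unfolding gg XX YY g coord_bracket[OF Z Z'] k by (simp add: algebra_simps)
    also have "\<dots> = \<phi> (dec (gact GM (lie_bracket Z Z') v) i)" using v by (simp add: f_def)
    finally show "\<phi> (dec (gact GM (lie_bracket Z Z') v) i)
        = \<phi> (dec (gact GM Z (gact GM Z' v) \<ominus>\<^bsub>GM\<^esub> gact GM Z' (gact GM Z v)) i)" by simp
  qed (use v in auto)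
qed

lemma GM_kact: "group_action_K GM"
  unfolding group_action_K_def
proof (intro conjI ballI)
  show "linear_map CC GM GM (kact GM k)" for k
    unfolding linear_map_def by (auto intro!: GM_vecI simp: nf algebra_simps)
  fix v assume v: "v \<in> carrier GM"
  show "kact GM (mat 1) v = v" using v by (intro GM_vecI) (auto simp: nf chi_one)
  show "kact GM (k ** k') v = kact GM k (kact GM k' v)" if "k \<in> SO2" "k' \<in> SO2" for k k'
    using v that by (intro GM_vecI) (auto simp: nf chi_mult power_int_mult_distrib)
qed

text \<open>\<open>X\<close> and \<open>Y\<close> shift the weight by \<open>2\<close> and
  \<open>-2\<close>, so conjugation with \<open>k\<close> multiplies them by the square of
  \<open>chi k\<close> and by its inverse, in agreement with \<open>coord_Ad\<close>.\<close>

lemma GM_Ad: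
  assumes k: "k \<in> SO2" and Z: "Z \<in> sl2c" and v: "v \<in> carrier GM"
  shows "gact GM (Ad k Z) v = kact GM k (gact GM Z (kact GM (matrix_inv k) v))"
proof (rule GM_vecI)
  fix \<phi> i assume \<phi>: "\<phi> \<in> dual_space U (carrier N)"
  let ?x = "chi k"
  have x: "?x \<noteq> 0" using k by simp
  have d: "dec (kact GM (matrix_inv k) v) = (\<lambda>j. inverse ?x powi wt l j \<odot>\<^bsub>U\<^esub> dec v j)"
    using v k by (auto simp: chi_inv)
  have e: "?x powi wt l i * inverse ?x powi wt l i = 1"
    "?x powi wt l i * inverse ?x powi wt l (i - 1) = ?x ^ 2"
    "?x powi wt l i * inverse ?x powi wt l (i + 1) = inverse ?x ^ 2"
  proof -
    have pw: "?x powi wt l i * inverse ?x powi j = ?x powi (wt l i - j)" for j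
      using x by (simp add: power_int_inverse power_int_diff divide_inverse)
    have ws: "wt l i - wt l (i - 1) = 2" "wt l i - wt l (i + 1) = - 2" "wt l i - wt l i = 0" by simp_all
    show "?x powi wt l i * inverse ?x powi wt l i = 1"
      "?x powi wt l i * inverse ?x powi wt l (i - 1) = ?x ^ 2"
      "?x powi wt l i * inverse ?x powi wt l (i + 1) = inverse ?x ^ 2"
      unfolding pw ws by (simp_all add: power_int_minus power_inverse)
  qed
  have "\<phi> (dec (kact GM k (gact GM Z (kact GM (matrix_inv k) v))) i)
      = ?x powi wt l i * \<phi> (gfun Z (\<lambda>j. inverse ?x powi wt l j \<odot>\<^bsub>U\<^esub> dec v j) i)"
    using v \<phi> by (simp add: d nf)
  also have "\<dots> = coordX Z * (?x powi wt l i * inverse ?x powi wt l (i - 1)) * \<phi> (xa (i - 1) (dec v (i - 1)))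
      + coordH Z * of_int (wt l i) * (?x powi wt l i * inverse ?x powi wt l i) * \<phi> (dec v i)
      + coordY Z * (?x powi wt l i * inverse ?x powi wt l (i + 1)) * \<phi> (ea (i + 1) (dec v (i + 1)))"
    using v \<phi> by (simp only: functional_gfun dec_mem U_smult_mem xa_linear ea_linear nf xa_closed ea_closed)
      (simp only: ring_distribs mult_ac)
  also have "\<dots> = coordX (Ad k Z) * \<phi> (xa (i - 1) (dec v (i - 1))) + coordH (Ad k Z) * of_int (wt l i) * \<phi> (dec v i)
      + coordY (Ad k Z) * \<phi> (ea (i + 1) (dec v (i + 1)))"
    unfolding e coord_Ad[OF k Z] by (simp only: mult_ac mult_1_right mult_1_left)
  also have "\<dots> = \<phi> (dec (gact GM (Ad k Z) v) i)"
    using v \<phi> by (simp only: functional_gfun dec_ops dec_mem)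
  finally show "\<phi> (dec (gact GM (Ad k Z) v) i)
      = \<phi> (dec (kact GM k (gact GM Z (kact GM (matrix_inv k) v))) i)" by simp
qed (use v in auto)

definition Sp :: "int set \<Rightarrow> 'u set" where "Sp S = {v \<in> carrier GM. \<forall>i. i \<notin> S \<longrightarrow> pg i v = \<zero>\<^bsub>GM\<^esub>}"

lemma Sp_fd: "finite S \<Longrightarrow> fd_subspace GM (Sp S)"
  unfolding Sp_def by (intro GM.fd_subspace_finite_support Wg_fd)

lemma Sp_iff: "v \<in> Sp S \<longleftrightarrow> v \<in> carrier GM \<and> (\<forall>i. i \<notin> S \<longrightarrow> dec v i = \<zero>\<^bsub>N\<^esub>)"
  by (auto simp: Sp_def pg_zero_iff)

text \<open>\<open>\<phi>\<close> is linear only on the subspace \<open>Sp S\<close>, so the rules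
  for functionals on the whole space do not apply, and all partial sums have to be kept inside
  \<open>Sp S\<close>.\<close>

lemma dual_finsum_Sp:
  assumes "\<phi> \<in> dual_space GM (Sp S)" "finite S" "v \<in> carrier GM"
    "\<And>i. dec v i = (if i \<in> S then c i \<odot>\<^bsub>U\<^esub> dec w i else \<zero>\<^bsub>N\<^esub>)" "w \<in> carrier GM"
  shows "\<phi> v = (\<Sum>i\<in>S. c i * \<phi> (pg i w))"
proof -
  have m: "pg i w \<in> Sp S" "c i \<odot>\<^bsub>GM\<^esub> pg i w \<in> Sp S" if "i \<in> S" for i
    using that assms(5) by (auto simp: Sp_iff)
  have sub: "submodule (Sp S) CC GM" using Sp_fd[OF assms(2)] GM.fd_subspace_submodule by blast
  have \<phi>0: "\<phi> \<zero>\<^bsub>GM\<^esub> = 0"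
  proof -
    have "\<phi> (0 \<odot>\<^bsub>GM\<^esub> \<zero>\<^bsub>GM\<^esub>) = 0 * \<phi> \<zero>\<^bsub>GM\<^esub>"
      using assms(1) GM.submodule_zero[OF sub] unfolding dual_space_def by blast
    then show ?thesis by simp
  qed
  have v: "v = (\<Oplus>\<^bsub>GM\<^esub>i\<in>S. c i \<odot>\<^bsub>GM\<^esub> pg i w)"
  proof -
    have "v = (\<Oplus>\<^bsub>GM\<^esub>i\<in>S. pg i v)"
      using assms by (intro GM.decompose) (auto simp: pg_zero_iff)
    also have "\<dots> = (\<Oplus>\<^bsub>GM\<^esub>i\<in>S. c i \<odot>\<^bsub>GM\<^esub> pg i w)"
      using assms by (intro GM.M.finsum_cong' refl) (auto intro!: GM_vecI)
    finally show ?thesis .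
  qed
  have "\<phi> (\<Oplus>\<^bsub>GM\<^esub>i\<in>A. c i \<odot>\<^bsub>GM\<^esub> pg i w) = (\<Sum>i\<in>A. c i * \<phi> (pg i w))" if "A \<subseteq> S" for A
    using finite_subset[OF that assms(2)] that
  proof (induction A rule: finite_induct)
    case (insert x F)
    have F: "(\<Oplus>\<^bsub>GM\<^esub>i\<in>F. c i \<odot>\<^bsub>GM\<^esub> pg i w) \<in> Sp S"
      using insert m by (intro GM.submodule_finsum[OF sub]) auto
    have "(\<Oplus>\<^bsub>GM\<^esub>i\<in>insert x F. c i \<odot>\<^bsub>GM\<^esub> pg i w) = c x \<odot>\<^bsub>GM\<^esub> pg x w \<oplus>\<^bsub>GM\<^esub> (\<Oplus>\<^bsub>GM\<^esub>i\<in>F. c i \<odot>\<^bsub>GM\<^esub> pg i w)"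
      using insert assms(5) by (intro GM.M.finsum_insert) auto
    then have "\<phi> (\<Oplus>\<^bsub>GM\<^esub>i\<in>insert x F. c i \<odot>\<^bsub>GM\<^esub> pg i w)
        = \<phi> (c x \<odot>\<^bsub>GM\<^esub> pg x w) + \<phi> (\<Oplus>\<^bsub>GM\<^esub>i\<in>F. c i \<odot>\<^bsub>GM\<^esub> pg i w)"
      using assms(1) F m(2)[of x] insert.prems by (auto simp: dual_space_def)
    also have "\<phi> (c x \<odot>\<^bsub>GM\<^esub> pg x w) = c x * \<phi> (pg x w)"
      using assms(1) m(1)[of x] insert.prems by (auto simp: dual_space_def)
    finally show ?case using insert by simp
  qed (simp add: \<phi>0)
  from this[of S] show ?thesis using v by simp
qed

lemma exp_deriv: "((\<lambda>t. exp (z * complex_of_real t) * c) has_vector_derivative z * (exp (z * complex_of_real t) * c)) (at t)"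
proof -
  have "((\<lambda>w. exp (z * w) * c) has_field_derivative z * (exp (z * of_real t) * c)) (at (of_real t))"
    by (auto intro!: derivative_eq_intros)
  then show ?thesis by (rule has_vector_derivative_real_field)
qed

lemma kact_rot_dec:
  "v \<in> carrier GM \<Longrightarrow> dec (kact GM (rot \<theta>) v) i = exp (- \<i> * of_int (wt l i) * of_real \<theta>) \<odot>\<^bsub>U\<^esub> dec v i"
  by (simp only: dec_ops chi_rot_powi)

lemma GM_locally_smooth: "locally_smooth GM"
  unfolding locally_smooth_def
proof
  fix v assume v: "v \<in> carrier GM"
  define S where "S = {i. dec v i \<noteq> \<zero>\<^bsub>N\<^esub>}"
  have S: "finite S" using dec_finite[OF v] by (simp add: S_def)
  have "smooth_fun (\<lambda>\<theta>. \<phi> (kact GM (rot \<theta>) w))" if w: "w \<in> Sp S" and \<phi>: "\<phi> \<in> dual_space GM (Sp S)" for \<phi> w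
  proof -
    define z where "z i = - \<i> * complex_of_int (wt l i)" for i
    have wC: "w \<in> carrier GM" using w by (simp add: Sp_iff)
    \<comment> \<open>On \<open>Sp S\<close> the rotations give finite sums of exponentials; the
      \<open>n\<close>-th derivative multiplies each term by \<open>z i ^ n\<close>.\<close>
    define F where "F n \<theta> = (\<Sum>i\<in>S. exp (z i * of_real \<theta>) * (z i ^ n * \<phi> (pg i w)))" for n and \<theta> :: real
    have "\<phi> (kact GM (rot \<theta>) w) = F 0 \<theta>" for \<theta>
      unfolding F_def
      by (subst dual_finsum_Sp[OF \<phi> S, where w = w and c = "\<lambda>i. exp (z i * of_real \<theta>)"])
        (use w wC in \<open>auto simp: kact_rot_dec z_def Sp_iff simp del: dec_ops(5)\<close>)
    moreover have "(F n has_vector_derivative F (Suc n) t) (at t)" for n t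
    proof -
      have "(F n has_vector_derivative (\<Sum>i\<in>S. z i * (exp (z i * of_real t) * (z i ^ n * \<phi> (pg i w))))) (at t)"
        unfolding F_def by (intro has_vector_derivative_sum exp_deriv)
      then show ?thesis by (simp add: F_def mult_ac)
    qed
    ultimately show ?thesis unfolding smooth_fun_def by (intro exI[of _ F]) auto
  qed
  then show "\<exists>W. fd_subspace GM W \<and> v \<in> W \<and> (\<forall>k\<in>SO2. \<forall>w\<in>W. kact GM k w \<in> W) \<and>
     (\<forall>w\<in>W. \<forall>\<phi>\<in>dual_space GM W. smooth_fun (\<lambda>\<theta>. \<phi> (kact GM (rot \<theta>) w)))"
    using v by (intro exI[of _ "Sp S"]) (auto simp: Sp_fd[OF S] Sp_iff, auto simp: S_def)
qed

lemma GM_derivative: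
  assumes v: "v \<in> carrier GM"
  shows "has_derivative_at_0 GM (\<lambda>t. kact GM (rot (t * s)) v) (gact GM (complexify (s *\<^sub>R J_mat)) v)"
proof -
  define S where "S = {i. dec v i \<noteq> \<zero>\<^bsub>N\<^esub>}"
  have S: "finite S" using dec_finite[OF v] by (simp add: S_def)
  \<comment> \<open>By \<open>J_mat_eq\<close> this is the factor by which \<open>s\<close> times
    \<open>J_mat\<close> acts on component \<open>i\<close>, and also the exponent of the character
    by which \<open>rot (t * s)\<close> acts there.\<close>
  define z where "z i = - \<i> * complex_of_int (wt l i) * of_real s" for i
  have kd: "dec (kact GM (rot (t * s)) v) i = (if i \<in> S then exp (z i * of_real t) \<odot>\<^bsub>U\<^esub> dec v i else \<zero>\<^bsub>N\<^esub>)" for t i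
    using v by (auto simp: kact_rot_dec S_def z_def mult_ac simp del: dec_ops(5))
  have gd: "dec (gact GM (complexify (s *\<^sub>R J_mat)) v) i = (if i \<in> S then z i \<odot>\<^bsub>U\<^esub> dec v i else \<zero>\<^bsub>N\<^esub>)" for i
    using v by (intro N_eqI) (auto simp: J_mat_eq coord_scale functional_gfun nf S_def z_def)
  have "((\<lambda>t. \<phi> (kact GM (rot (t * s)) v)) has_vector_derivative \<phi> (gact GM (complexify (s *\<^sub>R J_mat)) v)) (at 0)"
    if \<phi>: "\<phi> \<in> dual_space GM (Sp S)" for \<phi>
  proof -
    have "\<phi> (kact GM (rot (t * s)) v) = (\<Sum>i\<in>S. exp (z i * of_real t) * \<phi> (pg i v))" for t
      using v kd by (intro dual_finsum_Sp[OF \<phi> S]) auto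
    moreover have "\<phi> (gact GM (complexify (s *\<^sub>R J_mat)) v) = (\<Sum>i\<in>S. z i * \<phi> (pg i v))"
      using v gd by (intro dual_finsum_Sp[OF \<phi> S]) auto
    moreover have "((\<lambda>t. \<Sum>i\<in>S. exp (z i * of_real t) * \<phi> (pg i v)) has_vector_derivative
        (\<Sum>i\<in>S. z i * (exp (z i * of_real 0) * \<phi> (pg i v)))) (at 0)"
      by (intro has_vector_derivative_sum exp_deriv)
    ultimately show ?thesis by simp
  qed
  then show ?thesis
    unfolding has_derivative_at_0_def
    using v by (intro exI[of _ "Sp S"]) (auto simp: Sp_fd[OF S] Sp_iff kd gd simp del: dec_ops)
qed

lemma GM_gk: "is_gk_module GM"
  unfolding is_gk_module_def
  using GM.cvec GM_lie GM_kact GM_locally_smooth GM_Ad GM_derivative by blast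

end

sublocale gmod \<subseteq> GK: gk GM
  by (rule gk.intro) (rule GM_gk)

context gk
begin

section \<open>Submodules generated by a finite set\<close>

lemma U_operators_closed: "a \<in> U_operators M \<Longrightarrow> v \<in> V \<Longrightarrow> a v \<in> V"
  by (induction a arbitrary: v rule: U_operators.induct) auto

text \<open>The submodule over the enveloping algebra generated by a finite \<open>S\<close>, in the
  form in which \<open>finitely_generated_U\<close> speaks of it.\<close>

definition gen :: "'u set \<Rightarrow> 'u set" where
  "gen S = {\<Oplus>s\<in>S. a s s | a. \<forall>s\<in>S. a s \<in> U_operators M}"

lemma gen_closed:
  assumes S: "finite S" "S \<subseteq> V"
  shows gen_V: "v \<in> gen S \<Longrightarrow> v \<in> V"
    and gen_add: "v \<in> gen S \<Longrightarrow> w \<in> gen S \<Longrightarrow> v \<oplus> w \<in> gen S"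
    and gen_smult: "v \<in> gen S \<Longrightarrow> c \<odot> v \<in> gen S"
    and gen_gact: "v \<in> gen S \<Longrightarrow> Z \<in> sl2c \<Longrightarrow> gact M Z v \<in> gen S"
    and gen_superset: "v \<in> S \<Longrightarrow> v \<in> gen S"
proof -
  have mem: "a s s \<in> V" if "\<forall>s\<in>S. a s \<in> U_operators M" "s \<in> S" for a s
    using that S(2) U_operators_closed[of "a s" s] by auto
  show 1: "v \<in> V" if "v \<in> gen S" for v
    using that mem by (auto simp: gen_def intro!: M.finsum_closed)
  show "v \<oplus> w \<in> gen S" if "v \<in> gen S" "w \<in> gen S" for v w
  proof -
    obtain a b where ab: "\<forall>s\<in>S. a s \<in> U_operators M" "v = (\<Oplus>s\<in>S. a s s)"
      "\<forall>s\<in>S. b s \<in> U_operators M" "w = (\<Oplus>s\<in>S. b s s)" using \<open>v \<in> gen S\<close> \<open>w \<in> gen S\<close> by (auto simp: gen_def)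
    have "v \<oplus> w = (\<Oplus>s\<in>S. a s s \<oplus> b s s)"
      unfolding ab using mem ab(1,3) by (intro M.finsum_addf[symmetric]) auto
    then show ?thesis
      using ab(1,3) unfolding gen_def
      by (intro CollectI exI[of _ "\<lambda>s v. a s v \<oplus> b s v"]) (auto intro: U_operators.plus)
  qed
  show "c \<odot> v \<in> gen S" if v: "v \<in> gen S" for c v
  proof -
    obtain a where ab: "\<forall>s\<in>S. a s \<in> U_operators M" "v = (\<Oplus>s\<in>S. a s s)" using v by (auto simp: gen_def)
    have "c \<odot> v = (\<Oplus>s\<in>S. c \<odot> a s s)"
      unfolding ab using mem ab(1) S(1) by (intro finsum_smult_ldistr) auto
    then show ?thesis
      using ab(1) unfolding gen_def
      by (intro CollectI exI[of _ "\<lambda>s v. c \<odot> a s v"]) (auto intro: U_operators.scale)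
  qed
  show "gact M Z v \<in> gen S" if v: "v \<in> gen S" and Z: "Z \<in> sl2c" for v Z
  proof -
    obtain a where ab: "\<forall>s\<in>S. a s \<in> U_operators M" "v = (\<Oplus>s\<in>S. a s s)" using v by (auto simp: gen_def)
    have "gact M Z v = (\<Oplus>s\<in>S. gact M Z (a s s))"
      unfolding ab using mem ab(1) S(1) by (intro linear_map_finsum[OF cvec_axioms cvec_axioms gact_linear[OF Z]]) auto
    then show ?thesis
      using ab(1) Z unfolding gen_def
      by (intro CollectI exI[of _ "\<lambda>s v. gact M Z (a s v)"]) (auto intro: U_operators.times U_operators.lie)
  qed
  show "v \<in> gen S" if v: "v \<in> S" for v
  proof -
    have "v \<in> span_of S" using span_of_superset[OF S v] .
    then obtain c where "v = (\<Oplus>s\<in>S. c s \<odot> s)" by (auto simp: span_of_def)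
    then show ?thesis unfolding gen_def
      by (intro CollectI exI[of _ "\<lambda>s v. c s \<odot> v"]) (auto intro: U_operators.scale U_operators.one)
  qed
qed

end

context gmod
begin

section \<open>Weights, generators and Casimir operator of the constructed module\<close>

lemma gfun_basis:
  assumes "\<And>j. f j \<in> carrier N"
  shows "gfun X_mat f i = xa (i - 1) (f (i - 1))" "gfun Y_mat f i = ea (i + 1) (f (i + 1))"
    "gfun H_mat f i = of_int (wt l i) \<odot>\<^bsub>U\<^esub> f i"
  using assms by (intro N_eqI; simp add: functional_gfun nf)+

lemma weight_space_GM:
  "v \<in> weight_space GM n \<longleftrightarrow> v \<in> carrier GM \<and> (\<forall>i. wt l i \<noteq> n \<longrightarrow> dec v i = \<zero>\<^bsub>N\<^esub>)"
proof (cases "v \<in> carrier GM")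
  case True
  note v = this
  have "gact GM H_mat v = of_int n \<odot>\<^bsub>GM\<^esub> v \<longleftrightarrow> (\<forall>i. wt l i \<noteq> n \<longrightarrow> dec v i = \<zero>\<^bsub>N\<^esub>)"
  proof
    assume eq: "gact GM H_mat v = of_int n \<odot>\<^bsub>GM\<^esub> v"
    show "\<forall>i. wt l i \<noteq> n \<longrightarrow> dec v i = \<zero>\<^bsub>N\<^esub>"
    proof (intro allI impI N_eqI)
      fix i \<phi> assume i: "wt l i \<noteq> n" and \<phi>: "\<phi> \<in> dual_space U (carrier N)"
      have "\<phi> (dec (gact GM H_mat v) i) = \<phi> (dec (of_int n \<odot>\<^bsub>GM\<^esub> v) i)" by (simp only: eq)
      then have "of_int (wt l i) * \<phi> (dec v i) = of_int n * \<phi> (dec v i)"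
        using v \<phi> by (simp add: gfun_basis nf del: of_int_add of_int_diff of_int_minus of_int_mult)
      then show "\<phi> (dec v i) = \<phi> \<zero>\<^bsub>N\<^esub>"
        using i \<phi> by (simp add: nf del: of_int_add of_int_diff of_int_minus of_int_mult)
    qed (use v in auto)
  next
    assume *: "\<forall>i. wt l i \<noteq> n \<longrightarrow> dec v i = \<zero>\<^bsub>N\<^esub>"
    have "of_int (wt l i) \<odot>\<^bsub>U\<^esub> dec v i = of_int n \<odot>\<^bsub>U\<^esub> dec v i" for i
      using * by (cases "wt l i = n") (auto simp del: of_int_add of_int_diff of_int_minus of_int_mult)
    then show "gact GM H_mat v = of_int n \<odot>\<^bsub>GM\<^esub> v"
      using v by (intro GM_vecI) (auto simp: gfun_basis simp del: of_int_add of_int_diff of_int_minus of_int_mult)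
  qed
  then show ?thesis using v by (simp add: weight_space_def)
qed (simp add: weight_space_def)

lemma weight_space_Wg: "weight_space GM (wt l i) = Wg i"
  by (auto simp: weight_space_GM Wg_def)

lemma weight_space_trivial: "odd (n + int l + 1) \<Longrightarrow> weight_space GM n = {\<zero>\<^bsub>GM\<^esub>}"
proof -
  assume n: "odd (n + int l + 1)"
  have ne: "wt l i \<noteq> n" for i
  proof
    assume "wt l i = n"
    then have "n + int l + 1 = 2 * i" by simp
    then show False using n by simp
  qed
  have "v = \<zero>\<^bsub>GM\<^esub>" if "v \<in> weight_space GM n" for v
    using that ne by (intro GM_vecI) (auto simp: weight_space_GM)
  moreover have "\<zero>\<^bsub>GM\<^esub> \<in> weight_space GM n" by (simp add: weight_space_GM)
  ultimately show ?thesis by blast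
qed

text \<open>The sum runs over all integers. Those of the wrong parity have zero weight space, and
  the others are the \<open>wt l i\<close>, so the projections are the \<open>pg i\<close> under
  another numbering.\<close>

lemma GM_ids: "internal_direct_sum GM (weight_space GM)"
proof -
  define q where "q n = (if even (n + int l + 1) then pg ((n + int l + 1) div 2) else (\<lambda>_. \<zero>\<^bsub>GM\<^esub>))" for n
  have q_wt: "q (wt l i) = pg i" for i by (simp add: q_def)
  have ex: "n = wt l ((n + int l + 1) div 2)" if "even (n + int l + 1)" for n
    using even_two_times_div_two[OF that] by linarith
  have W: "(\<exists>i. n = wt l i \<and> weight_space GM n = Wg i \<and> q n = pg i) \<or>
      (weight_space GM n = {\<zero>\<^bsub>GM\<^esub>} \<and> q n = (\<lambda>_. \<zero>\<^bsub>GM\<^esub>) \<and> (\<forall>i. n \<noteq> wt l i))" for n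
  proof (cases "even (n + int l + 1)")
    case True
    then show ?thesis using ex[OF True] weight_space_Wg q_wt by metis
  next
    case False
    then have "n \<noteq> wt l i" for i by auto
    then show ?thesis using False weight_space_trivial[OF False] by (simp add: q_def)
  qed
  have "graded GM (weight_space GM) q"
  proof (intro graded.intro graded_axioms.intro GM_cvec)
    show "submodule (weight_space GM n) CC GM" for n by (rule GK.submodule_weight_space)
    fix v n assume v: "v \<in> carrier GM"
    show "q n v \<in> weight_space GM n" using W[of n] v GM.p_mem[OF v] by auto
    show "q n (c \<odot>\<^bsub>GM\<^esub> v) = c \<odot>\<^bsub>GM\<^esub> q n v" for c using W[of n] v GM.p_smult[OF v] by auto
    have "{n. q n v \<noteq> \<zero>\<^bsub>GM\<^esub>} \<subseteq> wt l ` {i. pg i v \<noteq> \<zero>\<^bsub>GM\<^esub>}"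
    proof
      fix n assume n: "n \<in> {n. q n v \<noteq> \<zero>\<^bsub>GM\<^esub>}"
      then show "n \<in> wt l ` {i. pg i v \<noteq> \<zero>\<^bsub>GM\<^esub>}" using W[of n] by auto
    qed
    then show "finite {n. q n v \<noteq> \<zero>\<^bsub>GM\<^esub>}" using GM.p_finite[OF v] finite_subset by blast
    fix w assume w: "w \<in> carrier GM"
    show "q n (v \<oplus>\<^bsub>GM\<^esub> w) = q n v \<oplus>\<^bsub>GM\<^esub> q n w" using W[of n] GM.p_add[OF v w] by auto
    show "v = w" if "\<And>n. q n v = q n w"
      using that[of "wt l _"] unfolding q_wt by (rule GM.p_ext[OF v w])
  next
    fix v n assume v: "v \<in> weight_space GM n"
    then have vC: "v \<in> carrier GM" by (simp add: weight_space_GM)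
    show "q n v = v" using W[of n] v GM.p_same by auto
    fix n' assume "n' \<noteq> n"
    then show "q n' v = \<zero>\<^bsub>GM\<^esub>" using W[of n] W[of n'] v GM.p_other GM.p_zero by auto
  qed
  then show ?thesis by (rule graded.internal_direct_sum)
qed

lemma X_sg: "u \<in> Cm N l i \<Longrightarrow> gact GM X_mat (sg i u) = sg (i + 1) (xa i u)"
  and Y_sg: "u \<in> Cm N l i \<Longrightarrow> gact GM Y_mat (sg i u) = sg (i - 1) (ea i u)"
  using xa_Cm[of u i] ea_Cm[of u i] Cm_mem[of u i]
  by (auto intro!: GM_vecI simp: gfun_basis dec_sg)

lemma Cm_eq: "cc l i = cc l j \<Longrightarrow> Cm N l i = Cm N l j"
  by (simp add: Cm_def)

lemma Cm_fixed: "u \<in> Cm N l i \<Longrightarrow> mat_elem (cc l i) (cc l i) 1 \<odot>\<^bsub>N\<^esub> u = u"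
  by (simp add: Cm_def)

lemma X_sg_chain: "u \<in> Cm N l i \<Longrightarrow> 0 < i \<Longrightarrow> i \<noteq> int l \<Longrightarrow> gact GM X_mat (sg i u) = sg (i + 1) u"
  using Cm_fixed[of u i] by (simp add: X_sg, simp add: xi_def cc_def split: if_splits)

lemma Y_sg_chain: "u \<in> Cm N l i \<Longrightarrow> i \<le> 0 \<Longrightarrow> gact GM Y_mat (sg i u) = sg (i - 1) u"
  using Cm_fixed[of u i] by (simp add: Y_sg, simp add: et_def cc_def)

text \<open>The degrees \<open>0\<close>, \<open>1\<close> and \<open>l + 1\<close> generate:
  \<open>Y\<close> below \<open>0\<close>, and \<open>X\<close> above \<open>1\<close> and above
  \<open>l + 1\<close>, merely copy a component to the next degree, so all degrees of a chain are
  reached from its first one.\<close>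

lemma GM_fg: "finitely_generated_U GM"
proof -
  obtain B where B: "\<And>i. B i \<subseteq> Wg i" "\<And>i. finite (B i)" "\<And>i. Wg i \<subseteq> GM.span_of (B i)"
    using Wg_fd unfolding GM.fd_subspace_iff by metis
  define S where "S = B 0 \<union> B 1 \<union> B (int l + 1)"
  have "B i \<subseteq> carrier GM" for i using B(1)[of i] GM.W_mem[of _ i] by blast
  then have S: "finite S" "S \<subseteq> carrier GM" using B(2) by (simp_all add: S_def)
  note cl = GK.gen_add[OF S] GK.gen_smult[OF S] GK.gen_V[OF S] GK.gen_gact[OF S] GK.gen_superset[OF S]
  have sub: "Wg i \<subseteq> GK.gen S" if i: "B i \<subseteq> S" for i
  proof -
    have "\<zero>\<^bsub>GM\<^esub> \<in> GK.gen S"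
    proof -
      have "(\<Oplus>\<^bsub>GM\<^esub>s\<in>S. (\<lambda>v. 0 \<odot>\<^bsub>GM\<^esub> v) s) = \<zero>\<^bsub>GM\<^esub>"
        by (rule GM.vector_eqI) (use S in \<open>auto simp: GM.functional_finsum GM.functional_zero Pi_def subset_iff
          intro!: GM.M.finsum_closed\<close>)
      then show ?thesis unfolding GK.gen_def
        by (intro CollectI exI[of _ "\<lambda>s v. 0 \<odot>\<^bsub>GM\<^esub> v"]) (auto intro: U_operators.scale U_operators.one)
    qed
    then have "submodule (GK.gen S) CC GM"
      using cl by (intro GM.submoduleI') auto
    then have "GM.span_of (B i) \<subseteq> GK.gen S"
      using B(2) i cl(5) by (intro GM.span_of_minimal) auto
    then show ?thesis using B(3) by blast
  qed
  have base: "Wg 0 \<subseteq> GK.gen S" "Wg 1 \<subseteq> GK.gen S" "Wg (int l + 1) \<subseteq> GK.gen S"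
    by (intro sub; auto simp: S_def)+
  have up: "Wg (i + 1) \<subseteq> GK.gen S" if i: "Wg i \<subseteq> GK.gen S" "0 < i" "i \<noteq> int l" for i
  proof
    fix v assume v: "v \<in> Wg (i + 1)"
    have u: "dec v (i + 1) \<in> Cm N l i"
      using dec_Cm[of v "i + 1"] v Cm_eq[of "i + 1" i] i by (auto simp: Wg_def cc_def split: if_splits)
    have "v = gact GM X_mat (sg i (dec v (i + 1)))"
      using Wg_eq[OF v] X_sg_chain[OF u i(2,3)] by simp
    moreover have "gact GM X_mat (sg i (dec v (i + 1))) \<in> GK.gen S"
      using sg_Wg[OF u] i(1) by (intro cl(4)) auto
    ultimately show "v \<in> GK.gen S" by (rule ssubst)
  qed
  have down: "Wg (i - 1) \<subseteq> GK.gen S" if i: "Wg i \<subseteq> GK.gen S" "i \<le> 0" for i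
  proof
    fix v assume v: "v \<in> Wg (i - 1)"
    have u: "dec v (i - 1) \<in> Cm N l i"
      using dec_Cm[of v "i - 1"] v Cm_eq[of "i - 1" i] i by (auto simp: Wg_def cc_def split: if_splits)
    have "v = gact GM Y_mat (sg i (dec v (i - 1)))"
      using Wg_eq[OF v] Y_sg_chain[OF u i(2)] by simp
    moreover have "gact GM Y_mat (sg i (dec v (i - 1))) \<in> GK.gen S"
      using sg_Wg[OF u] i(1) by (intro cl(4)) auto
    ultimately show "v \<in> GK.gen S" by (rule ssubst)
  qed
  have neg: "Wg (- int k) \<subseteq> GK.gen S" for k
  proof (induction k)
    case (Suc k)
    have "- int (Suc k) = - int k - 1" by simp
    then show ?case using down[OF Suc] by (simp only:)
  qed (use base in simp)
  have mid: "Wg (1 + int k) \<subseteq> GK.gen S" if "k < l" for k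
    using that
  proof (induction k)
    case (Suc k)
    have "1 + int (Suc k) = 1 + int k + 1" by simp
    then show ?case using up[of "1 + int k"] Suc by (simp only:)
  qed (use base in simp)
  have pos: "Wg (int l + 1 + int k) \<subseteq> GK.gen S" for k
  proof (induction k)
    case (Suc k)
    have "int l + 1 + int (Suc k) = int l + 1 + int k + 1" by simp
    then show ?case using up[OF Suc] by (simp only:)
  qed (use base in simp)
  have all: "Wg i \<subseteq> GK.gen S" for i
  proof -
    consider "i \<le> 0" | "0 < i" "i \<le> int l" | "int l < i" by linarith
    then show ?thesis
    proof cases
      case 1
      then show ?thesis using neg[of "nat (- i)"] by simp
    next
      case 2
      then show ?thesis using mid[of "nat (i - 1)"] by auto
    next
      case 3
      then show ?thesis using pos[of "nat (i - int l - 1)"] by simp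
    qed
  qed
  have "v \<in> GK.gen S" if "v \<in> carrier GM" for v
    using that by (induction v rule: GM.graded_induct) (use all cl in auto)
  then show ?thesis
    unfolding finitely_generated_U_def using S by (intro exI[of _ S]) (fastforce simp: GK.gen_def)
qed

lemma GM_HC: "harish_chandra GM"
  unfolding harish_chandra_def
proof (intro conjI allI GM_gk GM_fg GM_ids)
  fix n
  show "fd_subspace GM (weight_space GM n)"
  proof (cases "even (n + int l + 1)")
    case True
    then have "n = wt l ((n + int l + 1) div 2)" using even_two_times_div_two by fastforce
    then show ?thesis using weight_space_Wg Wg_fd by metis
  next
    case False
    have "submodule {\<zero>\<^bsub>GM\<^esub>} CC GM" by (rule GM.submoduleI') auto
    moreover have "{\<zero>\<^bsub>GM\<^esub>} \<subseteq> GM.span_of {}" by (auto simp: GM.span_of_def)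
    ultimately show ?thesis
      unfolding weight_space_trivial[OF False] GM.fd_subspace_iff by (auto intro!: exI[of _ "{}"])
  qed
qed

text \<open>The scalar in \<open>XY_Cm\<close> was chosen to absorb the contribution of the weight,
  so only the term \<open>4 tT\<close> survives. Nilpotency of \<open>tT\<close> thereby becomes the
  condition on the Casimir element.\<close>

lemma dec_casimir:
  assumes v: "v \<in> carrier GM"
  shows "dec (casimir GM v \<ominus>\<^bsub>GM\<^esub> ((of_nat l)\<^sup>2 - 1) \<odot>\<^bsub>GM\<^esub> v) i = 4 \<odot>\<^bsub>U\<^esub> tT (dec v i)"
proof (rule N_eqI)
  fix \<phi> assume \<phi>: "\<phi> \<in> dual_space U (carrier N)"
  have XY: "xa (i - 1) (ea i (dec v i)) = tT (dec v i) \<oplus>\<^bsub>N\<^esub> kap l i \<odot>\<^bsub>U\<^esub> dec v i"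
    using XY_Cm[OF dec_Cm[OF v]] .
  have d: "dec (gact GM Y_mat v) = (\<lambda>i. ea (i + 1) (dec v (i + 1)))"
    "dec (gact GM H_mat v) = (\<lambda>i. of_int (wt l i) \<odot>\<^bsub>U\<^esub> dec v i)"
    using v by (auto simp: gfun_basis)
  show "\<phi> (dec (casimir GM v \<ominus>\<^bsub>GM\<^esub> ((of_nat l)\<^sup>2 - 1) \<odot>\<^bsub>GM\<^esub> v) i) = \<phi> (4 \<odot>\<^bsub>U\<^esub> tT (dec v i))"
    using v \<phi>
    by (simp add: casimir_def dec_minus gfun_basis d XY nf kap_def power2_eq_square)
      (simp add: algebra_simps)
qed (use v in \<open>auto simp: casimir_def\<close>)

lemma GM_in_HC_l: "in_HC_l l GM"
  unfolding in_HC_l_def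
proof
  show "internal_direct_sum GM (\<lambda>i. weight_space GM (wt l i))"
    unfolding weight_space_Wg using GM.internal_direct_sum by (simp add: eta_contract_eq)
  let ?C = "\<lambda>w. casimir GM w \<ominus>\<^bsub>GM\<^esub> ((of_nat l)\<^sup>2 - 1) \<odot>\<^bsub>GM\<^esub> w"
  have C: "?C w \<in> carrier GM" if "w \<in> carrier GM" for w
    using that by (simp add: casimir_def)
  have tp: "(tT ^^ n) u \<in> carrier N" if "u \<in> carrier N" for n u
    using G.T_pow_closed[of u n] that by simp
  have "(?C ^^ n) v \<in> carrier GM \<and> (\<forall>i. dec ((?C ^^ n) v) i = 4 ^ n \<odot>\<^bsub>U\<^esub> (tT ^^ n) (dec v i))"
    if v: "v \<in> carrier GM" for n v
  proof (induction n)
    case 0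
    then show ?case using v smult_1[unfolded U_simps] by simp
  next
    case (Suc n)
    have "tT (c \<odot>\<^bsub>U\<^esub> u) = c \<odot>\<^bsub>U\<^esub> tT u" if "u \<in> carrier N" for c u
      using G.T_smult[of u c] that by simp
    then show ?case
      using Suc C v dec_casimir tp[of "dec v _" n] smult_smult[unfolded U_simps] by simp
  qed
  \<comment> \<open>The successor makes the exponent positive, as \<open>in_HC_l\<close> demands;
    \<open>nilA\<close> itself may be \<open>0\<close>.\<close>
  then have "(?C ^^ Suc nilA) v = \<zero>\<^bsub>GM\<^esub>" if "v \<in> carrier GM" for v
    using that G.T_nil_ge[of _ "Suc nilA", unfolded U_simps] by (intro GM_vecI) (auto simp del: funpow.simps)
  then show "\<exists>m>0. \<forall>v\<in>carrier GM. (?C ^^ m) v = \<zero>\<^bsub>GM\<^esub>" by blast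
qed

end

sublocale gmod \<subseteq> HG: hcl GM l
  by unfold_locales (use GM_HC GM_in_HC_l l_pos in auto)

section \<open>The isomorphism between \<open>N\<close> and the image of the constructed
  module\<close>

text \<open>Both projections are additive and agree on homogeneous vectors. This lets the explicit
  \<open>pg\<close> replace the projections that \<open>dproj\<close> obtains by
  description.\<close>

lemma graded_unique:
  assumes "graded M W p" "graded M W q" "v \<in> carrier M"
  shows "p i v = q i v"
proof -
  interpret p: graded M W p by fact
  interpret q: graded M W q by fact
  show ?thesis using assms(3)
  proof (induction v rule: p.graded_induct)
    case (homogeneous j v)
    then show ?case by (cases "i = j") (auto simp: p.p_same q.p_same p.p_other q.p_other)
  qed (simp add: p.p_add q.p_add)
qed

lemma A_homD:
  assumes "f \<in> A_hom N N'"
  shows "v \<in> carrier N \<Longrightarrow> f v \<in> carrier N'"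
    "v \<in> carrier N \<Longrightarrow> w \<in> carrier N \<Longrightarrow> f (v \<oplus>\<^bsub>N\<^esub> w) = f v \<oplus>\<^bsub>N'\<^esub> f w"
    "a \<in> carrier order_A \<Longrightarrow> v \<in> carrier N \<Longrightarrow> f (a \<odot>\<^bsub>N\<^esub> v) = a \<odot>\<^bsub>N'\<^esub> f v"
    "f \<in> extensional (carrier N)"
  using assms by (auto simp: A_hom_def linear_map_def)

text \<open>The explicit map constructed below leads from the given module to the image of the
  functor, whereas essential surjectivity asks for an isomorphism in the opposite direction.\<close>

lemma Rep_A_inverse_iso:
  assumes N: "left_A N" and N': "left_A N'" and f: "f \<in> A_hom N N'"
    and bij: "bij_betw f (carrier N) (carrier N')"
  shows "\<exists>g. is_iso Rep_A N' N g"
proof -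
  interpret N: left_A N by fact
  interpret N': left_A N' by fact
  define g where "g = restrict (inv_into (carrier N) f) (carrier N')"
  have gf: "g (f v) = v" if "v \<in> carrier N" for v
    using bij that A_homD(1)[OF f that] by (simp add: g_def bij_betw_def)
  have fg: "f (g v) = v" and gc: "g v \<in> carrier N" if "v \<in> carrier N'" for v
    using bij that by (auto simp: g_def bij_betw_def f_inv_into_f inv_into_into)
  have inj: "v = w" if "v \<in> carrier N" "w \<in> carrier N" "f v = f w" for v w
    using bij that by (auto simp: bij_betw_def inj_on_def)
  have cl: "v \<oplus>\<^bsub>N\<^esub> w \<in> carrier N" if "v \<in> carrier N" "w \<in> carrier N" for v w
    using N.M.a_closed[of v w] that by simp
  have cl': "v \<oplus>\<^bsub>N'\<^esub> w \<in> carrier N'" if "v \<in> carrier N'" "w \<in> carrier N'" for v w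
    using N'.M.a_closed[of v w] that by simp
  have "g \<in> A_hom N' N"
    unfolding A_hom_def linear_map_def
  proof (intro CollectI conjI ballI)
    show "g \<in> extensional (carrier N')" by (simp add: g_def)
    show "g \<in> carrier N' \<rightarrow> carrier N" using gc by auto
    show "g (v \<oplus>\<^bsub>N'\<^esub> w) = g v \<oplus>\<^bsub>N\<^esub> g w" if "v \<in> carrier N'" "w \<in> carrier N'" for v w
      by (rule inj) (use that in \<open>simp_all add: cl cl' gc fg A_homD(2)[OF f]\<close>)
    show "g (a \<odot>\<^bsub>N'\<^esub> v) = a \<odot>\<^bsub>N\<^esub> g v" if "a \<in> carrier order_A" "v \<in> carrier N'" for a v
      by (rule inj) (use that in \<open>simp_all add: N.act_closed N'.act_closed gc fg A_homD(3)[OF f]\<close>)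
  qed
  moreover have "compose (carrier N') f g = (\<lambda>v\<in>carrier N'. v)"
    by (auto simp: compose_def fg intro!: restrict_ext)
  moreover have "compose (carrier N) g f = (\<lambda>v\<in>carrier N. v)"
    by (auto simp: compose_def gf intro!: restrict_ext)
  ultimately show ?thesis
    using f unfolding is_iso_def Rep_A_def by auto
qed

context gmod
begin

abbreviation ee where "ee r u \<equiv> mat_elem r r 1 \<odot>\<^bsub>N\<^esub> u"

text \<open>The components of \<open>u\<close> are placed in the distinguished degrees of their
  chains; this is the candidate for the isomorphism.\<close>

definition psi :: "'u \<Rightarrow> 'u" where
  "psi u = code (\<lambda>i. if i \<in> range (idx l) then ee (cc l i) u else \<zero>\<^bsub>N\<^esub>)"

lemma ee_closed [simp]: "u \<in> carrier N \<Longrightarrow> ee r u \<in> carrier N"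
  by (simp add: act_closed)

lemma ee_ee: "u \<in> carrier N \<Longrightarrow> ee r (ee s u) = (if r = s then ee r u else \<zero>\<^bsub>N\<^esub>)"
  by (simp add: act_mult mat_elem_mult act_zero_left)

lemma Cm_idx: "Cm N l (idx l r) = {u \<in> carrier N. ee r u = u}"
  by (simp add: Cm_def cc_idx[OF l_pos])

lemma psi_FF: "u \<in> carrier N \<Longrightarrow> (\<lambda>i. if i \<in> range (idx l) then ee (cc l i) u else \<zero>\<^bsub>N\<^esub>) \<in> FF N l"
  by (auto simp: FF_def Cm_closed Cm_def ee_ee a_linear[OF mat_elem_eps_in(3)]
      intro: rev_finite_subset[of "range (idx l)"])

lemma psi_mem [simp]: "u \<in> carrier N \<Longrightarrow> psi u \<in> carrier GM"
  by (simp add: psi_def code_mem psi_FF)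

lemma dec_psi: "u \<in> carrier N \<Longrightarrow> dec (psi u) i = (if i \<in> range (idx l) then ee (cc l i) u else \<zero>\<^bsub>N\<^esub>)"
  by (simp add: psi_def psi_FF)

lemma dec_psi_idx: "u \<in> carrier N \<Longrightarrow> dec (psi u) (idx l r) = ee r u"
  by (simp add: dec_psi cc_idx[OF l_pos])

lemma wsp_Wg: "wsp l GM i = Wg i"
  by (simp only: wsp_def weight_space_Wg)

lemma pr_pg: "v \<in> carrier GM \<Longrightarrow> dproj GM (wsp l GM) i v = pg i v"
  using graded_unique[OF HG.graded_axioms, of pg v i] GM_graded wsp_Wg by (metis (no_types, lifting) ext)

lemma EU_eq: "HG.EU = {v \<in> carrier GM. \<forall>i. i \<notin> range (idx l) \<longrightarrow> dec v i = \<zero>\<^bsub>N\<^esub>}"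
  by (auto simp: HG.EU_def pr_pg pg_zero_iff)

lemma psi_EU: "u \<in> carrier N \<Longrightarrow> psi u \<in> HG.EU"
  by (simp add: EU_eq dec_psi)

lemma EU_eqI:
  assumes "v \<in> HG.EU" "w \<in> HG.EU" "\<And>r. dec v (idx l r) = dec w (idx l r)"
  shows "v = w"
proof (rule GM_eqI)
  fix i show "dec v i = dec w i"
    using assms by (cases "i \<in> range (idx l)") (auto simp: EU_eq)
qed (use assms in \<open>auto simp: EU_eq\<close>)

lemma pg_psi: "u \<in> carrier N \<Longrightarrow> pg (idx l r) (psi u) = sg (idx l r) (ee r u)"
  by (simp add: pg_def dec_psi_idx)

lemma idx_inj: "idx l r = idx l s \<longleftrightarrow> r = s"
  by (rule HG.idx_inj)

lemma sg_EU: "u \<in> Cm N l (idx l r) \<Longrightarrow> sg (idx l r) u \<in> HG.EU"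
  by (auto simp: EU_eq dec_sg)

lemma psi_Cm: "u \<in> Cm N l (idx l r) \<Longrightarrow> psi u = sg (idx l r) u"
proof (rule EU_eqI)
  assume u: "u \<in> Cm N l (idx l r)"
  then have uN: "u \<in> carrier N" and e: "ee r u = u" by (auto simp: Cm_idx)
  show "psi u \<in> HG.EU" using psi_EU[OF uN] .
  show "sg (idx l r) u \<in> HG.EU" using sg_EU[OF u] .
  fix s
  have "ee s u = (if r = s then u else \<zero>\<^bsub>N\<^esub>)" using ee_ee[OF uN, of s r] e by auto
  then show "dec (psi u) (idx l s) = dec (sg (idx l r) u) (idx l s)"
    using u uN by (auto simp: dec_psi_idx dec_sg idx_inj)
qed

text \<open>Between the degrees \<open>1\<close> and \<open>l\<close> the constructed
  \<open>X\<close> only copies.\<close>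

lemma Xs_sg:
  assumes u: "u \<in> Cm N l 1"
  shows "X_star l GM (sg 1 u) = sg (int l) u"
proof -
  have "(gact GM X_mat ^^ k) (sg 1 u) = sg (1 + int k) u" if "k < l" for k
    using that
  proof (induction k)
    case (Suc k)
    have "u \<in> Cm N l (1 + int k)" using u Cm_eq[of 1 "1 + int k"] Suc.prems by (simp add: cc_def)
    from X_sg_chain[OF this] Suc show ?case by (simp add: add.commute add.left_commute)
  qed simp
  from this[of "l - 1"] show ?thesis using l_pos by (simp add: X_star_def of_nat_diff)
qed

lemma psi_A_hom: "restrict psi (carrier N) \<in> A_hom N HG.E"
proof -
  interpret UE: left_A HG.E by (rule HG.left_A_E)
  have psi_lin: "psi (u \<oplus>\<^bsub>N\<^esub> w) = psi u \<oplus>\<^bsub>GM\<^esub> psi w" "psi (c \<odot>\<^bsub>U\<^esub> u) = c \<odot>\<^bsub>GM\<^esub> psi u"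
    if "u \<in> carrier N" "w \<in> carrier N" for u w c
    using that by (auto intro!: GM_vecI simp: dec_psi a_linear[OF mat_elem_eps_in(3)])
  have idx: "idx l 1 = 1" "idx l 2 = 0" "idx l 3 = int l + 1" by (simp_all add: idx_def)
  have "linear_map order_A N HG.E (restrict psi (carrier N))"
  proof (rule A_linearI[OF left_A_axioms HG.left_A_E])
    show "linear_map CC U UE.U (restrict psi (carrier N))"
      by (auto simp: linear_map_def psi_EU psi_lin HG.G.underlying_OM[unfolded HG.E_eq[symmetric], simplified])
    fix u assume u: "u \<in> carrier N"
    have pE: "psi u \<in> HG.EU" by (rule psi_EU[OF u])
    have eC: "ee r u \<in> Cm N l (idx l r)" for r using u by (simp add: Cm_idx ee_ee)
    have pp: "dproj GM (wsp l GM) (idx l r) (psi u) = sg (idx l r) (ee r u)" for r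
      using u by (simp add: pr_pg pg_psi)
    have psi_e: "psi (ee r u) = sg (idx l r) (ee r u)" for r by (rule psi_Cm[OF eC])
    show "restrict psi (carrier N) (ee r u) = mat_elem r r 1 \<odot>\<^bsub>HG.E\<^esub> restrict psi (carrier N) u" for r
      using u pE by (simp add: HG.E_mat_elem pp psi_e)
    have aC: "mat_elem 1 2 fps_X \<odot>\<^bsub>N\<^esub> u \<in> Cm N l (idx l 1)" "mat_elem 2 1 1 \<odot>\<^bsub>N\<^esub> u \<in> Cm N l (idx l 2)"
      "mat_elem 1 3 fps_X \<odot>\<^bsub>N\<^esub> u \<in> Cm N l (idx l 1)" "mat_elem 3 1 1 \<odot>\<^bsub>N\<^esub> u \<in> Cm N l (idx l 3)"
      and ar: "mat_elem 1 2 fps_X \<odot>\<^bsub>N\<^esub> ee 2 u = mat_elem 1 2 fps_X \<odot>\<^bsub>N\<^esub> u"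
      "mat_elem 2 1 1 \<odot>\<^bsub>N\<^esub> ee 1 u = mat_elem 2 1 1 \<odot>\<^bsub>N\<^esub> u"
      "mat_elem 1 3 fps_X \<odot>\<^bsub>N\<^esub> ee 3 u = mat_elem 1 3 fps_X \<odot>\<^bsub>N\<^esub> u"
      "mat_elem 3 1 1 \<odot>\<^bsub>N\<^esub> ee 1 u = mat_elem 3 1 1 \<odot>\<^bsub>N\<^esub> u"
      using u by (simp_all add: Cm_idx act_mult act_closed mat_elem_mult mat_elem_in_order_A eps_def)
    have m: "mat_elem 1 2 fps_X \<odot>\<^bsub>N\<^esub> u \<in> carrier N" "mat_elem 2 1 1 \<odot>\<^bsub>N\<^esub> u \<in> carrier N"
      "mat_elem 1 3 fps_X \<odot>\<^bsub>N\<^esub> u \<in> carrier N" "mat_elem 3 1 1 \<odot>\<^bsub>N\<^esub> u \<in> carrier N"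
      using aC by (auto simp: Cm_def)
    have x: "xi l 0 = mat_elem 1 2 fps_X" "et l 1 = mat_elem 2 1 1" "et l (int l + 1) = mat_elem 1 3 fps_X"
      "xi l (int l) = mat_elem 3 1 1"
      using l_pos by (simp_all add: xi_def et_def)
    have eC': "ee 1 u \<in> Cm N l 1" "ee 2 u \<in> Cm N l 0" "ee 3 u \<in> Cm N l (int l + 1)"
      using eC[of 1] eC[of 2] eC[of 3] by (simp_all add: idx)
    have l1: "Cm N l (int l) = Cm N l 1" using l_pos by (intro Cm_eq) (simp add: cc_def)
    have h12: "HG.hth 1 2 (psi u) = sg 1 (mat_elem 1 2 fps_X \<odot>\<^bsub>N\<^esub> u)"
      using pp[of 2] X_sg[OF eC'(2)] by (simp add: HG.hth_def HG.be_def HG.al_def idx x ar)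
    have h21: "HG.hth 2 1 (psi u) = sg 0 (mat_elem 2 1 1 \<odot>\<^bsub>N\<^esub> u)"
      using pp[of 1] Y_sg[OF eC'(1)] by (simp add: HG.hth_def HG.be_def HG.al_def idx x ar)
    have h31: "HG.hth 3 1 (psi u) = sg (int l + 1) (mat_elem 3 1 1 \<odot>\<^bsub>N\<^esub> u)"
      using pp[of 1] Xs_sg[OF eC'(1)] X_sg[of "ee 1 u" "int l"] eC'(1) l1
      by (simp add: HG.hth_def HG.be_def HG.al_def idx x ar)
    have c1: "mat_elem 1 3 fps_X \<odot>\<^bsub>N\<^esub> u \<in> Cm N l 1" using aC(3) by (simp add: idx)
    \<comment> \<open>\<open>X_star\<close> copies a component from degree \<open>1\<close> to
      degree \<open>l\<close>, so its inverse copies it back.\<close>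
    have "HG.Xi (sg (int l) (mat_elem 1 3 fps_X \<odot>\<^bsub>N\<^esub> u)) = sg 1 (mat_elem 1 3 fps_X \<odot>\<^bsub>N\<^esub> u)"
      using sg_Wg[OF c1] Xs_sg[OF c1] by (intro HG.Xi_eqI) (simp_all add: wsp_Wg)
    then have h13: "HG.hth 1 3 (psi u) = sg 1 (mat_elem 1 3 fps_X \<odot>\<^bsub>N\<^esub> u)"
      using pp[of 3] Y_sg[OF eC'(3)] by (simp add: HG.hth_def HG.be_def HG.al_def idx x ar)
    show "restrict psi (carrier N) (mat_elem 1 2 fps_X \<odot>\<^bsub>N\<^esub> u) = mat_elem 1 2 fps_X \<odot>\<^bsub>HG.E\<^esub> restrict psi (carrier N) u"
      "restrict psi (carrier N) (mat_elem 2 1 1 \<odot>\<^bsub>N\<^esub> u) = mat_elem 2 1 1 \<odot>\<^bsub>HG.E\<^esub> restrict psi (carrier N) u"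
      "restrict psi (carrier N) (mat_elem 1 3 fps_X \<odot>\<^bsub>N\<^esub> u) = mat_elem 1 3 fps_X \<odot>\<^bsub>HG.E\<^esub> restrict psi (carrier N) u"
      "restrict psi (carrier N) (mat_elem 3 1 1 \<odot>\<^bsub>N\<^esub> u) = mat_elem 3 1 1 \<odot>\<^bsub>HG.E\<^esub> restrict psi (carrier N) u"
      using u pE m psi_Cm[OF aC(1)] psi_Cm[OF aC(2)] psi_Cm[OF aC(3)] psi_Cm[OF aC(4)]
      by (simp_all add: HG.E_arrows h12 h21 h13 h31 idx)
  qed
  then show ?thesis by (simp add: A_hom_def)
qed

lemma psi_bij: "bij_betw (restrict psi (carrier N)) (carrier N) (carrier HG.E)"
proof -
  have sum: "u = (\<Oplus>\<^bsub>U\<^esub>r\<in>UNIV. ee r u)" if "u \<in> carrier N" for u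
    using G.e_sum[of u] that by (simp add: te_def)
  have "inj_on psi (carrier N)"
  proof (rule inj_onI)
    fix u w assume u: "u \<in> carrier N" and w: "w \<in> carrier N" and eq: "psi u = psi w"
    have "ee r u = ee r w" for r using dec_psi_idx[OF u, of r] dec_psi_idx[OF w, of r] eq by simp
    then show "u = w" using sum[OF u] sum[OF w] by simp
  qed
  moreover have "psi ` carrier N = HG.EU"
  proof
    show "psi ` carrier N \<subseteq> HG.EU" using psi_EU by auto
    show "HG.EU \<subseteq> psi ` carrier N"
    proof
      fix v assume v: "v \<in> HG.EU"
      then have vC: "v \<in> carrier GM" by (simp add: EU_eq)
      have c: "dec v (idx l r) \<in> carrier N" "ee r (dec v (idx l r)) = dec v (idx l r)" for r
        using dec_Cm[OF vC, of "idx l r"] by (simp_all add: Cm_idx)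
      \<comment> \<open>The preimage of \<open>v\<close> is the sum, taken in \<open>N\<close>, of
        its entries in the three distinguished degrees.\<close>
      define u where "u = (\<Oplus>\<^bsub>U\<^esub>r\<in>UNIV. dec v (idx l r))"
      have u: "u \<in> carrier N" unfolding u_def using M.finsum_closed[of "\<lambda>r. dec v (idx l r)" UNIV] c by simp
      have eu: "ee s u = dec v (idx l s)" for s
      proof (rule N_eqI)
        fix \<phi> assume \<phi>: "\<phi> \<in> dual_space U (carrier N)"
        have "(\<lambda>w. \<phi> (ee s w)) \<in> dual_space U (carrier N)"
          using \<phi> by (simp add: dual_space_def a_linear[OF mat_elem_eps_in(3)])
        then have "\<phi> (ee s u) = (\<Sum>r\<in>UNIV. \<phi> (ee s (dec v (idx l r))))"
          unfolding u_def using c by (subst functional_finsum) auto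
        also have "\<dots> = (\<Sum>r\<in>UNIV. if r = s then \<phi> (dec v (idx l s)) else 0)"
          using c ee_ee[of "dec v (idx l _)" s] \<phi>
          by (intro sum.cong refl) (metis functional_zero U_simps(1,3))
        finally show "\<phi> (ee s u) = \<phi> (dec v (idx l s))" by simp
      qed (use u c in auto)
      have "v = psi u"
        using v psi_EU[OF u] by (rule EU_eqI) (auto simp: dec_psi_idx[OF u] eu)
      then show "v \<in> psi ` carrier N" using u by blast
    qed
  qed
  ultimately show ?thesis by (simp add: bij_betw_def inj_on_def)
qed

end

section \<open>The equivalence\<close>

lemma concrete_categoryI:
  assumes "\<And>x y z g f. Cmp C x y z g f = compose (car x) g f" "\<And>x. Idn C x = (\<lambda>v\<in>car x. v)"
    and ext: "\<And>x y f. x \<in> Obj C \<Longrightarrow> y \<in> Obj C \<Longrightarrow> f \<in> Hom C x y \<Longrightarrow> f \<in> extensional (car x) \<inter> (car x \<rightarrow> car y)"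
    and "\<And>x. x \<in> Obj C \<Longrightarrow> (\<lambda>v\<in>car x. v) \<in> Hom C x x"
    and "\<And>x y z f g. x \<in> Obj C \<Longrightarrow> y \<in> Obj C \<Longrightarrow> z \<in> Obj C \<Longrightarrow> f \<in> Hom C x y \<Longrightarrow> g \<in> Hom C y z \<Longrightarrow>
      compose (car x) g f \<in> Hom C x z"
  shows "is_category C"
  unfolding is_category_def assms(1,2)
proof (intro conjI ballI)
  fix x y f assume x: "x \<in> Obj C" and y: "y \<in> Obj C" and f: "f \<in> Hom C x y"
  note e = ext[OF x y f]
  show "compose (car x) f (\<lambda>v\<in>car x. v) = f" "compose (car x) (\<lambda>v\<in>car y. v) f = f"
    using e by (auto simp: compose_def restrict_def extensional_def fun_eq_iff)
next
  fix w x y z f g h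
  assume o: "w \<in> Obj C" "x \<in> Obj C" "y \<in> Obj C" "z \<in> Obj C" and m: "f \<in> Hom C w x" "g \<in> Hom C x y" "h \<in> Hom C y z"
  show "compose (car w) h (compose (car w) g f) = compose (car w) (compose (car x) h g) f"
    using ext[OF o(1,2) m(1)] by (auto simp: compose_def restrict_def fun_eq_iff)
qed (use assms in auto)

lemma Rep_A_category: "is_category Rep_A"
proof (rule concrete_categoryI[where car = carrier])
  fix x y z :: "(fmat3, 'u) module" and f g
  assume "f \<in> Hom Rep_A x y" "g \<in> Hom Rep_A y z"
  then have f: "f \<in> A_hom x y" and g: "g \<in> A_hom y z" by (simp_all add: Rep_A_def)
  assume "x \<in> Obj Rep_A"
  then interpret left_A x by (rule left_A.intro)
  show "compose (carrier x) g f \<in> Hom Rep_A x z"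
    using A_homD[OF f] A_homD[OF g] M.a_closed act_closed
    by (auto simp: Rep_A_def A_hom_def linear_map_def compose_def)
next
  fix x :: "(fmat3, 'u) module" assume "x \<in> Obj Rep_A"
  then interpret left_A x by (rule left_A.intro)
  show "(\<lambda>v\<in>carrier x. v) \<in> Hom Rep_A x x"
    using M.a_closed act_closed by (auto simp: Rep_A_def A_hom_def linear_map_def)
qed (auto simp: Rep_A_def A_hom_def linear_map_def)

lemma HC_l_cat_simps:
  "Hom (HC_l_cat l) = gk_hom" "Cmp (HC_l_cat l) x y z g f = compose (carrier x) g f"
  "Idn (HC_l_cat l) x = (\<lambda>v\<in>carrier x. v)"
  by (simp_all add: HC_l_cat_def HC_cat_def full_subcat_def gk_cat_def)

lemma Obj_HC_l: "l > 0 \<Longrightarrow> M \<in> Obj (HC_l_cat l) \<longleftrightarrow> hcl M l"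
  by (auto simp: HC_l_cat_def HC_cat_def full_subcat_def gk_cat_def hcl_def hcl_axioms_def gk_def
      harish_chandra_def)

lemma HC_l_category:
  assumes "l > 0"
  shows "is_category (HC_l_cat l)"
proof (rule concrete_categoryI[where car = carrier])
  fix x y z :: "'u gk_module" and f g
  assume f: "f \<in> Hom (HC_l_cat l) x y" and g: "g \<in> Hom (HC_l_cat l) y z"
  assume "x \<in> Obj (HC_l_cat l)"
  then interpret hcl x l by (simp add: Obj_HC_l[OF assms])
  note f = gk_homD[OF f[unfolded HC_l_cat_simps]] and g = gk_homD[OF g[unfolded HC_l_cat_simps]]
  show "compose (carrier x) g f \<in> Hom (HC_l_cat l) x z"
    using f(2,3) g(2,3) linear_mapD[OF f(1)] linear_mapD[OF g(1)]
    by (auto simp: HC_l_cat_simps gk_hom_def linear_map_def compose_def)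
next
  fix x :: "'u gk_module" assume "x \<in> Obj (HC_l_cat l)"
  then interpret hcl x l by (simp add: Obj_HC_l[OF assms])
  show "(\<lambda>v\<in>carrier x. v) \<in> Hom (HC_l_cat l) x x"
    by (auto simp: HC_l_cat_simps gk_hom_def linear_map_def)
qed (auto simp: HC_l_cat_simps gk_hom_def linear_map_def)

definition E_functor :: "nat \<Rightarrow> ('u gk_module, 'u \<Rightarrow> 'u, (fmat3, 'u) module, 'u \<Rightarrow> 'u) cat_functor" where
  "E_functor l = \<lparr>on_obj = E_obj l, on_mor = (\<lambda>M M' f. restrict f (hcl.EU M l))\<rparr>"

lemma E_functor_simps: "on_obj (E_functor l) M = E_obj l M" "on_mor (E_functor l) M M' f = restrict f (hcl.EU M l)"
  by (simp_all add: E_functor_def)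

lemma Rep_A_simps: "Hom Rep_A = A_hom" "Cmp Rep_A x y z g f = compose (carrier x) g f"
  "Idn Rep_A x = (\<lambda>v\<in>carrier x. v)"
  by (simp_all add: Rep_A_def)

lemma E_functor_is_functor:
  assumes l: "l > 0"
  shows "is_functor (HC_l_cat l) Rep_A (E_functor l)"
  unfolding is_functor_def
proof (intro conjI ballI HC_l_category[OF l] Rep_A_category)
  fix x :: "'u gk_module" assume x: "x \<in> Obj (HC_l_cat l)"
  interpret A: hcl x l using x by (simp add: Obj_HC_l[OF l])
  show "on_obj (E_functor l) x \<in> Obj Rep_A"
    using left_A.N_obj[OF A.left_A_E] by (simp add: E_functor_simps)
  show "on_mor (E_functor l) x x (Idn (HC_l_cat l) x) = Idn Rep_A (on_obj (E_functor l) x)"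
    using A.EU_V by (auto simp: E_functor_simps HC_l_cat_simps Rep_A_simps intro!: restrict_ext)
  fix y f assume y: "y \<in> Obj (HC_l_cat l)" and f: "f \<in> Hom (HC_l_cat l) x y"
  interpret B: hcl y l using y by (simp add: Obj_HC_l[OF l])
  interpret f: hcl_hom x y l f by unfold_locales (use f in \<open>simp add: HC_l_cat_simps\<close>)
  show "on_mor (E_functor l) x y f \<in> Hom Rep_A (on_obj (E_functor l) x) (on_obj (E_functor l) y)"
    using f.restrict_A_hom by (simp add: E_functor_simps Rep_A_simps)
  fix z g
  show "on_mor (E_functor l) x z (Cmp (HC_l_cat l) x y z g f) =
    Cmp Rep_A (on_obj (E_functor l) x) (on_obj (E_functor l) y) (on_obj (E_functor l) z)
      (on_mor (E_functor l) y z g) (on_mor (E_functor l) x y f)"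
    using A.EU_V f.f_EU
    by (auto simp: E_functor_simps HC_l_cat_simps Rep_A_simps compose_def intro!: restrict_ext)
qed

lemma E_functor_equivalence:
  assumes l: "l > 0"
  shows "is_equivalence (HC_l_cat l) Rep_A (E_functor l)"
proof (rule is_equivalence_if_fully_faithful[OF E_functor_is_functor[OF l]])
  fix x y :: "'u gk_module" assume x: "x \<in> Obj (HC_l_cat l)" and y: "y \<in> Obj (HC_l_cat l)"
  have xh: "hcl x l" and yh: "hcl y l" using x y by (simp_all add: Obj_HC_l[OF l])
  show "bij_betw (on_mor (E_functor l) x y) (Hom (HC_l_cat l) x y)
      (Hom Rep_A (on_obj (E_functor l) x) (on_obj (E_functor l) y))"
    unfolding bij_betw_def E_functor_simps HC_l_cat_simps Rep_A_simps
  proof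
    show "inj_on (\<lambda>f. restrict f (hcl.EU x l)) (gk_hom x y)"
      using gk_hom_eqI[OF xh yh] by (intro inj_onI)
    show "(\<lambda>f. restrict f (hcl.EU x l)) ` gk_hom x y = A_hom (E_obj l x) (E_obj l y)"
    proof
      show "A_hom (E_obj l x) (E_obj l y) \<subseteq> (\<lambda>f. restrict f (hcl.EU x l)) ` gk_hom x y"
        using exists_gk_hom[OF xh yh] by (metis image_eqI subsetI)
      show "(\<lambda>f. restrict f (hcl.EU x l)) ` gk_hom x y \<subseteq> A_hom (E_obj l x) (E_obj l y)"
        using hcl_hom.restrict_A_hom[OF hcl_hom.intro[OF xh yh hcl_hom_axioms.intro]] by auto
    qed
  qed
next
  fix d :: "(fmat3, 'u) module" assume d: "d \<in> Obj Rep_A"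
  interpret left_A d by (rule left_A.intro) (rule d)
  obtain code :: "(int \<Rightarrow> 'u) \<Rightarrow> 'u" where code: "inj_on code (FF d l)" using exists_code[of l] by blast
  interpret gmod d l code by unfold_locales (use l code in auto)
  have "GM \<in> Obj (HC_l_cat l)" using HG.hcl_axioms by (simp add: Obj_HC_l[OF l])
  moreover have "\<exists>f. is_iso Rep_A (E_obj l GM) d f"
    by (rule Rep_A_inverse_iso[OF left_A_axioms HG.left_A_E psi_A_hom psi_bij])
  ultimately show "\<exists>x\<in>Obj (HC_l_cat l). \<exists>f. is_iso Rep_A (on_obj (E_functor l) x) d f"
    unfolding E_functor_simps by blast
qed

theorem theorem1p9:
  fixes l :: nat
  assumes "l > 0"
  shows
    "(\<forall>M\<in>Obj (HC_l_cat l :: ('u gk_module, 'u \<Rightarrow> 'u) cat).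
        linear_map CC (vspace_on M (weight_space M (- int l + 1)))
          (vspace_on M (weight_space M (int l - 1))) (X_star l M) \<and>
        bij_betw (X_star l M) (weight_space M (- int l + 1)) (weight_space M (int l - 1))) \<and>
     (\<exists>E :: ('u gk_module, 'u \<Rightarrow> 'u, (fmat3, 'u) module, 'u \<Rightarrow> 'u) cat_functor.
        is_equivalence (HC_l_cat l) Rep_A E \<and>
        (\<forall>M\<in>Obj (HC_l_cat l). quiver_rep_of (on_obj E M) = gelfand_rep_of l M))"
proof (intro conjI ballI exI[of _ "E_functor l"])
  fix M :: "'u gk_module" assume M: "M \<in> Obj (HC_l_cat l)"
  interpret hcl M l using M by (simp add: Obj_HC_l[OF assms])
  show "bij_betw (X_star l M) (weight_space M (- int l + 1)) (weight_space M (int l - 1))"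
    using Xs_bij by (simp only: wsp_simps)
  then have m: "X_star l M v \<in> weight_space M (int l - 1)" if "v \<in> weight_space M (- int l + 1)" for v
    using that by (auto simp: bij_betw_def)
  have "v \<in> V" if "v \<in> weight_space M n" for v n using that by (simp add: weight_space_def)
  then show "linear_map CC (vspace_on M (weight_space M (- int l + 1)))
      (vspace_on M (weight_space M (int l - 1))) (X_star l M)"
    using m linear_mapD[OF Xs_linear]
    by (auto simp: linear_map_def vspace_on_def)
  show "quiver_rep_of (on_obj (E_functor l) M) = gelfand_rep_of l M"
    using quiver_rep_of_E by (simp add: E_functor_simps)
qed (rule E_functor_equivalence[OF assms])

end
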